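(* Let $k,\ell,m,n$ be positive integers such that $k=3$ or $k\geq 5$. Assume that there is a totally real Galois number field $L$ with $[L:\mathbb{Q}]=\ell$ and $\mathrm{Gal}(L/\mathbb{Q})\cong C_\ell$ (the cyclic group of order $\ell$), containing elements $a_1,\dots,a_n\in\mathcal{O}_L^+$ such that every totally positive quadratic $\mathcal{O}_L$-lattice that represents all of $a_1,\dots,a_n$ has rank $\geq m$. Then there is $B>0$ (depending on $k,\ell,L,a_1,\dots,a_n$) with the following property: for every totally real number field $K$ with $[K:\mathbb{Q}]=k$ whose discriminant satisfies $\mathrm{disc}_K>B$, is coprime to $\mathrm{disc}_L$, and whose Galois closure $\widetilde K$ satisfies $\mathrm{Gal}(\widetilde K/\mathbb{Q})\cong S_k$, we have $[KL:\mathbb{Q}]=k\ell$ and $m(KL)\geq m$.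
   Context: For a totally real number field $F$ of degree $N$ with real embeddings $\sigma_1,\dots,\sigma_N$ and ring of integers $\mathcal{O}_F$, an element $\alpha\in F$ is totally positive if $\sigma_i(\alpha)>0$ for all $i$; $\mathcal{O}_F^+$ is the set of totally positive elements of $\mathcal{O}_F$. $\mathrm{disc}_F$ denotes the discriminant of $F$. A totally positive quadratic $\mathcal{O}_F$-lattice of rank $r$ is a pair $(\Lambda,Q)$ where $\Lambda$ is a finitely generated $\mathcal{O}_F$-submodule of $F^r$ with $\Lambda F=F^r$, $Q:F^r\to F$ is a quadratic form, and $Q(v)\in\mathcal{O}_F^+$ for all nonzero $v\in\Lambda$ (the form need not be classical). The lattice represents $\alpha$ if $Q(v)=\alpha$ for some $v\in\Lambda$, and it is universal if it represents every element of $\mathcal{O}_F^+$. $m(F)$ denotes the minimal rank of a universal totally positive quadratic $\mathcal{O}_F$-lattice. $S_k$ is the symmetric group on $k$ letters and $KL$ denotes the compositum. *)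

theory Defs
  imports
    "HOL-Algebra.Algebraic_Closure_Type"
    "HOL-Algebra.Generated_Fields"
    "HOL-Algebra.Embedded_Algebras"
    "HOL-Algebra.Elementary_Groups"
    "HOL-Algebra.Sym_Groups"
    "HOL-Algebra.Bij"
    "HOL-Library.Extended_Nat"
    "Jordan_Normal_Form.Determinant"
begin

text \<open>
  Number fields are taken inside the algebraically closed field of complex numbers, so that
  composita and Galois closures make sense.
\<close>

abbreviation complex_ring :: "complex ring" where
  "complex_ring \<equiv> ring_of_type_algebra"

definition number_field :: "complex set \<Rightarrow> bool" where
  "number_field K \<longleftrightarrow> subfield K complex_ring \<and> ring.finite_dimension complex_ring \<rat> K"

definition field_degree :: "complex set \<Rightarrow> nat" where
  "field_degree K = ring.dim complex_ring \<rat> K"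

definition compositum :: "complex set \<Rightarrow> complex set \<Rightarrow> complex set" where
  "compositum K L = generate_field complex_ring (K \<union> L)"

text \<open>Embeddings are extensional, so that each one is counted once.\<close>

definition embeddings :: "complex set \<Rightarrow> (complex \<Rightarrow> complex) set" where
  "embeddings K = Ring.ring_hom (complex_ring\<lparr>carrier := K\<rparr>) complex_ring \<inter> extensional K"

definition totally_real :: "complex set \<Rightarrow> bool" where
  "totally_real K \<longleftrightarrow> (\<forall>\<sigma>\<in>embeddings K. \<sigma> ` K \<subseteq> \<real>)"

definition ring_of_integers :: "complex set \<Rightarrow> complex set" where
  "ring_of_integers K = {x \<in> K. algebraic_int x}"

definition totally_positive :: "complex set \<Rightarrow> complex \<Rightarrow> bool" where
  "totally_positive K x \<longleftrightarrow> (\<forall>\<sigma>\<in>embeddings K. \<sigma> x \<in> \<real> \<and> Re (\<sigma> x) > 0)"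

definition positive_integers :: "complex set \<Rightarrow> complex set" where
  "positive_integers K = {x \<in> ring_of_integers K. totally_positive K x}"

definition integral_basis :: "complex set \<Rightarrow> nat \<Rightarrow> (nat \<Rightarrow> complex) \<Rightarrow> bool" where
  "integral_basis K n b \<longleftrightarrow>
     (\<forall>i<n. b i \<in> ring_of_integers K) \<and>
     (\<forall>x\<in>ring_of_integers K.
        \<exists>!c. c \<in> {..<n} \<rightarrow>\<^sub>E (UNIV :: int set) \<and> x = (\<Sum>i<n. of_int (c i) * b i))"

definition field_disc :: "complex set \<Rightarrow> int" where
  "field_disc K = (THE d. \<exists>b \<sigma>. let n = field_degree K in
     integral_basis K n b \<and> bij_betw \<sigma> {..<n} (embeddings K) \<and>
     of_int d = (det (mat n n (\<lambda>(i, j). \<sigma> i (b j))))\<^sup>2)"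

text \<open>
  Galois means normal here, separability being automatic in characteristic zero. Since the complex
  numbers are algebraically closed, a polynomial splits over \<open>L\<close> iff \<open>L\<close> contains all its complex
  roots.
\<close>

definition galois_number_field :: "complex set \<Rightarrow> bool" where
  "galois_number_field L \<longleftrightarrow> number_field L \<and>
     (\<forall>p :: rat poly. Factorial_Ring.irreducible p \<and> (\<exists>x\<in>L. poly (map_poly of_rat p) x = 0) \<longrightarrow>
        (\<forall>z :: complex. poly (map_poly of_rat p) z = 0 \<longrightarrow> z \<in> L))"

definition galois_closure :: "complex set \<Rightarrow> complex set" where
  "galois_closure K = \<Inter> {M. galois_number_field M \<and> K \<subseteq> M}"

definition galois_group :: "complex set \<Rightarrow> (complex \<Rightarrow> complex) monoid" where
  "galois_group K = BijGroup K
     \<lparr>carrier := {\<sigma> \<in> Bij K. (\<forall>x\<in>\<rat>. \<sigma> x = x) \<and>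
        \<sigma> \<in> ring_iso (complex_ring\<lparr>carrier := K\<rparr>) (complex_ring\<lparr>carrier := K\<rparr>)}\<rparr>"

definition coord_space :: "complex set \<Rightarrow> nat \<Rightarrow> complex vec set" where
  "coord_space F r = {v \<in> carrier_vec r. set\<^sub>v v \<subseteq> F}"

definition span_over :: "complex set \<Rightarrow> nat \<Rightarrow> complex vec set \<Rightarrow> complex vec set" where
  "span_over R r S = {finsum_vec TYPE(complex) r (\<lambda>s. c s \<cdot>\<^sub>v s) T | c T.
     finite T \<and> T \<subseteq> S \<and> c ` T \<subseteq> R}"

definition quadratic_form_on :: "complex set \<Rightarrow> nat \<Rightarrow> (complex vec \<Rightarrow> complex) \<Rightarrow> bool" where
  "quadratic_form_on F r Q \<longleftrightarrow>
     (\<exists>c. (\<forall>i<r. \<forall>j<r. c i j \<in> F) \<and>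
        (\<forall>v\<in>coord_space F r. Q v = (\<Sum>j<r. \<Sum>i\<le>j. c i j * v $ i * v $ j)))"

definition tp_quadratic_lattice ::
    "complex set \<Rightarrow> nat \<Rightarrow> complex vec set \<Rightarrow> (complex vec \<Rightarrow> complex) \<Rightarrow> bool" where
  "tp_quadratic_lattice F r \<Lambda> Q \<longleftrightarrow>
     (\<exists>S. finite S \<and> S \<subseteq> coord_space F r \<and> \<Lambda> = span_over (ring_of_integers F) r S) \<and>
     span_over F r \<Lambda> = coord_space F r \<and>
     quadratic_form_on F r Q \<and>
     (\<forall>v\<in>\<Lambda>. v \<noteq> 0\<^sub>v r \<longrightarrow> Q v \<in> positive_integers F)"

definition represents :: "complex vec set \<Rightarrow> (complex vec \<Rightarrow> complex) \<Rightarrow> complex \<Rightarrow> bool" where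
  "represents \<Lambda> Q \<alpha> \<longleftrightarrow> (\<exists>v\<in>\<Lambda>. Q v = \<alpha>)"

definition universal_lattice ::
    "complex set \<Rightarrow> nat \<Rightarrow> complex vec set \<Rightarrow> (complex vec \<Rightarrow> complex) \<Rightarrow> bool" where
  "universal_lattice F r \<Lambda> Q \<longleftrightarrow>
     tp_quadratic_lattice F r \<Lambda> Q \<and> (\<forall>\<alpha>\<in>positive_integers F. represents \<Lambda> Q \<alpha>)"

text \<open>The minimum of a set of ranks, with the convention that the empty set has minimum \<open>\<infinity>\<close>.\<close>

definition min_universal_rank :: "complex set \<Rightarrow> enat" where
  "min_universal_rank F = Inf (enat ` {r. \<exists>\<Lambda> Q. universal_lattice F r \<Lambda> Q})"

end

theory Submission
  imports Defs "Jordan_Normal_Form.Char_Poly"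
begin

text \<open>
  Let \<open>F = K L\<close> and let vectors \<open>v\<^sub>i\<close> of a universal \<open>F\<close>-lattice of rank \<open>r\<close> represent the \<open>a\<^sub>i\<close>.
  By the parallelogram law and positivity, all conjugates of the algebraic integers \<open>Q (v\<^sub>i + v\<^sub>j)\<close> are bounded in
  terms of the \<open>a\<^sub>i\<close>. Since \<open>Gal L\<close> is abelian, commutators of automorphisms of the algebraic numbers fix \<open>L\<close>
  pointwise, whereas they induce all 3-cycles on the \<open>k \<ge> 3\<close> embeddings of \<open>K\<close>. Hence \<open>[F : Q] = k l\<close>, and
  \<open>K \<subseteq> L(\<alpha>)\<close> for every \<open>\<alpha> \<in> F - L\<close>. There are only finitely many algebraic integers \<open>\<alpha>\<close> of bounded degree with
  bounded conjugates, and \<open>L(\<alpha>)\<close> has finitely many subfields; so for all but finitely many \<open>K\<close>, which the choice of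
  \<open>B\<close> excludes, all \<open>Q (v\<^sub>i + v\<^sub>j)\<close> lie in \<open>L\<close>. The polar form is then \<open>L\<close>-valued on the \<open>L\<close>-span of the \<open>v\<^sub>i\<close>,
  and Gram-Schmidt orthogonalisation over \<open>L\<close> turns the \<open>v\<^sub>i\<close> into generators of an \<open>L\<close>-lattice of rank at most \<open>r\<close>
  representing all \<open>a\<^sub>i\<close>, so that \<open>m \<le> r\<close>.
\<close>

text \<open>Two obstacles shape the proof. The fields K vary, so no single finite Galois group can
  host the argument. Everything is therefore phrased through \<open>abs_gal\<close>, the
  automorphisms of all algebraic numbers: embeddings are their restrictions, degrees are numbers of
  embeddings, and an algebraic number lies in a field E as soon as every automorphism fixing E fixes
  it (\<open>abs_gal_fixed_field\<close>). The second obstacle is the rank. Vectors independent over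
  L may be dependent over K L, so the L-span of the vectors that represent the given elements might
  have L-dimension above r. Total positivity rules this out: the form is anisotropic on that span,
  and an orthogonal family of anisotropic vectors is independent over all complex numbers, hence has
  at most r members. That K lies in L(\<alpha>) is a maximality property of point stabilisers: if
  some automorphism fixes L and \<alpha> but moves K, then 3-cycles of embeddings of K transport
  this to every automorphism fixing L, and \<alpha> falls into L.\<close>

no_notation fps_nth (infixl \<open>$\<close> 75)

section \<open>Subfields of the complex numbers\<close>

lemma complex_ring_simps [simp]:
  "carrier complex_ring = UNIV" "monoid.mult complex_ring = (*)" "one complex_ring = 1"
  "ring.zero complex_ring = 0" "add complex_ring = (+)"
  by (simp_all add: ring_of_type_algebra_def)

lemma complex_ring_field: "field complex_ring"
  by (rule field_from_type_algebra)

lemma complex_ring_domain: "domain complex_ring"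
  using complex_ring_field field.axioms(1) by blast

lemma complex_ring_ring: "ring complex_ring"
  by (rule ring_from_type_algebra)

lemma complex_ring_a_inv [simp]: "a_inv complex_ring x = - x"
  using abelian_group.minus_equality[OF ring.is_abelian_group[OF complex_ring_ring], of "- x" x] by simp

lemma complex_ring_m_inv [simp]: "x \<noteq> 0 \<Longrightarrow> m_inv complex_ring x = inverse x"
  using comm_monoid.comm_inv_char[of complex_ring x "inverse x"]
    cring.axioms(2)[OF cring_from_type_algebra] by simp

abbreviation subfld :: "complex set \<Rightarrow> bool" where
  "subfld E \<equiv> subfield E complex_ring"

lemma subfldI:
  assumes "1 \<in> E" "\<And>x y. x \<in> E \<Longrightarrow> y \<in> E \<Longrightarrow> x + y \<in> E" "\<And>x. x \<in> E \<Longrightarrow> - x \<in> E"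
    "\<And>x y. x \<in> E \<Longrightarrow> y \<in> E \<Longrightarrow> x * y \<in> E" "\<And>x. x \<in> E \<Longrightarrow> inverse x \<in> E"
  shows "subfld E"
  by (rule field.subfieldI'[OF complex_ring_field], rule ring.subringI[OF complex_ring_ring])
    (use assms in auto)

lemma
  assumes "subfld E"
  shows subfld_0: "0 \<in> E" and subfld_1: "1 \<in> E"
    and subfld_add: "x \<in> E \<Longrightarrow> y \<in> E \<Longrightarrow> x + y \<in> E"
    and subfld_mult: "x \<in> E \<Longrightarrow> y \<in> E \<Longrightarrow> x * y \<in> E"
    and subfld_minus: "x \<in> E \<Longrightarrow> - x \<in> E"
  using subringE[OF subfieldE(1)[OF assms]] by auto

lemma subfld_inverse:
  assumes "subfld E" "x \<in> E" shows "inverse x \<in> E"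
  using ring.subfield_m_inv(1)[OF complex_ring_ring assms(1), of x] assms subfld_0[OF assms(1)]
  by (cases "x = 0") auto

lemma subfld_diff:
  assumes "subfld E" "x \<in> E" "y \<in> E" shows "x - y \<in> E"
  using subfld_add[OF assms(1,2) subfld_minus[OF assms(1,3)]] by simp

lemma subfld_divide:
  assumes "subfld E" "x \<in> E" "y \<in> E" shows "x / y \<in> E"
  using subfld_mult[OF assms(1,2) subfld_inverse[OF assms(1,3)]] by (simp add: divide_inverse)

lemma subfld_sum: "subfld E \<Longrightarrow> (\<And>i. i \<in> I \<Longrightarrow> f i \<in> E) \<Longrightarrow> sum f I \<in> E"
  by (induction I rule: infinite_finite_induct) (auto simp: subfld_0 subfld_add)

lemma subfld_of_nat: "subfld E \<Longrightarrow> of_nat n \<in> E"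
  by (induction n) (auto simp: subfld_0 subfld_1 subfld_add)

lemma subfld_of_int: "subfld E \<Longrightarrow> of_int n \<in> E"
  by (cases n rule: int_cases2) (auto simp: subfld_of_nat subfld_minus)

lemma subfld_Rats: "subfld E \<Longrightarrow> x \<in> \<rat> \<Longrightarrow> x \<in> E"
  by (erule Rats_cases') (auto simp: subfld_divide subfld_of_int)

lemma Rats_subfld: "subfld \<rat>"
  by (rule subfldI) auto

section \<open>Polynomials with coefficients in a subfield\<close>

definition polys_over :: "complex set \<Rightarrow> complex poly set" where
  "polys_over E = {p. \<forall>i. coeff p i \<in> E}"

lemma polys_overD: "p \<in> polys_over E \<Longrightarrow> coeff p i \<in> E"
  by (simp add: polys_over_def)

lemma polys_over_mono: "E \<subseteq> E' \<Longrightarrow> polys_over E \<subseteq> polys_over E'"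
  by (auto simp: polys_over_def)

context
  fixes E assumes E: "subfld E"
begin

lemma polys_over_0: "0 \<in> polys_over E"
  by (auto simp: polys_over_def subfld_0[OF E])

lemma polys_over_pCons: "pCons a p \<in> polys_over E \<longleftrightarrow> a \<in> E \<and> p \<in> polys_over E"
  by (auto simp: polys_over_def coeff_pCons split: nat.splits)

lemma polys_over_add: "p \<in> polys_over E \<Longrightarrow> q \<in> polys_over E \<Longrightarrow> p + q \<in> polys_over E"
  by (auto simp: polys_over_def subfld_add[OF E])

lemma polys_over_diff: "p \<in> polys_over E \<Longrightarrow> q \<in> polys_over E \<Longrightarrow> p - q \<in> polys_over E"
  by (auto simp: polys_over_def subfld_diff[OF E])

lemma polys_over_mult: "p \<in> polys_over E \<Longrightarrow> q \<in> polys_over E \<Longrightarrow> p * q \<in> polys_over E"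
  by (auto simp: polys_over_def coeff_mult intro!: subfld_sum[OF E] subfld_mult[OF E])

lemma polys_over_smult: "c \<in> E \<Longrightarrow> p \<in> polys_over E \<Longrightarrow> smult c p \<in> polys_over E"
  by (auto simp: polys_over_def subfld_mult[OF E])

lemma polys_over_pderiv: "p \<in> polys_over E \<Longrightarrow> pderiv p \<in> polys_over E"
  by (simp add: polys_over_def coeff_pderiv subfld_mult[OF E subfld_of_nat[OF E]] del: of_nat_Suc)

lemma poly_mem_subfld: "p \<in> polys_over E \<Longrightarrow> x \<in> E \<Longrightarrow> poly p x \<in> E"
  by (induction p) (auto simp: polys_over_pCons subfld_0[OF E] subfld_add[OF E] subfld_mult[OF E])

text \<open>Prepending a coefficient to the dividend raises the degree of the remainder by at most
  one, and subtracting one multiple of the monic \<open>m\<close> restores the bound. No coefficient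
  is ever inverted, so quotient and remainder stay over E.\<close>

lemma polys_over_division:
  assumes "m \<in> polys_over E" "lead_coeff m = 1" "p \<in> polys_over E"
  shows "\<exists>q\<in>polys_over E. \<exists>r\<in>polys_over E. p = q * m + r \<and> (r = 0 \<or> degree r < degree m)"
  using assms(3)
proof (induction p)
  case 0
  show ?case by (rule bexI[of _ 0], rule bexI[of _ 0]) (auto simp: polys_over_0)
next
  case (pCons a p)
  then obtain q r where qr: "q \<in> polys_over E" "r \<in> polys_over E" "p = q * m + r"
    "r = 0 \<or> degree r < degree m" by (auto simp: polys_over_pCons)
  define r1 where "r1 = pCons a r"
  define c where "c = coeff r1 (degree m)"
  have r1: "r1 \<in> polys_over E" using pCons qr by (auto simp: r1_def polys_over_pCons)
  then have c: "c \<in> E" by (auto simp: c_def polys_overD)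
  have deg: "degree r1 \<le> degree m" using qr(4) by (auto simp: r1_def degree_pCons_le)
  define r2 where "r2 = r1 - smult c m"
  have "degree r2 \<le> degree m" unfolding r2_def using deg degree_smult_le[of c m] by (intro degree_diff_le) auto
  moreover have "coeff r2 (degree m) = 0" using assms(2) by (simp add: r2_def c_def)
  ultimately have "r2 = 0 \<or> degree r2 < degree m"
    by (metis eq_zero_or_degree_less)
  moreover have "pCons a p = (pCons c q) * m + r2"
    by (simp add: qr(3) r2_def r1_def)
  moreover have "r2 \<in> polys_over E" "pCons c q \<in> polys_over E"
    using r1 c assms(1) qr by (auto simp: r2_def polys_over_pCons intro!: polys_over_diff polys_over_smult)
  ultimately show ?case by blast
qed

end

section \<open>Minimal polynomials and their roots\<close>

definition is_minpoly :: "complex set \<Rightarrow> complex \<Rightarrow> complex poly \<Rightarrow> bool" where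
  "is_minpoly E x m \<longleftrightarrow> m \<in> polys_over E \<and> lead_coeff m = 1 \<and> poly m x = 0 \<and>
     (\<forall>q\<in>polys_over E. q \<noteq> 0 \<longrightarrow> poly q x = 0 \<longrightarrow> degree m \<le> degree q)"

lemma minpoly_exists:
  assumes E: "subfld E" and p: "p \<in> polys_over E" "p \<noteq> 0" "poly p x = 0"
  shows "\<exists>m. is_minpoly E x m"
proof -
  let ?P = "\<lambda>q. q \<in> polys_over E \<and> q \<noteq> 0 \<and> poly q x = 0"
  obtain q where q: "?P q" "\<And>q'. ?P q' \<Longrightarrow> degree q \<le> degree q'"
    using ex_has_least_nat[of ?P p degree] p by auto
  define m where "m = smult (inverse (lead_coeff q)) q"
  have "lead_coeff q \<in> E" "lead_coeff q \<noteq> 0" using q by (auto simp: polys_overD)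
  then have "is_minpoly E x m" using q
    by (auto simp: is_minpoly_def m_def intro!: polys_over_smult[OF E] subfld_inverse[OF E])
  then show ?thesis ..
qed

lemma is_minpoly_dvd:
  assumes E: "subfld E" and m: "is_minpoly E x m" and q: "q \<in> polys_over E" "poly q x = 0"
  shows "\<exists>s\<in>polys_over E. q = s * m"
proof -
  obtain s r where sr: "s \<in> polys_over E" "r \<in> polys_over E" "q = s * m + r"
    "r = 0 \<or> degree r < degree m"
    using polys_over_division[OF E _ _ q(1), of m] m by (auto simp: is_minpoly_def)
  have "poly r x = 0" using sr(3) q(2) m by (simp add: is_minpoly_def)
  with sr m have "r = 0" by (force simp: is_minpoly_def)
  with sr show ?thesis by auto
qed

lemma monic_degree_0_imp_1: "lead_coeff p = 1 \<Longrightarrow> degree p = 0 \<Longrightarrow> p = 1"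
  by (erule degree_eq_zeroE) simp

lemma is_minpoly_degree_pos: "is_minpoly E x m \<Longrightarrow> degree m > 0"
  using monic_degree_0_imp_1[of m] by (intro gr0I) (auto simp: is_minpoly_def)

text \<open>The minimal polynomial m' of y divides m, say m = s * m', and x is a root of one of the
  two factors. Minimality of m at x excludes s, and then forces s to be constant.\<close>

lemma is_minpoly_other_root:
  assumes E: "subfld E" and m: "is_minpoly E x m" and y: "poly m y = 0"
  shows "is_minpoly E y m"
proof -
  have m0: "m \<noteq> 0" using m by (auto simp: is_minpoly_def)
  obtain m' where m': "is_minpoly E y m'"
    using minpoly_exists[OF E _ m0 y] m by (auto simp: is_minpoly_def)
  obtain s where s: "s \<in> polys_over E" "m = s * m'"
    using is_minpoly_dvd[OF E m' _ y] m by (auto simp: is_minpoly_def)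
  have nz: "s \<noteq> 0" "m' \<noteq> 0" using m0 s by auto
  have deg: "degree m = degree s + degree m'" using nz s by (simp add: degree_mult_eq)
  have "poly s x = 0 \<or> poly m' x = 0" using m s by (auto simp: is_minpoly_def)
  then show ?thesis
  proof
    assume "poly s x = 0"
    then have "degree m \<le> degree s" using m s(1) nz by (auto simp: is_minpoly_def)
    with deg is_minpoly_degree_pos[OF m'] show ?thesis by simp
  next
    assume "poly m' x = 0"
    then have "degree m \<le> degree m'" using m m' nz by (auto simp: is_minpoly_def)
    with deg have "degree s = 0" by simp
    moreover have "lead_coeff s = 1" using m m' s by (auto simp: is_minpoly_def lead_coeff_mult)
    ultimately have "s = 1" using monic_degree_0_imp_1 by blast
    with s m' show ?thesis by simp
  qed
qed

text \<open>Separability in characteristic zero: a multiple root would also be a root of the nonzero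
  derivative, although m has least degree at each of its roots.\<close>

lemma is_minpoly_rsquarefree:
  assumes E: "subfld E" and m: "is_minpoly E x m"
  shows "rsquarefree m"
  unfolding rsquarefree_roots
proof (intro allI notI, elim conjE)
  fix a assume a: "poly m a = 0" "poly (pderiv m) a = 0"
  have ma: "is_minpoly E a m" by (rule is_minpoly_other_root[OF E m a(1)])
  have pos: "degree m > 0" by (rule is_minpoly_degree_pos[OF m])
  have "pderiv m \<noteq> 0" using pos by (simp add: pderiv_eq_0_iff)
  moreover have "pderiv m \<in> polys_over E" using m by (auto simp: is_minpoly_def polys_over_pderiv[OF E])
  ultimately have "degree m \<le> degree (pderiv m)" using ma a(2) by (auto simp: is_minpoly_def)
  with pos show False by (simp add: degree_pderiv)
qed

lemma is_minpoly_card_roots: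
  assumes E: "subfld E" and m: "is_minpoly E x m"
  shows "card {y. poly m y = 0} = degree m"
proof -
  have "m \<noteq> 0" using m by (auto simp: is_minpoly_def)
  then have fin: "finite {y. poly m y = 0}" by (rule poly_roots_finite)
  have "m = (\<Prod>z | poly m z = 0. [:- z, 1:])"
    using complex_poly_decompose_rsquarefree[OF is_minpoly_rsquarefree[OF E m]] m
    by (simp add: is_minpoly_def)
  then have "degree m = degree (\<Prod>z | poly m z = 0. [:- z, 1:])" by simp
  also have "\<dots> = (\<Sum>z | poly m z = 0. degree [:- z, 1:])"
    by (rule degree_prod_eq_sum_degree) auto
  finally show ?thesis by simp
qed

section \<open>Simple extensions as rings of polynomial values\<close>

text \<open>This is the ring E[x]; it is a field precisely when x is algebraic over E, which is the
  only situation of interest here.\<close>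

definition adjoin :: "complex set \<Rightarrow> complex \<Rightarrow> complex set" where
  "adjoin E x = (\<lambda>p. poly p x) ` polys_over E"

text \<open>The list polynomials of the algebra library start with the leading coefficient, hence
  the reversal.\<close>

lemma eval_eq_poly: "ring.eval complex_ring ps x = poly (Poly (rev ps)) x"
proof (induction ps)
  case Nil
  show ?case using ring.eval.simps(1)[OF complex_ring_ring] by simp
next
  case (Cons a ps)
  have "x [^]\<^bsub>complex_ring\<^esub> n = x ^ n" for n :: nat
    by (induction n) (simp_all add: nat_pow_def mult.commute)
  then show ?case using Cons ring.eval.simps(2)[OF complex_ring_ring, of a ps]
    by (simp add: Poly_snoc poly_monom)
qed

lemma set_subset_imp_Poly_polys_over:
  assumes "subfld E" "set ps \<subseteq> E" shows "Poly ps \<in> polys_over E"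
  using assms(2) by (induction ps) (auto simp: polys_over_0[OF assms(1)] polys_over_pCons[OF assms(1)])

lemma algebraic_over_iff:
  assumes E: "subfld E"
  shows "(ring.algebraic complex_ring over E) x \<longleftrightarrow> (\<exists>p\<in>polys_over E. p \<noteq> 0 \<and> poly p x = 0)"
proof
  assume "(ring.algebraic complex_ring over E) x"
  then obtain ps where ps: "ps \<in> carrier (univ_poly complex_ring E)" "ps \<noteq> []" "ring.eval complex_ring ps x = 0"
    using domain.algebraicE[OF complex_ring_domain subfieldE(1)[OF E], of x] by auto
  then have pol: "hd ps \<noteq> 0" "set ps \<subseteq> E"
    by (auto simp: univ_poly_def polynomial_def)
  have "Poly (rev ps) \<in> polys_over E" using pol(2) by (intro set_subset_imp_Poly_polys_over[OF E]) simp
  moreover have "Poly (rev ps) \<noteq> 0"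
  proof
    assume "Poly (rev ps) = 0"
    then have "coeff (Poly (rev ps)) (length ps - 1) = 0" by simp
    then have "nth_default 0 (rev ps) (length ps - 1) = 0" by simp
    with ps(2) pol(1) show False by (simp add: nth_default_def rev_nth hd_conv_nth)
  qed
  ultimately show "\<exists>p\<in>polys_over E. p \<noteq> 0 \<and> poly p x = 0" using ps(3) eval_eq_poly by auto
next
  assume "\<exists>p\<in>polys_over E. p \<noteq> 0 \<and> poly p x = 0"
  then obtain p where p: "p \<in> polys_over E" "p \<noteq> 0" "poly p x = 0" by auto
  have "set (coeffs p) \<subseteq> E" using p(1) subfld_0[OF E] by (auto simp: polys_over_def coeffs_def)
  moreover have "hd (rev (coeffs p)) \<noteq> 0" using p(2) by (simp add: hd_rev last_coeffs_eq_coeff_degree)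
  ultimately have "rev (coeffs p) \<in> carrier (univ_poly complex_ring E)"
    by (auto simp: univ_poly_def polynomial_def)
  moreover have "rev (coeffs p) \<noteq> []" using p(2) by simp
  moreover have "ring.eval complex_ring (rev (coeffs p)) x = 0" using p(3) by (simp add: eval_eq_poly)
  ultimately show "(ring.algebraic complex_ring over E) x"
    using ring.algebraicI[OF complex_ring_ring, of "rev (coeffs p)" E x] by simp
qed

lemma simple_extension_eq_adjoin:
  assumes E: "subfld E"
  shows "ring.simple_extension complex_ring E x = adjoin E x"
proof -
  interpret R: ring complex_ring by (rule complex_ring_ring)
  show ?thesis
  proof (intro equalityI subsetI)
    fix y assume "y \<in> R.simple_extension E x"
    then show "y \<in> adjoin E x"
    proof (induction rule: R.simple_extension.induct)
      case zero
      show ?case using polys_over_0[OF E] by (force simp: adjoin_def)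
    next
      case (lin k1 k2)
      then obtain p where "p \<in> polys_over E" "k1 = poly p x" by (auto simp: adjoin_def)
      then show ?case using lin polys_over_pCons[OF E, of k2 p] unfolding adjoin_def
        by (intro image_eqI[of _ _ "pCons k2 p"]) (auto simp: mult.commute)
    qed
  next
    fix y assume "y \<in> adjoin E x"
    then obtain p where p: "p \<in> polys_over E" "y = poly p x" by (auto simp: adjoin_def)
    have "poly p x \<in> R.simple_extension E x" using p(1)
    proof (induction p)
      case 0
      then show ?case using R.simple_extension.zero by simp
    next
      case (pCons a p)
      then show ?case using R.simple_extension.lin[of "poly p x" E x a]
        by (simp add: polys_over_pCons[OF E] add.commute mult.commute)
    qed
    with p show "y \<in> R.simple_extension E x" by simp
  qed
qed

lemma adjoin_subfld:
  assumes E: "subfld E" and p: "p \<in> polys_over E" "p \<noteq> 0" "poly p x = 0"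
  shows "subfld (adjoin E x)"
  using domain.simple_extension_is_subfield[OF complex_ring_domain E, of x]
    algebraic_over_iff[OF E, of x] p unfolding simple_extension_eq_adjoin[OF E] by auto

lemma adjoin_base:
  assumes "subfld E" shows "E \<subseteq> adjoin E x"
proof
  fix e assume "e \<in> E"
  then have "[:e:] \<in> polys_over E" using assms by (simp add: polys_over_pCons polys_over_0)
  from imageI[OF this, of "\<lambda>p. poly p x"] show "e \<in> adjoin E x" by (simp add: adjoin_def)
qed

lemma adjoin_mem:
  assumes "subfld E" shows "x \<in> adjoin E x"
proof -
  have "[:0, 1:] \<in> polys_over E"
    using assms by (simp add: polys_over_pCons polys_over_0 subfld_0 subfld_1)
  from imageI[OF this, of "\<lambda>p. poly p x"] show ?thesis by (simp add: adjoin_def)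
qed

lemma adjoin_least: "subfld E' \<Longrightarrow> E \<subseteq> E' \<Longrightarrow> x \<in> E' \<Longrightarrow> adjoin E x \<subseteq> E'"
  unfolding adjoin_def using polys_over_mono[of E E'] poly_mem_subfld by blast

section \<open>Field embeddings\<close>

text \<open>Values outside E are left open, so that one map serves for a field and for all its
  subfields; extensionality is added only where embeddings are counted.\<close>

definition field_emb :: "complex set \<Rightarrow> (complex \<Rightarrow> complex) \<Rightarrow> bool" where
  "field_emb E \<sigma> \<longleftrightarrow> \<sigma> 1 = 1 \<and>
     (\<forall>x\<in>E. \<forall>y\<in>E. \<sigma> (x + y) = \<sigma> x + \<sigma> y \<and> \<sigma> (x * y) = \<sigma> x * \<sigma> y)"

lemma embeddings_eq: "embeddings E = {\<sigma>. field_emb E \<sigma>} \<inter> extensional E"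
  by (auto simp: embeddings_def field_emb_def Ring.ring_hom_def)

lemma field_emb_mono: "field_emb E \<sigma> \<Longrightarrow> E' \<subseteq> E \<Longrightarrow> field_emb E' \<sigma>"
  unfolding field_emb_def by blast

lemma field_emb_cong:
  assumes "subfld E" "field_emb E \<sigma>" "\<And>x. x \<in> E \<Longrightarrow> \<tau> x = \<sigma> x"
  shows "field_emb E \<tau>"
  using assms(2,3) subfld_1[OF assms(1)] subfld_add[OF assms(1)] subfld_mult[OF assms(1)]
  by (simp add: field_emb_def)

context
  fixes E \<sigma> assumes E: "subfld E" and \<sigma>: "field_emb E \<sigma>"
begin

lemma field_emb_add: "x \<in> E \<Longrightarrow> y \<in> E \<Longrightarrow> \<sigma> (x + y) = \<sigma> x + \<sigma> y"
  and field_emb_mult: "x \<in> E \<Longrightarrow> y \<in> E \<Longrightarrow> \<sigma> (x * y) = \<sigma> x * \<sigma> y"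
  and field_emb_1: "\<sigma> 1 = 1"
  using \<sigma> by (auto simp: field_emb_def)

lemma field_emb_0: "\<sigma> 0 = 0"
  using field_emb_add[of 0 0] subfld_0[OF E] by simp

lemma field_emb_minus: "x \<in> E \<Longrightarrow> \<sigma> (- x) = - \<sigma> x"
  using field_emb_add[of x "- x"] subfld_minus[OF E, of x] field_emb_0 by (simp add: add_eq_0_iff)

lemma field_emb_diff: "x \<in> E \<Longrightarrow> y \<in> E \<Longrightarrow> \<sigma> (x - y) = \<sigma> x - \<sigma> y"
  using field_emb_add[of x "- y"] subfld_minus[OF E, of y] field_emb_minus[of y] by simp

lemma field_emb_inverse:
  assumes "x \<in> E" shows "\<sigma> (inverse x) = inverse (\<sigma> x)"
proof (cases "x = 0")
  case False
  then show ?thesis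
    using field_emb_mult[OF assms subfld_inverse[OF E assms]] field_emb_1 inverse_unique by force
qed (simp add: field_emb_0)

lemma field_emb_inj: "inj_on \<sigma> E"
proof (rule inj_onI)
  fix x y assume xy: "x \<in> E" "y \<in> E" "\<sigma> x = \<sigma> y"
  let ?d = "x - y"
  have d: "?d \<in> E" "\<sigma> ?d = 0" using xy subfld_diff[OF E] field_emb_diff by auto
  show "x = y"
  proof (rule ccontr)
    assume "x \<noteq> y"
    then have "\<sigma> (?d * inverse ?d) = 1" by (simp add: field_emb_1)
    with field_emb_mult[OF d(1) subfld_inverse[OF E d(1)]] d(2) show False by simp
  qed
qed

lemma field_emb_sum:
  "(\<And>i. i \<in> I \<Longrightarrow> f i \<in> E) \<Longrightarrow> \<sigma> (sum f I) = (\<Sum>i\<in>I. \<sigma> (f i))"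
  by (induction I rule: infinite_finite_induct)
    (auto simp: field_emb_0 field_emb_add subfld_sum[OF E])

lemma field_emb_of_int: "\<sigma> (of_int n) = of_int n"
proof -
  have "\<sigma> (of_nat k) = of_nat k" for k
    by (induction k) (auto simp: field_emb_0 field_emb_1 field_emb_add subfld_1[OF E] subfld_of_nat[OF E])
  then show ?thesis by (cases n rule: int_cases2) (auto simp: field_emb_minus subfld_of_nat[OF E])
qed

lemma field_emb_Rats:
  assumes "x \<in> \<rat>" shows "\<sigma> x = x"
  using assms
proof (cases rule: Rats_cases')
  case (1 a b)
  then show ?thesis
    by (simp add: divide_inverse field_emb_mult field_emb_inverse field_emb_of_int subfld_of_int[OF E]
        subfld_inverse[OF E])
qed

lemma coeff_map_poly_emb: "coeff (map_poly \<sigma> p) i = \<sigma> (coeff p i)"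
  by (simp add: coeff_map_poly field_emb_0)

lemma map_poly_emb_add:
  "p \<in> polys_over E \<Longrightarrow> q \<in> polys_over E \<Longrightarrow> map_poly \<sigma> (p + q) = map_poly \<sigma> p + map_poly \<sigma> q"
  by (rule poly_eqI) (simp add: coeff_map_poly_emb polys_overD field_emb_add)

lemma map_poly_emb_diff:
  "p \<in> polys_over E \<Longrightarrow> q \<in> polys_over E \<Longrightarrow> map_poly \<sigma> (p - q) = map_poly \<sigma> p - map_poly \<sigma> q"
  by (rule poly_eqI) (simp add: coeff_map_poly_emb polys_overD field_emb_diff)

lemma map_poly_emb_mult:
  assumes "p \<in> polys_over E" "q \<in> polys_over E"
  shows "map_poly \<sigma> (p * q) = map_poly \<sigma> p * map_poly \<sigma> q"
proof (rule poly_eqI)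
  fix n
  show "coeff (map_poly \<sigma> (p * q)) n = coeff (map_poly \<sigma> p * map_poly \<sigma> q) n"
    using assms unfolding coeff_map_poly_emb coeff_mult
    by (subst field_emb_sum) (auto simp: polys_overD field_emb_mult subfld_mult[OF E])
qed

lemma map_poly_emb_pCons: "map_poly \<sigma> (pCons a p) = pCons (\<sigma> a) (map_poly \<sigma> p)"
  by (rule poly_eqI) (auto simp: coeff_map_poly_emb coeff_pCons split: nat.splits)

lemma field_emb_poly:
  assumes "p \<in> polys_over E" "x \<in> E"
  shows "\<sigma> (poly p x) = poly (map_poly \<sigma> p) (\<sigma> x)"
  using assms(1)
proof (induction p)
  case (pCons a p)
  then show ?case
    using poly_mem_subfld[OF E _ assms(2), of p]
    by (simp add: map_poly_emb_pCons polys_over_pCons[OF E] field_emb_add field_emb_mult subfld_mult[OF E] assms(2))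
qed (simp add: field_emb_0)

lemma map_poly_emb_Rats: "p \<in> polys_over \<rat> \<Longrightarrow> map_poly \<sigma> p = p"
  by (rule poly_eqI) (simp add: coeff_map_poly_emb polys_overD field_emb_Rats)

lemma field_emb_poly_Rats:
  assumes "p \<in> polys_over \<rat>" "x \<in> E"
  shows "\<sigma> (poly p x) = poly p (\<sigma> x)"
  using field_emb_poly[OF _ assms(2), of p] map_poly_emb_Rats[OF assms(1)] assms(1)
    polys_over_mono[of \<rat> E] subfld_Rats[OF E] by auto

text \<open>E[x] is E[X] modulo m, so p(x) can be sent to the value at y of the transported
  polynomial. Two representatives p, q of one element differ by a multiple of m, whose transport
  vanishes at y.\<close>

lemma field_emb_extend_adjoin:
  assumes m: "is_minpoly E x m" and y: "poly (map_poly \<sigma> m) y = 0"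
  shows "\<exists>\<tau>. field_emb (adjoin E x) \<tau> \<and> (\<forall>e\<in>E. \<tau> e = \<sigma> e) \<and> \<tau> x = y"
proof -
  have wd: "poly (map_poly \<sigma> p) y = poly (map_poly \<sigma> q) y"
    if pq: "p \<in> polys_over E" "q \<in> polys_over E" "poly p x = poly q x" for p q
  proof -
    obtain s where s: "s \<in> polys_over E" "p - q = s * m"
      using is_minpoly_dvd[OF E m polys_over_diff[OF E pq(1,2)]] pq(3) by auto
    have "map_poly \<sigma> p - map_poly \<sigma> q = map_poly \<sigma> s * map_poly \<sigma> m"
      using map_poly_emb_diff[OF pq(1,2)] map_poly_emb_mult[OF s(1), of m] m s(2)
      by (simp add: is_minpoly_def)
    then have "poly (map_poly \<sigma> p - map_poly \<sigma> q) y = 0" using y by simp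
    then show ?thesis by simp
  qed
  define \<tau> where "\<tau> z = poly (map_poly \<sigma> (SOME p. p \<in> polys_over E \<and> poly p x = z)) y" for z
  have \<tau>: "\<tau> (poly p x) = poly (map_poly \<sigma> p) y" if "p \<in> polys_over E" for p
  proof -
    have "(SOME q. q \<in> polys_over E \<and> poly q x = poly p x) \<in> polys_over E \<and>
      poly (SOME q. q \<in> polys_over E \<and> poly q x = poly p x) x = poly p x"
      by (rule someI[of _ p]) (use that in auto)
    then show ?thesis unfolding \<tau>_def by (intro wd) (use that in auto)
  qed
  have const: "\<tau> e = \<sigma> e" if "e \<in> E" for e
    using \<tau>[of "[:e:]"] that by (simp add: polys_over_pCons[OF E] polys_over_0[OF E] map_poly_emb_pCons field_emb_0)
  have "field_emb (adjoin E x) \<tau>"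
    unfolding field_emb_def adjoin_def
  proof (intro conjI ballI; (elim imageE)?)
    show "\<tau> 1 = 1" using const[OF subfld_1[OF E]] field_emb_1 by simp
  next
    fix u v p q assume A: "u = poly p x" "p \<in> polys_over E" "v = poly q x" "q \<in> polys_over E"
    show "\<tau> (u + v) = \<tau> u + \<tau> v"
      using \<tau>[OF polys_over_add[OF E A(2,4)]] \<tau>[OF A(2)] \<tau>[OF A(4)] A map_poly_emb_add by simp
    show "\<tau> (u * v) = \<tau> u * \<tau> v"
      using \<tau>[OF polys_over_mult[OF E A(2,4)]] \<tau>[OF A(2)] \<tau>[OF A(4)] A map_poly_emb_mult by simp
  qed
  moreover have "\<tau> x = y"
    using \<tau>[of "[:0, 1:]"]
    by (simp add: polys_over_pCons[OF E] polys_over_0[OF E] map_poly_emb_pCons field_emb_0 field_emb_1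
        subfld_0[OF E] subfld_1[OF E])
  ultimately show ?thesis using const by blast
qed

end

section \<open>The absolute Galois group of the rationals\<close>

definition Qbar :: "complex set" where
  "Qbar = {x. algebraic x}"

lemma Qbar_iff: "x \<in> Qbar \<longleftrightarrow> (\<exists>p\<in>polys_over \<rat>. p \<noteq> 0 \<and> poly p x = 0)"
  by (auto simp: Qbar_def algebraic_altdef polys_over_def)

lemma Qbar_subfld: "subfld Qbar"
proof -
  have "Qbar = {x \<in> carrier complex_ring. (ring.algebraic complex_ring over \<rat>) x}"
    by (auto simp: Qbar_iff algebraic_over_iff[OF Rats_subfld])
  then show ?thesis using field.subfield_of_algebraics[OF complex_ring_field Rats_subfld] by simp
qed

lemma adjoin_Qbar:
  assumes "subfld E" "E \<subseteq> Qbar" "x \<in> Qbar"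
  shows "subfld (adjoin E x)" "adjoin E x \<subseteq> Qbar"
proof -
  obtain p where p: "p \<in> polys_over \<rat>" "p \<noteq> 0" "poly p x = 0" using assms(3) by (auto simp: Qbar_iff)
  moreover have "p \<in> polys_over E"
    using p(1) polys_over_mono[of \<rat> E] subfld_Rats[OF assms(1)] by auto
  ultimately show "subfld (adjoin E x)" using adjoin_subfld[OF assms(1)] by blast
  show "adjoin E x \<subseteq> Qbar" by (rule adjoin_least[OF Qbar_subfld assms(2,3)])
qed

lemma Qbar_minpoly:
  assumes "subfld E" "x \<in> Qbar" shows "\<exists>m. is_minpoly E x m"
proof -
  obtain p where p: "p \<in> polys_over \<rat>" "p \<noteq> 0" "poly p x = 0" using assms(2) by (auto simp: Qbar_iff)
  moreover have "p \<in> polys_over E"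
    using p(1) polys_over_mono[of \<rat> E] subfld_Rats[OF assms(1)] by auto
  ultimately show ?thesis using minpoly_exists[OF assms(1)] by blast
qed

section \<open>Extending embeddings to all algebraic numbers\<close>

text \<open>Partial embeddings are stored as graphs, so that extending an embedding is set
  inclusion, the order to which Zorn's lemma is applied.\<close>

definition emb_graphs :: "(complex \<times> complex) set set" where
  "emb_graphs = {(\<lambda>x. (x, \<sigma> x)) ` E | E \<sigma>. subfld E \<and> E \<subseteq> Qbar \<and> field_emb E \<sigma>}"

text \<open>Any two elements of the united domain already lie in the domain of one member of the
  chain (\<open>common\<close>), and every field or homomorphism law can be checked there.\<close>

lemma emb_graphs_chain_Union:
  assumes "\<C> \<noteq> {}" "subset.chain emb_graphs \<C>"
  shows "\<Union>\<C> \<in> emb_graphs"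
proof -
  have sub: "\<C> \<subseteq> emb_graphs" and lin: "\<And>A B. A \<in> \<C> \<Longrightarrow> B \<in> \<C> \<Longrightarrow> A \<subseteq> B \<or> B \<subseteq> A"
    using assms(2) by (auto simp: subset.chain_def)
  define E where "E = fst ` \<Union>\<C>"
  define \<sigma> where "\<sigma> x = (THE y. (x, y) \<in> \<Union>\<C>)" for x
  have graph: "\<exists>F \<tau>. subfld F \<and> F \<subseteq> Qbar \<and> field_emb F \<tau> \<and> A = (\<lambda>x. (x, \<tau> x)) ` F" if "A \<in> \<C>" for A
    using that sub unfolding emb_graphs_def by blast
  have single: "y = y'" if xy: "(x, y) \<in> \<Union>\<C>" "(x, y') \<in> \<Union>\<C>" for x y y'
  proof -
    obtain A B where "A \<in> \<C>" "B \<in> \<C>" "(x, y) \<in> A" "(x, y') \<in> B" using xy by auto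
    then obtain C where "C \<in> \<C>" "(x, y) \<in> C" "(x, y') \<in> C" using lin by blast
    with graph[of C] show ?thesis by auto
  qed
  have \<sigma>: "\<sigma> x = y" if "(x, y) \<in> \<Union>\<C>" for x y
    unfolding \<sigma>_def using single that by (intro the_equality) auto
  have common: "\<exists>F. subfld F \<and> F \<subseteq> Qbar \<and> F \<subseteq> E \<and> field_emb F \<sigma> \<and> x \<in> F \<and> y \<in> F"
    if xy: "x \<in> E" "y \<in> E" for x y
  proof -
    obtain A B where "A \<in> \<C>" "B \<in> \<C>" "x \<in> fst ` A" "y \<in> fst ` B" using xy by (auto simp: E_def)
    then obtain C where C: "C \<in> \<C>" "x \<in> fst ` C" "y \<in> fst ` C" using lin by blast
    obtain F \<tau> where F: "subfld F" "F \<subseteq> Qbar" "field_emb F \<tau>" "C = (\<lambda>x. (x, \<tau> x)) ` F"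
      using graph[OF C(1)] by blast
    have "\<sigma> z = \<tau> z" if "z \<in> F" for z using \<sigma>[of z "\<tau> z"] C(1) F(4) that by blast
    then have "field_emb F \<sigma>" using field_emb_cong[OF F(1,3)] by simp
    moreover have CF: "fst ` C = F" by (simp add: F(4) image_image)
    moreover have "fst ` C \<subseteq> E" using C(1) by (auto simp: E_def)
    ultimately show ?thesis using F(1,2) C(2,3) by blast
  qed
  obtain A where A: "A \<in> \<C>" using assms(1) by auto
  obtain F \<tau> where F: "subfld F" "A = (\<lambda>x. (x, \<tau> x)) ` F" using graph[OF A] by auto
  have "fst ` A = F" by (simp add: F(2) image_image)
  then have one: "1 \<in> E" using A subfld_1[OF F(1)] unfolding E_def by blast
  have "subfld E"
  proof (rule subfldI)
    show "x + y \<in> E" "x * y \<in> E" if "x \<in> E" "y \<in> E" for x y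
      using common[OF that] subfld_add subfld_mult by blast+
    show "- x \<in> E" "inverse x \<in> E" if "x \<in> E" for x
      using common[OF that that] subfld_minus subfld_inverse by blast+
  qed (rule one)
  moreover have "field_emb E \<sigma>" unfolding field_emb_def
  proof (intro conjI ballI)
    show "\<sigma> 1 = 1" using common[OF one one] field_emb_1 by blast
    show "\<sigma> (x + y) = \<sigma> x + \<sigma> y" "\<sigma> (x * y) = \<sigma> x * \<sigma> y" if "x \<in> E" "y \<in> E" for x y
      using common[OF that] field_emb_add field_emb_mult by blast+
  qed
  moreover have "E \<subseteq> Qbar" using common by blast
  moreover have "\<Union>\<C> = (\<lambda>x. (x, \<sigma> x)) ` E"
  proof (intro equalityI subsetI)
    fix z assume z: "z \<in> \<Union>\<C>"
    then have "fst z \<in> E" by (auto simp: E_def)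
    moreover have "z = (fst z, \<sigma> (fst z))" using \<sigma>[of "fst z" "snd z"] z by simp
    ultimately show "z \<in> (\<lambda>x. (x, \<sigma> x)) ` E" by blast
  next
    fix z assume "z \<in> (\<lambda>x. (x, \<sigma> x)) ` E"
    then obtain x where x: "x \<in> E" "z = (x, \<sigma> x)" by auto
    then obtain y where "(x, y) \<in> \<Union>\<C>" unfolding E_def by (metis fst_eqD imageE prod.collapse)
    with \<sigma>[OF this] x show "z \<in> \<Union>\<C>" by simp
  qed
  ultimately show ?thesis unfolding emb_graphs_def by blast
qed

text \<open>The transported minimal polynomial keeps its leading coefficient 1 and its positive
  degree, so it has a complex root to which x can be sent.\<close>

lemma extend_field_emb_adjoin:
  assumes E: "subfld E" and \<sigma>: "field_emb E \<sigma>" and x: "x \<in> Qbar"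
  shows "\<exists>\<tau>. field_emb (adjoin E x) \<tau> \<and> (\<forall>e\<in>E. \<tau> e = \<sigma> e)"
proof -
  obtain m where m: "is_minpoly E x m" using Qbar_minpoly[OF E x] by blast
  have "coeff (map_poly \<sigma> m) (degree m) = 1"
    using m by (simp add: coeff_map_poly_emb[OF E \<sigma>] is_minpoly_def field_emb_1[OF E \<sigma>])
  then have "degree (map_poly \<sigma> m) > 0"
    using is_minpoly_degree_pos[OF m] le_degree[of "map_poly \<sigma> m" "degree m"] by simp
  then have "\<not> constant (poly (map_poly \<sigma> m))" by (simp add: constant_degree)
  then obtain y where "poly (map_poly \<sigma> m) y = 0" using fundamental_theorem_of_algebra by blast
  from field_emb_extend_adjoin[OF E \<sigma> m this] show ?thesis by blast
qed

text \<open>A maximal extension must be defined on every algebraic number, since otherwise a missing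
  one could still be adjoined.\<close>

lemma extend_field_emb_Qbar:
  assumes E: "subfld E" "E \<subseteq> Qbar" and \<sigma>: "field_emb E \<sigma>"
  shows "\<exists>\<tau>. field_emb Qbar \<tau> \<and> (\<forall>e\<in>E. \<tau> e = \<sigma> e)"
proof -
  let ?g = "(\<lambda>x. (x, \<sigma> x)) ` E"
  define S where "S = {A \<in> emb_graphs. ?g \<subseteq> A}"
  have "?g \<in> S" using assms by (auto simp: emb_graphs_def S_def)
  then have "S \<noteq> {}" by blast
  moreover have "(\<Union>\<C>) \<in> S" if "\<C> \<noteq> {}" "subset.chain S \<C>" for \<C>
  proof -
    have "subset.chain emb_graphs \<C>" using that(2) by (auto simp: subset.chain_def S_def)
    then have "\<Union>\<C> \<in> emb_graphs" using emb_graphs_chain_Union that(1) by blast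
    moreover have "?g \<subseteq> (\<Union>\<C>)" using that unfolding subset.chain_def S_def by blast
    ultimately show ?thesis by (simp add: S_def)
  qed
  ultimately have "\<exists>M\<in>S. \<forall>A\<in>S. M \<subseteq> A \<longrightarrow> A = M" by (rule subset_Zorn_nonempty)
  then obtain M where M: "M \<in> S" "\<And>A. A \<in> S \<Longrightarrow> M \<subseteq> A \<Longrightarrow> A = M" by blast
  then obtain F \<tau> where F: "subfld F" "F \<subseteq> Qbar" "field_emb F \<tau>" "M = (\<lambda>x. (x, \<tau> x)) ` F"
    unfolding S_def emb_graphs_def by blast
  have "Qbar \<subseteq> F"
  proof
    fix x assume x: "x \<in> Qbar"
    obtain \<rho> where \<rho>: "field_emb (adjoin F x) \<rho>" "\<And>e. e \<in> F \<Longrightarrow> \<rho> e = \<tau> e"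
      using extend_field_emb_adjoin[OF F(1,3) x] by blast
    let ?A = "(\<lambda>x. (x, \<rho> x)) ` adjoin F x"
    have "M \<subseteq> ?A" using F(4) adjoin_base[OF F(1)] \<rho>(2) by force
    moreover have "?A \<in> emb_graphs"
      unfolding emb_graphs_def using adjoin_Qbar[OF F(1,2) x] \<rho>(1) by blast
    moreover from calculation have "?A = M" using M unfolding S_def by blast
    then have "fst ` ?A = fst ` M" by simp
    then have "adjoin F x = F" by (simp add: F(4) image_image)
    then show "x \<in> F" using adjoin_mem[OF F(1)] by blast
  qed
  with F have "F = Qbar" by auto
  moreover have "\<tau> e = \<sigma> e" if "e \<in> E" for e
  proof -
    have "(e, \<sigma> e) \<in> M" using M(1) that by (auto simp: S_def)
    with F(4) show ?thesis by auto
  qed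
  ultimately show ?thesis using F by blast
qed

section \<open>The automorphisms of the algebraic numbers and their fixed fields\<close>

text \<open>Extending by the identity outside the algebraic numbers makes these total bijections, closed under composition and
  inversion.\<close>

definition abs_gal :: "(complex \<Rightarrow> complex) set" where
  "abs_gal = {g. field_emb Qbar g \<and> (\<forall>x. x \<notin> Qbar \<longrightarrow> g x = x)}"

lemma abs_gal_emb: "g \<in> abs_gal \<Longrightarrow> field_emb Qbar g"
  by (simp add: abs_gal_def)

lemmas abs_gal_add = field_emb_add[OF Qbar_subfld abs_gal_emb]
  and abs_gal_mult = field_emb_mult[OF Qbar_subfld abs_gal_emb]
  and abs_gal_0 = field_emb_0[OF Qbar_subfld abs_gal_emb]
  and abs_gal_1 = field_emb_1[OF Qbar_subfld abs_gal_emb]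
  and abs_gal_minus = field_emb_minus[OF Qbar_subfld abs_gal_emb]
  and abs_gal_diff = field_emb_diff[OF Qbar_subfld abs_gal_emb]
  and abs_gal_inverse = field_emb_inverse[OF Qbar_subfld abs_gal_emb]
  and abs_gal_Rats = field_emb_Rats[OF Qbar_subfld abs_gal_emb]
  and abs_gal_poly_Rats = field_emb_poly_Rats[OF Qbar_subfld abs_gal_emb]

lemma abs_gal_mem:
  assumes g: "g \<in> abs_gal" and x: "x \<in> Qbar" shows "g x \<in> Qbar"
proof -
  obtain p where p: "p \<in> polys_over \<rat>" "p \<noteq> 0" "poly p x = 0" using x by (auto simp: Qbar_iff)
  then have "poly p (g x) = 0" using abs_gal_poly_Rats[OF g p(1) x] abs_gal_0[OF g] by simp
  with p show ?thesis by (auto simp: Qbar_iff)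
qed

text \<open>For surjectivity, y is a root of a nonzero rational polynomial; its finite root set is
  mapped injectively into itself, hence onto itself.\<close>

lemma abs_gal_bij: 
  assumes g: "g \<in> abs_gal" shows "bij g"
proof -
  have inj: "inj_on g Qbar" by (rule field_emb_inj[OF Qbar_subfld abs_gal_emb[OF g]])
  have "Qbar \<subseteq> g ` Qbar"
  proof
    fix y assume y: "y \<in> Qbar"
    then obtain p where p: "p \<in> polys_over \<rat>" "p \<noteq> 0" "poly p y = 0" by (auto simp: Qbar_iff)
    let ?R = "{z. poly p z = 0}"
    have R: "?R \<subseteq> Qbar" using p by (auto simp: Qbar_iff)
    have "finite ?R" using p(2) by (rule poly_roots_finite)
    moreover have "g ` ?R \<subseteq> ?R"
    proof safe
      fix z assume z: "poly p z = 0"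
      then show "poly p (g z) = 0" using abs_gal_poly_Rats[OF g p(1), of z] R abs_gal_0[OF g] by auto
    qed
    moreover have "inj_on g ?R" using inj R by (rule inj_on_subset)
    ultimately have "g ` ?R = ?R" by (rule endo_inj_surj)
    with p(3) R show "y \<in> g ` Qbar" by blast
  qed
  then have im: "g ` Qbar = Qbar" using abs_gal_mem[OF g] by blast
  have out: "g x = x" if "x \<notin> Qbar" for x using g that by (simp add: abs_gal_def)
  show ?thesis
  proof (rule bijI)
    show "inj g"
    proof (rule injI)
      fix x y assume "g x = g y"
      then show "x = y" using inj out abs_gal_mem[OF g]
        by (cases "x \<in> Qbar"; cases "y \<in> Qbar") (auto dest: inj_onD)
    qed
    show "surj g" using im out by (metis UNIV_I image_iff surjI surj_def)
  qed
qed

lemma abs_gal_id: "id \<in> abs_gal"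
  by (simp add: abs_gal_def field_emb_def)

lemma abs_gal_comp:
  assumes "g \<in> abs_gal" "h \<in> abs_gal" shows "g \<circ> h \<in> abs_gal"
  using assms abs_gal_mem[OF assms(2)] by (auto simp: abs_gal_def field_emb_def)

lemma abs_gal_inv:
  assumes g: "g \<in> abs_gal" shows "inv_into UNIV g \<in> abs_gal"
proof -
  note bij = abs_gal_bij[OF g]
  have cancel: "g (inv_into UNIV g x) = x" for x using bij by (simp add: bij_is_surj surj_f_inv_f)
  have cancel': "inv_into UNIV g (g x) = x" for x using bij by (simp add: bij_is_inj)
  \<comment> \<open>A non-algebraic preimage would be fixed by g and would therefore equal the
    algebraic number x.\<close>
  have mem: "inv_into UNIV g x \<in> Qbar" if "x \<in> Qbar" for x
  proof (rule ccontr)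
    assume "inv_into UNIV g x \<notin> Qbar"
    then have "g (inv_into UNIV g x) = inv_into UNIV g x" using g by (simp add: abs_gal_def)
    with cancel \<open>inv_into UNIV g x \<notin> Qbar\<close> that show False by simp
  qed
  show ?thesis unfolding abs_gal_def field_emb_def
  proof (intro CollectI conjI ballI allI impI)
    show "inv_into UNIV g 1 = 1" using cancel'[of 1] abs_gal_1[OF g] by simp
    fix x y assume "x \<in> Qbar" "y \<in> Qbar"
    then show "inv_into UNIV g (x + y) = inv_into UNIV g x + inv_into UNIV g y" "inv_into UNIV g (x * y) = inv_into UNIV g x * inv_into UNIV g y"
      using cancel'[of "inv_into UNIV g x + inv_into UNIV g y"] cancel'[of "inv_into UNIV g x * inv_into UNIV g y"]
      by (simp_all add: abs_gal_add[OF g] abs_gal_mult[OF g] mem cancel)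
  next
    fix x assume "x \<notin> Qbar"
    then have "g x = x" using g by (simp add: abs_gal_def)
    then show "inv_into UNIV g x = x" using cancel'[of x] by simp
  qed
qed

lemma abs_gal_inv_cancel:
  assumes "g \<in> abs_gal" shows "g (inv_into UNIV g x) = x" "inv_into UNIV g (g x) = x"
  using abs_gal_bij[OF assms] by (simp_all add: bij_is_surj surj_f_inv_f bij_is_inj)

lemma abs_gal_extend:
  assumes "subfld E" "E \<subseteq> Qbar" "field_emb E \<sigma>"
  shows "\<exists>g\<in>abs_gal. \<forall>e\<in>E. g e = \<sigma> e"
proof -
  obtain \<tau> where \<tau>: "field_emb Qbar \<tau>" "\<forall>e\<in>E. \<tau> e = \<sigma> e"
    using extend_field_emb_Qbar[OF assms] by blast
  define g where "g x = (if x \<in> Qbar then \<tau> x else x)" for x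
  have "field_emb Qbar g" by (rule field_emb_cong[OF Qbar_subfld \<tau>(1)]) (simp add: g_def)
  then have "g \<in> abs_gal" by (simp add: abs_gal_def g_def)
  moreover have "\<forall>e\<in>E. g e = \<sigma> e" using \<tau>(2) assms(2) by (auto simp: g_def)
  ultimately show ?thesis by blast
qed

lemma abs_gal_minpoly_root:
  assumes E: "subfld E" "E \<subseteq> Qbar" and x: "x \<in> Qbar" and m: "is_minpoly E x m" "poly m y = 0"
  shows "\<exists>g\<in>abs_gal. (\<forall>e\<in>E. g e = e) \<and> g x = y"
proof -
  have id: "field_emb E (\<lambda>x. x)" by (simp add: field_emb_def)
  have "map_poly (\<lambda>x. x) m = m" by (rule poly_eqI) (simp add: coeff_map_poly)
  then obtain \<tau> where \<tau>: "field_emb (adjoin E x) \<tau>" "\<forall>e\<in>E. \<tau> e = e" "\<tau> x = y"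
    using field_emb_extend_adjoin[OF E(1) id m(1), of y] m(2) by auto
  obtain g where g: "g \<in> abs_gal" "\<And>e. e \<in> adjoin E x \<Longrightarrow> g e = \<tau> e"
    using abs_gal_extend[OF adjoin_Qbar[OF E x] \<tau>(1)] by blast
  have "g e = e" if "e \<in> E" for e using g(2)[of e] adjoin_base[OF E(1), of x] that \<tau>(2) by auto
  moreover have "g x = y" using g(2)[OF adjoin_mem[OF E(1)]] \<tau>(3) by simp
  ultimately show ?thesis using g(1) by blast
qed

text \<open>Each root of the minimal polynomial of x over E is the image of x under an automorphism
  fixing E. If all these images equal x, separability leaves degree 1, so x is in E. This one
  direction of the Galois correspondence carries the whole development.\<close>

theorem abs_gal_fixed_field:
  assumes E: "subfld E" "E \<subseteq> Qbar" and x: "x \<in> Qbar"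
    and fixed: "\<And>g. g \<in> abs_gal \<Longrightarrow> (\<And>e. e \<in> E \<Longrightarrow> g e = e) \<Longrightarrow> g x = x"
  shows "x \<in> E"
proof -
  obtain m where m: "is_minpoly E x m" using Qbar_minpoly[OF E(1) x] by blast
  have "{y. poly m y = 0} \<subseteq> {x}"
    using abs_gal_minpoly_root[OF E x m] fixed by fastforce
  then have "card {y. poly m y = 0} \<le> 1" using card_mono[of "{x}"] by fastforce
  then have "degree m = 1" using is_minpoly_card_roots[OF E(1) m] is_minpoly_degree_pos[OF m] by simp
  then obtain a b where ab: "m = [:a, b:]" by (metis degree1_coeffs)
  have "b = 1" "a \<in> E" using m \<open>degree m = 1\<close> ab polys_overD[of m E 0] by (auto simp: is_minpoly_def)
  moreover have "poly m x = 0" using m by (simp add: is_minpoly_def)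
  ultimately have "x = - a" using ab by (simp add: add_eq_0_iff2)
  then show ?thesis using \<open>a \<in> E\<close> subfld_minus[OF E(1)] by simp
qed

section \<open>Conjugates, and embeddings as restrictions of automorphisms\<close>

definition gal_orbit :: "complex \<Rightarrow> complex set" where
  "gal_orbit x = (\<lambda>g. g x) ` abs_gal"

lemma gal_orbit_eq_roots:
  assumes x: "x \<in> Qbar" and m: "is_minpoly \<rat> x m"
  shows "gal_orbit x = {y. poly m y = 0}"
proof (intro equalityI subsetI)
  fix y assume "y \<in> gal_orbit x"
  then obtain g where g: "g \<in> abs_gal" "y = g x" by (auto simp: gal_orbit_def)
  then show "y \<in> {y. poly m y = 0}"
    using abs_gal_poly_Rats[OF g(1) _ x, of m] m abs_gal_0[OF g(1)] by (simp add: is_minpoly_def)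
next
  fix y assume "y \<in> {y. poly m y = 0}"
  then show "y \<in> gal_orbit x"
    using abs_gal_minpoly_root[OF Rats_subfld _ x m, of y] subfld_Rats[OF Qbar_subfld]
    by (auto simp: gal_orbit_def)
qed

lemma finite_gal_orbit:
  assumes "x \<in> Qbar" shows "finite (gal_orbit x)"
proof -
  obtain m where m: "is_minpoly \<rat> x m" using Qbar_minpoly[OF Rats_subfld assms] by blast
  then have "m \<noteq> 0" by (auto simp: is_minpoly_def)
  then show ?thesis unfolding gal_orbit_eq_roots[OF assms m] by (rule poly_roots_finite)
qed

lemma embeddings_eq_restrict:
  assumes E: "subfld E" "E \<subseteq> Qbar"
  shows "embeddings E = (\<lambda>g. restrict g E) ` abs_gal"
proof (intro equalityI subsetI)
  fix \<sigma> assume \<sigma>: "\<sigma> \<in> embeddings E"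
  then obtain g where g: "g \<in> abs_gal" "\<forall>e\<in>E. g e = \<sigma> e"
    using abs_gal_extend[OF E] by (auto simp: embeddings_eq)
  then have "restrict g E = \<sigma>" using \<sigma> by (auto simp: embeddings_eq extensional_def restrict_def)
  with g show "\<sigma> \<in> (\<lambda>g. restrict g E) ` abs_gal" by blast
next
  fix \<sigma> assume "\<sigma> \<in> (\<lambda>g. restrict g E) ` abs_gal"
  then obtain g where g: "g \<in> abs_gal" "\<sigma> = restrict g E" by auto
  have "field_emb E \<sigma>"
    using field_emb_cong[OF E(1) field_emb_mono[OF abs_gal_emb[OF g(1)] E(2)], of \<sigma>] g(2) by simp
  with g show "\<sigma> \<in> embeddings E" by (simp add: embeddings_eq)
qed

text \<open>Used to carry equality of two automorphisms from a set of generators to the field that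
  it generates.\<close>

lemma equalizer_subfld:
  assumes "g \<in> abs_gal" "h \<in> abs_gal"
  shows "subfld {x \<in> Qbar. g x = h x}"
  by (rule subfldI)
    (auto simp: abs_gal_1[OF assms(1)] abs_gal_1[OF assms(2)] abs_gal_add[OF assms(1)] abs_gal_add[OF assms(2)]
      abs_gal_mult[OF assms(1)] abs_gal_mult[OF assms(2)] abs_gal_minus[OF assms(1)] abs_gal_minus[OF assms(2)]
      abs_gal_inverse[OF assms(1)] abs_gal_inverse[OF assms(2)]
      subfld_add[OF Qbar_subfld] subfld_mult[OF Qbar_subfld] subfld_1[OF Qbar_subfld]
      subfld_minus[OF Qbar_subfld] subfld_inverse[OF Qbar_subfld])

section \<open>Number fields and their embeddings\<close>

text \<open>For fields of algebraic numbers this says that the finite set A generates E over the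
  rationals. Phrased through automorphisms, it passes to composita, simple extensions and normal
  closures without any dimension count.\<close>

definition determined_by :: "complex set \<Rightarrow> complex set \<Rightarrow> bool" where
  "determined_by E A \<longleftrightarrow> finite A \<and> A \<subseteq> E \<and>
     (\<forall>g\<in>abs_gal. \<forall>h\<in>abs_gal. (\<forall>a\<in>A. g a = h a) \<longrightarrow> (\<forall>x\<in>E. g x = h x))"

lemma determined_byD:
  "determined_by E A \<Longrightarrow> g \<in> abs_gal \<Longrightarrow> h \<in> abs_gal \<Longrightarrow> (\<And>a. a \<in> A \<Longrightarrow> g a = h a) \<Longrightarrow> x \<in> E \<Longrightarrow> g x = h x"
  unfolding determined_by_def by blast

lemma restrict_eq_iff: "restrict g E = restrict h E \<longleftrightarrow> (\<forall>x\<in>E. g x = h x)"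
  by (metis restrict_apply' restrict_ext)

lemma finite_embeddings:
  assumes E: "subfld E" "E \<subseteq> Qbar" and A: "determined_by E A"
  shows "finite (embeddings E)"
proof -
  have sub: "A \<subseteq> E" "finite A" using A by (auto simp: determined_by_def)
  have "inj_on (\<lambda>\<sigma>. restrict \<sigma> A) (embeddings E)"
  proof (rule inj_onI)
    fix \<sigma> \<tau> assume \<sigma>: "\<sigma> \<in> embeddings E" "\<tau> \<in> embeddings E" and eq: "restrict \<sigma> A = restrict \<tau> A"
    obtain g h where gh: "g \<in> abs_gal" "h \<in> abs_gal" "\<sigma> = restrict g E" "\<tau> = restrict h E"
      using \<sigma> unfolding embeddings_eq_restrict[OF E] by blast
    have "g a = h a" if "a \<in> A" for a
      using eq gh that sub by (metis restrict_apply' subsetD)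
    then have "\<forall>x\<in>E. g x = h x" using determined_byD[OF A gh(1,2)] by blast
    then show "\<sigma> = \<tau>" using gh by (auto simp: restrict_def)
  qed
  moreover have "(\<lambda>\<sigma>. restrict \<sigma> A) ` embeddings E \<subseteq> PiE A gal_orbit"
    unfolding embeddings_eq_restrict[OF E] using sub by (auto simp: gal_orbit_def)
  moreover have "finite (PiE A gal_orbit)"
    using sub E finite_gal_orbit by (intro finite_PiE) auto
  ultimately show ?thesis using finite_imageD finite_subset by blast
qed

section \<open>Primitive elements, and the degree as the number of embeddings\<close>

lemma primitive_element_aux:
  assumes E: "subfld E" "E \<subseteq> Qbar" and "finite A" "A \<subseteq> E"
  shows "\<exists>\<theta>\<in>E. \<forall>g\<in>abs_gal. \<forall>h\<in>abs_gal. g \<theta> = h \<theta> \<longrightarrow> (\<forall>a\<in>A. g a = h a)"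
  using assms(3,4)
proof (induction A rule: finite_induct)
  case empty
  show ?case using subfld_0[OF E(1)] by auto
next
  case (insert a A)
  then obtain \<theta> where \<theta>: "\<theta> \<in> E"
    "\<And>g h b. g \<in> abs_gal \<Longrightarrow> h \<in> abs_gal \<Longrightarrow> g \<theta> = h \<theta> \<Longrightarrow> b \<in> A \<Longrightarrow> g b = h b" by blast
  have a: "a \<in> E" using insert by simp
  \<comment> \<open>If g and h agree on \<theta> + n * a but not on a, then n is one of these
    quotients of differences of conjugates. There are finitely many of them; entries with w = w'
    evaluate to 0 and merely exclude n = 0.\<close>
  define bad where "bad = (\<lambda>(u, u', w, w'). (u' - u) / (w - w')) `
    (gal_orbit \<theta> \<times> gal_orbit \<theta> \<times> gal_orbit a \<times> gal_orbit a)"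
  have "finite bad" unfolding bad_def using E \<theta>(1) a finite_gal_orbit by (intro finite_imageI finite_cartesian_product) auto
  moreover have "infinite (range (of_nat :: nat \<Rightarrow> complex))"
    by (rule range_inj_infinite) (simp add: inj_on_def)
  ultimately obtain n where n: "of_nat n \<notin> bad"
    by (metis finite_subset image_subset_iff)
  let ?t = "\<theta> + of_nat n * a"
  have Qb: "\<theta> \<in> Qbar" "a \<in> Qbar" "of_nat n \<in> Qbar" "of_nat n * a \<in> Qbar"
    using E \<theta> a subfld_of_nat[OF Qbar_subfld] subfld_mult[OF Qbar_subfld] by auto
  have key: "g a = h a \<and> g \<theta> = h \<theta>" if gh: "g \<in> abs_gal" "h \<in> abs_gal" "g ?t = h ?t" for g h
  proof -
    have *: "f ?t = f \<theta> + of_nat n * f a" if "f \<in> abs_gal" for f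
      using Qb by (simp add: abs_gal_add[OF that] abs_gal_mult[OF that] abs_gal_Rats[OF that])
    have eq: "g \<theta> + of_nat n * g a = h \<theta> + of_nat n * h a"
      using gh(3) unfolding *[OF gh(1)] *[OF gh(2)] .
    have "g a = h a"
    proof (rule ccontr)
      assume ne: "g a \<noteq> h a"
      then have "of_nat n = (h \<theta> - g \<theta>) / (g a - h a)" using eq by (simp add: field_simps)
      moreover have "(h \<theta> - g \<theta>) / (g a - h a) \<in> bad"
        unfolding bad_def using gh by (intro image_eqI[of _ _ "(g \<theta>, h \<theta>, g a, h a)"]) (auto simp: gal_orbit_def)
      ultimately show False using n by simp
    qed
    with eq show ?thesis by simp
  qed
  have "?t \<in> E" using \<theta> a subfld_add[OF E(1)] subfld_mult[OF E(1)] subfld_of_nat[OF E(1)] by simp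
  moreover have "\<forall>g\<in>abs_gal. \<forall>h\<in>abs_gal. g ?t = h ?t \<longrightarrow> (\<forall>b\<in>insert a A. g b = h b)"
    using key \<theta>(2) by blast
  ultimately show ?case by blast
qed

text \<open>An automorphism fixing \<theta> agrees with \<open>id\<close> at \<theta> and thus on
  all of E; the fixed field theorem turns this into E = Q(\<theta>).\<close>

lemma primitive_element:
  assumes E: "subfld E" "E \<subseteq> Qbar" and A: "determined_by E A"
  obtains \<theta> where "\<theta> \<in> E" "E = adjoin \<rat> \<theta>"
    "\<And>g h x. g \<in> abs_gal \<Longrightarrow> h \<in> abs_gal \<Longrightarrow> g \<theta> = h \<theta> \<Longrightarrow> x \<in> E \<Longrightarrow> g x = h x"
proof -
  have sub: "A \<subseteq> E" "finite A" using A by (auto simp: determined_by_def)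
  obtain \<theta> where \<theta>: "\<theta> \<in> E"
    "\<And>g h a. g \<in> abs_gal \<Longrightarrow> h \<in> abs_gal \<Longrightarrow> g \<theta> = h \<theta> \<Longrightarrow> a \<in> A \<Longrightarrow> g a = h a"
    using primitive_element_aux[OF E sub(2,1)] by blast
  have det: "g x = h x" if "g \<in> abs_gal" "h \<in> abs_gal" "g \<theta> = h \<theta>" "x \<in> E" for g h x
    using determined_byD[OF A that(1,2) _ that(4)] \<theta>(2)[OF that(1-3)] by blast
  have RQ: "\<rat> \<subseteq> Qbar" using subfld_Rats[OF Qbar_subfld] by auto
  have "E = adjoin \<rat> \<theta>"
  proof
    show "adjoin \<rat> \<theta> \<subseteq> E" using adjoin_least[OF E(1) _ \<theta>(1)] subfld_Rats[OF E(1)] by blast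
    show "E \<subseteq> adjoin \<rat> \<theta>"
    proof
      fix x assume x: "x \<in> E"
      show "x \<in> adjoin \<rat> \<theta>"
      proof (rule abs_gal_fixed_field)
        show "subfld (adjoin \<rat> \<theta>)" "adjoin \<rat> \<theta> \<subseteq> Qbar"
          using adjoin_Qbar[OF Rats_subfld RQ] \<theta>(1) E by auto
        show "x \<in> Qbar" using x E by auto
        fix g assume g: "g \<in> abs_gal" "\<And>e. e \<in> adjoin \<rat> \<theta> \<Longrightarrow> g e = e"
        have "g \<theta> = id \<theta>" using g(2)[OF adjoin_mem[OF Rats_subfld]] by simp
        from det[OF g(1) abs_gal_id this x] show "g x = x" by simp
      qed
    qed
  qed
  with \<theta>(1) det show ?thesis using that by blast
qed

text \<open>The link to the dimension behind \<open>field_degree\<close>. \<open>Irr\<close> is the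
  minimal polynomial of \<theta> as a coefficient list, of degree \<open>length ps - 1\<close>; each
  of the two inequalities uses the minimality of one of the two polynomials.\<close>

lemma dimension_adjoin:
  assumes m: "is_minpoly \<rat> \<theta> m"
  shows "ring.dimension complex_ring (degree m) \<rat> (adjoin \<rat> \<theta>)"
proof -
  interpret D: domain complex_ring by (rule complex_ring_domain)
  have m0: "m \<in> polys_over \<rat>" "m \<noteq> 0" "poly m \<theta> = 0" using m by (auto simp: is_minpoly_def)
  have alg: "(D.algebraic over \<rat>) \<theta>" using m0 algebraic_over_iff[OF Rats_subfld] by blast
  define ps where "ps = D.Irr \<rat> \<theta>"
  note Irr = D.IrrE[OF Rats_subfld _ alg, folded ps_def]
  have ps: "ps \<in> carrier (univ_poly complex_ring \<rat>)" "D.eval ps \<theta> = 0" "hd ps = 1"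
    using Irr by simp_all
  have ps_ne: "ps \<noteq> []" using Irr(2) by (auto simp: ring_irreducible_def univ_poly_zero)
  have ps_in: "set ps \<subseteq> \<rat>" using ps(1) ps_ne by (auto simp: univ_poly_def polynomial_def)
  have "degree m \<le> length ps - 1"
  proof -
    let ?p = "Poly (rev ps)"
    have "?p \<in> polys_over \<rat>" using ps_in by (intro set_subset_imp_Poly_polys_over[OF Rats_subfld]) simp
    moreover have "?p \<noteq> 0"
    proof
      assume "?p = 0"
      then have "coeff ?p (length ps - 1) = 0" by simp
      with ps_ne ps(3) show False by (simp add: nth_default_def rev_nth hd_conv_nth)
    qed
    moreover have "poly ?p \<theta> = 0" using ps(2) by (simp add: eval_eq_poly)
    ultimately have "degree m \<le> degree ?p" using m by (simp add: is_minpoly_def)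
    also have "\<dots> \<le> length ps - 1"
      using ps_ne by (intro degree_le) (auto simp: nth_default_def)
    finally show ?thesis .
  qed
  moreover have "length ps - 1 \<le> degree m"
  proof -
    let ?q = "rev (coeffs m)"
    have "set (coeffs m) \<subseteq> \<rat>" using m0(1) by (auto simp: polys_over_def coeffs_def)
    moreover have "hd ?q \<noteq> 0" using m0(2) by (simp add: hd_rev last_coeffs_eq_coeff_degree)
    ultimately have q: "?q \<in> carrier (univ_poly complex_ring \<rat>)"
      by (auto simp: univ_poly_def polynomial_def)
    have "D.eval ?q \<theta> = 0" using m0(3) by (simp add: eval_eq_poly)
    then have "length ps - 1 \<le> length ?q - 1"
      using D.pdivides_imp_degree_le[OF subfieldE(1)[OF Rats_subfld] ps(1) q _
          D.Irr_minimal[OF Rats_subfld _ alg q, folded ps_def]] m0(2) by simp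
    then show ?thesis using m0(2) by (simp add: length_coeffs_degree)
  qed
  ultimately have "degree m = length ps - 1" by simp
  then show ?thesis
    using D.dimension_simple_extension[OF Rats_subfld _ alg]
    by (simp add: simple_extension_eq_adjoin[OF Rats_subfld] ps_def)
qed

lemma card_image_eq_card_image:
  assumes "\<And>x y. x \<in> S \<Longrightarrow> y \<in> S \<Longrightarrow> f x = f y \<longleftrightarrow> h x = h y"
  shows "card (f ` S) = card (h ` S)"
proof -
  have "bij_betw (\<lambda>u. h (inv_into S f u)) (f ` S) (h ` S)"
  proof (rule bij_betw_imageI)
    show "inj_on (\<lambda>u. h (inv_into S f u)) (f ` S)"
    proof (rule inj_onI)
      fix u v assume uv: "u \<in> f ` S" "v \<in> f ` S" "h (inv_into S f u) = h (inv_into S f v)"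
      then have "f (inv_into S f u) = f (inv_into S f v)" using assms inv_into_into by metis
      with uv show "u = v" by (simp add: f_inv_into_f)
    qed
    have "h (inv_into S f (f x)) = h x" if "x \<in> S" for x
      using assms[of "inv_into S f (f x)" x] that by (simp add: inv_into_into f_inv_into_f)
    then show "(\<lambda>u. h (inv_into S f u)) ` f ` S = h ` S" by (auto simp: image_image)
  qed
  then show ?thesis by (rule bij_betw_same_card)
qed

text \<open>Degree, number of conjugates of a primitive element \<theta>, and number of embeddings
  coincide, because an embedding is determined by the image of \<theta> and by separability all
  roots are distinct.\<close>

lemma number_field_of_determined:
  assumes E: "subfld E" "E \<subseteq> Qbar" and A: "determined_by E A"
  shows "number_field E" "field_degree E = card (embeddings E)"
proof -
  interpret R: ring complex_ring by (rule complex_ring_ring)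
  obtain \<theta> where \<theta>: "\<theta> \<in> E" "E = adjoin \<rat> \<theta>"
    "\<And>g h x. g \<in> abs_gal \<Longrightarrow> h \<in> abs_gal \<Longrightarrow> g \<theta> = h \<theta> \<Longrightarrow> x \<in> E \<Longrightarrow> g x = h x"
    using primitive_element[OF E A] by blast
  have Q: "\<theta> \<in> Qbar" using \<theta>(1) E(2) by blast
  then obtain m where m: "is_minpoly \<rat> \<theta> m" using Qbar_minpoly[OF Rats_subfld] by blast
  have dim: "R.dimension (degree m) \<rat> E" using dimension_adjoin[OF m] \<theta>(2) by simp
  then show "number_field E"
    using E(1) R.finite_dimensionI[OF dim] by (simp add: number_field_def)
  have "field_degree E = degree m"
    unfolding field_degree_def using R.dimI[OF Rats_subfld dim] by (simp add: over_def)
  also have "\<dots> = card (gal_orbit \<theta>)"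
    unfolding gal_orbit_eq_roots[OF Q m] by (rule is_minpoly_card_roots[OF Rats_subfld m, symmetric])
  also have "\<dots> = card (embeddings E)"
    unfolding gal_orbit_def embeddings_eq_restrict[OF E]
  proof (rule card_image_eq_card_image)
    fix g h assume "g \<in> abs_gal" "h \<in> abs_gal"
    then show "g \<theta> = h \<theta> \<longleftrightarrow> restrict g E = restrict h E"
      unfolding restrict_eq_iff using \<theta>(1,3) by blast
  qed
  finally show "field_degree E = card (embeddings E)" .
qed

lemma number_field_subfld: "number_field E \<Longrightarrow> subfld E"
  by (simp add: number_field_def)

lemma number_field_Qbar:
  assumes "number_field E" shows "E \<subseteq> Qbar"
proof
  fix x assume "x \<in> E"
  then have "(ring.algebraic complex_ring over \<rat>) x"
    using ring.finite_dimension_imp_algebraic[OF complex_ring_ring Rats_subfld subfieldE(1)] assms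
    by (auto simp: number_field_def)
  then show "x \<in> Qbar" by (simp add: algebraic_over_iff[OF Rats_subfld] Qbar_iff)
qed

text \<open>A rational basis will do: the numbers on which two automorphisms agree form a field,
  which contains the rationals and hence all rational combinations of the basis.\<close>

lemma number_field_determined:
  assumes "number_field E" shows "\<exists>A. determined_by E A"
proof -
  interpret R: ring complex_ring by (rule complex_ring_ring)
  obtain n where "R.dimension n \<rat> E" using assms by (auto simp: number_field_def R.finite_dimension_def)
  then obtain Vs where Vs: "R.Span \<rat> Vs = E" using R.exists_base[OF Rats_subfld] by blast
  have "set Vs \<subseteq> E" using R.Span_base_incl[OF Rats_subfld, of Vs] Vs by simp
  moreover have "g x = h x"
    if gh: "g \<in> abs_gal" "h \<in> abs_gal" "\<forall>a\<in>set Vs. g a = h a" and x: "x \<in> E" for g h x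
  proof -
    let ?S = "{x \<in> Qbar. g x = h x}"
    have S: "subfld ?S" by (rule equalizer_subfld[OF gh(1,2)])
    have *: "R.combine Ks Us \<in> ?S" if "set Ks \<subseteq> \<rat>" "set Us \<subseteq> ?S" for Ks Us
      using that
    proof (induction Ks Us rule: R.combine.induct)
      case (1 k Ks u Us)
      have "k \<in> ?S" using 1 subfld_Rats[OF S] by (metis list.set_intros(1) subsetD)
      then have "k * u \<in> ?S" using subfld_mult[OF S] 1 by simp
      moreover have "R.combine Ks Us \<in> ?S" using 1 by simp
      ultimately have "k * u + R.combine Ks Us \<in> ?S" by (rule subfld_add[OF S])
      then show ?case by simp
    qed (use subfld_0[OF S] in auto)
    obtain Ks where "set Ks \<subseteq> \<rat>" "x = R.combine Ks Vs"
      using R.Span_eq_combine_set[OF Rats_subfld, of Vs] Vs x by auto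
    moreover have "set Vs \<subseteq> ?S" using \<open>set Vs \<subseteq> E\<close> number_field_Qbar[OF assms] gh(3) by auto
    ultimately have "x \<in> ?S" using * by blast
    then show ?thesis by simp
  qed
  ultimately have "determined_by E (set Vs)" unfolding determined_by_def by blast
  then show ?thesis ..
qed

lemma number_field_degree:
  assumes "number_field E" shows "field_degree E = card (embeddings E)" "finite (embeddings E)"
proof -
  obtain A where A: "determined_by E A" using number_field_determined[OF assms] by blast
  note E = number_field_subfld[OF assms] number_field_Qbar[OF assms]
  show "field_degree E = card (embeddings E)" by (rule number_field_of_determined(2)[OF E A])
  show "finite (embeddings E)" by (rule finite_embeddings[OF E A])
qed

text \<open>A subfield K is recovered from the set of embeddings of E that fix it, by the fixed
  field theorem, and there are only finitely many sets of embeddings.\<close>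

lemma finite_subfields:
  assumes E: "subfld E" "E \<subseteq> Qbar" and A: "determined_by E A"
  shows "finite {K. subfld K \<and> K \<subseteq> E}"
proof -
  define Fix where "Fix K = {\<sigma> \<in> embeddings E. \<forall>x\<in>K. \<sigma> x = x}" for K
  have "inj_on Fix {K. subfld K \<and> K \<subseteq> E}"
  proof (rule inj_onI)
    have le: "K' \<subseteq> K" if K: "subfld K" "K \<subseteq> E" "subfld K'" "K' \<subseteq> E" "Fix K = Fix K'" for K K'
    proof
      fix x assume x: "x \<in> K'"
      show "x \<in> K"
      proof (rule abs_gal_fixed_field[OF K(1)])
        show "K \<subseteq> Qbar" "x \<in> Qbar" using K E x by auto
        fix g assume g: "g \<in> abs_gal" "\<And>e. e \<in> K \<Longrightarrow> g e = e"
        then have "restrict g E \<in> Fix K" using K(2) by (auto simp: Fix_def embeddings_eq_restrict[OF E])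
        then have "restrict g E \<in> Fix K'" using K by simp
        then have "restrict g E x = x" using x by (simp add: Fix_def)
        then show "g x = x" using x K(4) by auto
      qed
    qed
    fix K K' assume "K \<in> {K. subfld K \<and> K \<subseteq> E}" "K' \<in> {K. subfld K \<and> K \<subseteq> E}" "Fix K = Fix K'"
    then show "K = K'" using le[of K K'] le[of K' K] by auto
  qed
  moreover have "Fix ` {K. subfld K \<and> K \<subseteq> E} \<subseteq> Pow (embeddings E)" by (auto simp: Fix_def)
  ultimately show ?thesis using finite_embeddings[OF E A] by (meson finite_Pow_iff finite_imageD finite_subset)
qed

section \<open>Galois groups\<close>

lemma polys_over_Rats_obtain:
  assumes "p \<in> polys_over \<rat>" obtains q :: "rat poly" where "p = map_poly of_rat q"
proof -
  have "\<forall>i. \<exists>r :: rat. coeff p i = of_rat r" using assms by (auto simp: polys_over_def Rats_def)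
  then obtain r :: "nat \<Rightarrow> rat" where r: "\<And>i. coeff p i = of_rat (r i)" by metis
  have "p = map_poly of_rat (Poly (map r [0..<Suc (degree p)]))"
  proof (rule poly_eqI)
    fix i
    show "coeff p i = coeff (map_poly of_rat (Poly (map r [0..<Suc (degree p)]))) i"
      using r[of i] coeff_eq_0[of p i] by (auto simp: coeff_map_poly nth_default_def less_Suc_eq_le simp del: upt_Suc)
  qed
  with that show ?thesis by blast
qed

lemma map_poly_of_rat_polys_over: "map_poly of_rat q \<in> polys_over \<rat>"
  by (auto simp: polys_over_def coeff_map_poly)

lemma degree_map_poly_of_rat: "degree (map_poly of_rat q :: complex poly) = degree q"
proof (rule antisym)
  show "degree (map_poly of_rat q :: complex poly) \<le> degree q" by (rule degree_le) (simp add: coeff_map_poly coeff_eq_0)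
  show "degree q \<le> degree (map_poly of_rat q :: complex poly)"
  proof (cases "q = 0")
    case False
    then have "coeff (map_poly of_rat q :: complex poly) (degree q) \<noteq> 0" by (simp add: coeff_map_poly)
    then show ?thesis by (rule le_degree)
  qed simp
qed

lemma map_poly_of_rat_mult: "map_poly of_rat (p * q) = (map_poly of_rat p * map_poly of_rat q :: complex poly)"
  by (rule poly_eqI) (simp add: coeff_map_poly coeff_mult of_rat_sum of_rat_mult)

lemma map_poly_of_rat_inj: "(map_poly of_rat p :: complex poly) = map_poly of_rat q \<Longrightarrow> p = q"
  by (simp add: poly_eq_iff coeff_map_poly)

lemma irreducible_minpoly:
  assumes x: "x \<in> Qbar" and m: "is_minpoly \<rat> x (map_poly of_rat m')"
  shows "Factorial_Ring.irreducible m'"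
proof (rule Factorial_Ring.irreducibleI)
  have deg: "degree m' > 0" using is_minpoly_degree_pos[OF m] by (simp add: degree_map_poly_of_rat)
  then show "m' \<noteq> 0" by auto
  show "\<not> m' dvd 1" using deg is_unit_iff_degree[of m'] by force
  fix a b assume ab: "m' = a * b"
  have ab0: "a \<noteq> 0" "b \<noteq> 0" using deg ab by auto
  have dab: "degree m' = degree a + degree b" using ab ab0 by (simp add: degree_mult_eq)
  have "poly (map_poly of_rat a) x * poly (map_poly of_rat b) x = 0"
    using m unfolding ab by (simp add: is_minpoly_def map_poly_of_rat_mult)
  then have "poly (map_poly of_rat a) x = 0 \<or> poly (map_poly of_rat b) x = 0" by simp
  moreover have "degree m' \<le> degree c" if "poly (map_poly of_rat c) x = 0" "c \<noteq> 0" for c :: "rat poly"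
  proof -
    have "(map_poly of_rat c :: complex poly) \<noteq> 0" using that(2) map_poly_of_rat_inj[of c 0] by auto
    then have "degree (map_poly of_rat m' :: complex poly) \<le> degree (map_poly of_rat c :: complex poly)"
      using m that(1) map_poly_of_rat_polys_over[of c] unfolding is_minpoly_def by blast
    then show ?thesis by (simp add: degree_map_poly_of_rat)
  qed
  ultimately have "degree b = 0 \<or> degree a = 0" using ab0 dab by fastforce
  then show "a dvd 1 \<or> b dvd 1" using ab0 by (auto simp: is_unit_iff_degree)
qed

lemma galois_number_field_stable:
  assumes M: "galois_number_field M" and g: "g \<in> abs_gal" and x: "x \<in> M"
  shows "g x \<in> M"
proof -
  have nf: "number_field M" using M by (simp add: galois_number_field_def)
  have xQ: "x \<in> Qbar" using number_field_Qbar[OF nf] x by blast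
  obtain m where m: "is_minpoly \<rat> x m" using Qbar_minpoly[OF Rats_subfld xQ] by blast
  obtain m' where m': "m = map_poly of_rat m'"
    using polys_over_Rats_obtain[of m] m by (auto simp: is_minpoly_def)
  have "Factorial_Ring.irreducible m'" using irreducible_minpoly[OF xQ] m m' by simp
  moreover have "poly (map_poly of_rat m') x = 0" using m m' by (simp add: is_minpoly_def)
  moreover have "g x \<in> gal_orbit x" using g by (auto simp: gal_orbit_def)
  then have "poly (map_poly of_rat m') (g x) = 0" using gal_orbit_eq_roots[OF xQ m] m' by simp
  ultimately show ?thesis using M x unfolding galois_number_field_def by blast
qed

text \<open>Converse of \<open>galois_number_field_stable\<close>. An irreducible rational
  polynomial with a root x in M is a constant multiple of the minimal polynomial of x, so its roots
  are the conjugates of x.\<close>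

lemma galois_number_fieldI:
  assumes M: "number_field M" and st: "\<And>g x. g \<in> abs_gal \<Longrightarrow> x \<in> M \<Longrightarrow> g x \<in> M"
  shows "galois_number_field M"
  unfolding galois_number_field_def
proof (intro conjI allI impI M, elim conjE bexE)
  fix p :: "rat poly" and z x :: complex
  assume p: "Factorial_Ring.irreducible p" and z: "poly (map_poly of_rat p) z = 0"
    and x: "x \<in> M" "poly (map_poly of_rat p) x = 0"
  have xQ: "x \<in> Qbar" using number_field_Qbar[OF M] x by blast
  obtain m where m: "is_minpoly \<rat> x m" using Qbar_minpoly[OF Rats_subfld xQ] by blast
  obtain m' where m': "m = map_poly of_rat m'"
    using polys_over_Rats_obtain[of m] m by (auto simp: is_minpoly_def)
  obtain s where s: "s \<in> polys_over \<rat>" "map_poly of_rat p = s * m"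
    using is_minpoly_dvd[OF Rats_subfld m map_poly_of_rat_polys_over x(2)] by blast
  obtain s' where s': "s = map_poly of_rat s'" using polys_over_Rats_obtain[OF s(1)] by blast
  have "(map_poly of_rat p :: complex poly) = map_poly of_rat (s' * m')"
    using s(2) s' m' by (simp add: map_poly_of_rat_mult)
  then have pe: "p = s' * m'" by (rule map_poly_of_rat_inj)
  have "degree m' > 0" using is_minpoly_degree_pos[OF m] m' by (simp add: degree_map_poly_of_rat)
  then have "\<not> m' dvd 1" using is_unit_iff_degree[of m'] by force
  then have "s' dvd 1" using p pe by (meson Factorial_Ring.irreducibleD)
  then have "s' \<noteq> 0" by auto
  moreover from this have "degree s' = 0" using \<open>s' dvd 1\<close> is_unit_iff_degree by blast
  then obtain c where "s' = [:c:]" by (rule degree_eq_zeroE)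
  ultimately obtain c where c: "s' = [:c:]" "c \<noteq> 0" by auto
  then have "poly s z \<noteq> 0" using s' by (simp add: map_poly_pCons)
  then have "poly m z = 0" using z s(2) by simp
  then have "z \<in> gal_orbit x" using gal_orbit_eq_roots[OF xQ m] by simp
  then show "z \<in> M" using st x(1) by (auto simp: gal_orbit_def)
qed

section \<open>Normal closures\<close>

definition conj_field :: "complex set \<Rightarrow> complex set" where
  "conj_field K = generate_field complex_ring (\<Union>g\<in>abs_gal. g ` K)"

lemma generate_field_least: "subfld E \<Longrightarrow> H \<subseteq> E \<Longrightarrow> generate_field complex_ring H \<subseteq> E"
  using field.generate_field_min_subfield1[OF complex_ring_field, of H E] by simp

lemma generate_field_subfld: "subfld (generate_field complex_ring H)"
  using field.generate_field_is_subfield[OF complex_ring_field, of H] by simp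

lemma generate_field_base: "H \<subseteq> generate_field complex_ring H"
  by (rule subsetI) (rule generate_field.incl)

text \<open>Everything passes from the conjugates of K to the field they generate: agreement of g
  and h through their equalizer, stability under g through the preimage of the field. Orbits of a
  determining set suffice, since g and h can be compared after composition with each f.\<close>

lemma conj_field_determined:
  assumes K: "subfld K" "K \<subseteq> Qbar" and A: "determined_by K A"
  shows "subfld (conj_field K)" "conj_field K \<subseteq> Qbar" "\<exists>B. determined_by (conj_field K) B"
    and "\<And>g x. g \<in> abs_gal \<Longrightarrow> x \<in> conj_field K \<Longrightarrow> g x \<in> conj_field K"
    and "\<And>g h x. g \<in> abs_gal \<Longrightarrow> h \<in> abs_gal \<Longrightarrow> x \<in> conj_field K \<Longrightarrow>
      (\<And>f y. f \<in> abs_gal \<Longrightarrow> y \<in> K \<Longrightarrow> g (f y) = h (f y)) \<Longrightarrow> g x = h x"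
proof -
  let ?H = "\<Union>g\<in>abs_gal. g ` K"
  show sub: "subfld (conj_field K)" unfolding conj_field_def by (rule generate_field_subfld)
  have HQ: "?H \<subseteq> Qbar" using K(2) abs_gal_mem by auto
  show cQ: "conj_field K \<subseteq> Qbar" unfolding conj_field_def by (rule generate_field_least[OF Qbar_subfld HQ])
  have base: "?H \<subseteq> conj_field K" unfolding conj_field_def by (rule generate_field_base)
  show agree: "g x = h x" if gh: "g \<in> abs_gal" "h \<in> abs_gal" "x \<in> conj_field K"
    and eq: "\<And>f y. f \<in> abs_gal \<Longrightarrow> y \<in> K \<Longrightarrow> g (f y) = h (f y)" for g h x
  proof -
    have "conj_field K \<subseteq> {x \<in> Qbar. g x = h x}"
      unfolding conj_field_def using HQ eq
      by (intro generate_field_least[OF equalizer_subfld[OF gh(1,2)]]) auto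
    with gh(3) show ?thesis by blast
  qed
  have A': "A \<subseteq> K" "finite A" using A by (auto simp: determined_by_def)
  have "determined_by (conj_field K) (\<Union>a\<in>A. gal_orbit a)"
    unfolding determined_by_def
  proof (intro conjI ballI impI)
    show "finite (\<Union>a\<in>A. gal_orbit a)" using A' K(2) finite_gal_orbit by auto
    show "(\<Union>a\<in>A. gal_orbit a) \<subseteq> conj_field K" using base A' by (auto simp: gal_orbit_def)
    fix g h x assume gh: "g \<in> abs_gal" "h \<in> abs_gal" and eq: "\<forall>a\<in>\<Union>a\<in>A. gal_orbit a. g a = h a"
      and x: "x \<in> conj_field K"
    show "g x = h x"
    proof (rule agree[OF gh x])
      fix f y assume f: "f \<in> abs_gal" and y: "y \<in> K"
      have "(g \<circ> f) a = (h \<circ> f) a" if "a \<in> A" for a using eq that f by (auto simp: gal_orbit_def)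
      from determined_byD[OF A abs_gal_comp[OF gh(1) f] abs_gal_comp[OF gh(2) f] this y]
      show "g (f y) = h (f y)" by simp
    qed
  qed
  then show "\<exists>B. determined_by (conj_field K) B" ..
  show "g x \<in> conj_field K" if g: "g \<in> abs_gal" and x: "x \<in> conj_field K" for g x
  proof -
    let ?S = "{x \<in> Qbar. g x \<in> conj_field K}"
    have S: "subfld ?S"
      by (rule subfldI)
        (auto simp: abs_gal_1[OF g] abs_gal_add[OF g] abs_gal_mult[OF g] abs_gal_minus[OF g] abs_gal_inverse[OF g]
        subfld_add[OF Qbar_subfld] subfld_mult[OF Qbar_subfld] subfld_1[OF Qbar_subfld]
        subfld_minus[OF Qbar_subfld] subfld_inverse[OF Qbar_subfld]
        subfld_add[OF sub] subfld_mult[OF sub] subfld_1[OF sub] subfld_minus[OF sub] subfld_inverse[OF sub])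
    have "g (f y) \<in> conj_field K" if "f \<in> abs_gal" "y \<in> K" for f y
    proof -
      have "(g \<circ> f) y \<in> ?H" using abs_gal_comp[OF g that(1)] that(2) by blast
      then show ?thesis using base by auto
    qed
    then have "?H \<subseteq> ?S" using HQ by blast
    from generate_field_least[OF S this, folded conj_field_def] x show ?thesis by blast
  qed
qed

text \<open>The intersection defining the closure is attained: \<open>conj_field K\<close> is itself
  Galois, and every Galois number field above K is stable under automorphisms and so contains all
  conjugates of K.\<close>

lemma galois_closure_eq:
  assumes K: "number_field K"
  shows "galois_closure K = conj_field K" "galois_number_field (conj_field K)"
proof -
  obtain A where A: "determined_by K A" using number_field_determined[OF K] by blast
  note KQ = number_field_subfld[OF K] number_field_Qbar[OF K]
  note cf = conj_field_determined[OF KQ A]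
  have "number_field (conj_field K)" using number_field_of_determined(1)[OF cf(1,2)] cf(3) by blast
  then show gal: "galois_number_field (conj_field K)" by (rule galois_number_fieldI) (rule cf(4))
  have base: "(\<Union>g\<in>abs_gal. g ` K) \<subseteq> conj_field K" unfolding conj_field_def by (rule generate_field_base)
  have "K \<subseteq> conj_field K" using base abs_gal_id by fastforce
  then have "galois_closure K \<subseteq> conj_field K" using gal by (auto simp: galois_closure_def)
  moreover have "conj_field K \<subseteq> M" if M: "galois_number_field M" "K \<subseteq> M" for M
  proof -
    have "subfld M" using M(1) by (auto simp: galois_number_field_def number_field_subfld)
    moreover have "(\<Union>g\<in>abs_gal. g ` K) \<subseteq> M" using galois_number_field_stable[OF M(1)] M(2) by blast
    ultimately show ?thesis unfolding conj_field_def by (rule generate_field_least)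
  qed
  then have "conj_field K \<subseteq> galois_closure K" by (auto simp: galois_closure_def)
  ultimately show "galois_closure K = conj_field K" by blast
qed

section \<open>Galois groups as groups of restrictions\<close>

lemma galois_group_carrier:
  assumes M: "galois_number_field M"
  shows "carrier (galois_group M) = (\<lambda>g. restrict g M) ` abs_gal"
proof (intro equalityI subsetI)
  have nf: "number_field M" using M by (simp add: galois_number_field_def)
  note MQ = number_field_subfld[OF nf] number_field_Qbar[OF nf]
  fix \<tau>
  {
    assume "\<tau> \<in> carrier (galois_group M)"
    then have "\<tau> \<in> embeddings M"
      by (auto simp: galois_group_def Bij_def ring_iso_def embeddings_def Ring.ring_hom_def)
    then show "\<tau> \<in> (\<lambda>g. restrict g M) ` abs_gal" by (simp add: embeddings_eq_restrict[OF MQ])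
  }
  assume "\<tau> \<in> (\<lambda>g. restrict g M) ` abs_gal"
  then obtain g where g: "g \<in> abs_gal" "\<tau> = restrict g M" by auto
  have mem: "g x \<in> M" if "x \<in> M" for x using galois_number_field_stable[OF M g(1) that] .
  have im: "g ` M = M"
  proof (intro equalityI subsetI)
    fix x assume "x \<in> M"
    then have "inv_into UNIV g x \<in> M" by (rule galois_number_field_stable[OF M abs_gal_inv[OF g(1)]])
    then show "x \<in> g ` M" using abs_gal_inv_cancel(1)[OF g(1), of x] by (metis imageI)
  qed (use mem in auto)
  have "inj_on g M" using abs_gal_bij[OF g(1)] by (meson bij_is_inj inj_on_subset subset_UNIV)
  with im have bij: "bij_betw \<tau> M M" unfolding g(2) by (simp add: bij_betw_def inj_on_restrict_eq)
  have emb: "field_emb M \<tau>"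
    using field_emb_cong[OF MQ(1) field_emb_mono[OF abs_gal_emb[OF g(1)] MQ(2)], of \<tau>] g(2) by simp
  have hom: "\<tau> \<in> Ring.ring_hom (complex_ring\<lparr>carrier := M\<rparr>) (complex_ring\<lparr>carrier := M\<rparr>)"
    using emb bij by (auto simp: Ring.ring_hom_def field_emb_def bij_betw_def)
  have "\<tau> x = x" if "x \<in> \<rat>" for x by (rule field_emb_Rats[OF MQ(1) emb that])
  then show "\<tau> \<in> carrier (galois_group M)" using bij hom g(2)
    by (auto simp: galois_group_def Bij_def ring_iso_def)
qed

lemma galois_group_mult:
  assumes M: "galois_number_field M" and gh: "g \<in> abs_gal" "h \<in> abs_gal"
  shows "restrict g M \<otimes>\<^bsub>galois_group M\<^esub> restrict h M = restrict (g \<circ> h) M"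
proof -
  have "restrict g M \<in> Bij M" "restrict h M \<in> Bij M"
    using galois_group_carrier[OF M] gh by (auto simp: galois_group_def)
  then show ?thesis using galois_number_field_stable[OF M gh(2)]
    by (auto simp: galois_group_def BijGroup_def compose_def restrict_def)
qed

lemma galois_group_cyclic_commute:
  assumes M: "galois_number_field M" and iso: "galois_group M \<cong> integer_mod_group l"
    and gh: "g \<in> abs_gal" "h \<in> abs_gal" and x: "x \<in> M"
  shows "g (h x) = h (g x)"
proof -
  obtain \<phi> where \<phi>: "\<phi> \<in> Group.iso (galois_group M) (integer_mod_group l)"
    using iso by (auto simp: is_iso_def)
  let ?C = "carrier (galois_group M)"
  have C: "restrict f M \<in> ?C" if "f \<in> abs_gal" for f using that galois_group_carrier[OF M] by auto
  \<comment> \<open>The target group is commutative, so the factors may be swapped;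
    \<open>hom\<close> and \<open>hom'\<close> then differ only in their order.\<close>
  have hom: "\<phi> (a \<otimes>\<^bsub>galois_group M\<^esub> b) = \<phi> b \<otimes>\<^bsub>integer_mod_group l\<^esub> \<phi> a" if "a \<in> ?C" "b \<in> ?C" for a b
    using \<phi> that by (auto simp: Group.iso_def hom_def add.commute)
  have hom': "\<phi> (a \<otimes>\<^bsub>galois_group M\<^esub> b) = \<phi> a \<otimes>\<^bsub>integer_mod_group l\<^esub> \<phi> b" if "a \<in> ?C" "b \<in> ?C" for a b
    using \<phi> that by (auto simp: Group.iso_def hom_def)
  have "\<phi> (restrict (g \<circ> h) M) = \<phi> (restrict (h \<circ> g) M)"
    using hom[OF C[OF gh(1)] C[OF gh(2)]] hom'[OF C[OF gh(2)] C[OF gh(1)]]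
    by (simp add: galois_group_mult[OF M gh] galois_group_mult[OF M gh(2,1)])
  then have "restrict (g \<circ> h) M = restrict (h \<circ> g) M"
    using \<phi> C[OF abs_gal_comp[OF gh]] C[OF abs_gal_comp[OF gh(2,1)]]
    by (auto simp: Group.iso_def bij_betw_def dest: inj_onD)
  then have "(g \<circ> h) x = (h \<circ> g) x" using x by (metis restrict_apply')
  then show ?thesis by simp
qed

lemma embeddings_compose:
  assumes K: "subfld K" "K \<subseteq> Qbar" and g: "g \<in> abs_gal" and \<sigma>: "\<sigma> \<in> embeddings K"
  shows "restrict (g \<circ> \<sigma>) K \<in> embeddings K"
proof -
  obtain f where f: "f \<in> abs_gal" "\<sigma> = restrict f K" using \<sigma> by (auto simp: embeddings_eq_restrict[OF K])
  then have "restrict (g \<circ> \<sigma>) K = restrict (g \<circ> f) K" by (auto simp: restrict_def)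
  then show ?thesis using abs_gal_comp[OF g f(1)] by (auto simp: embeddings_eq_restrict[OF K])
qed

text \<open>A counting argument. Automorphisms permute the k embeddings of K by composition, and two
  of them give the same permutation exactly when they agree on the closure. The Galois group has k!
  elements, so all k! permutations occur.\<close>

theorem symmetric_galois_group_realizes:
  assumes K: "number_field K" "field_degree K = k"
    and iso: "galois_group (galois_closure K) \<cong> sym_group k"
    and \<pi>: "\<pi> permutes embeddings K"
  shows "\<exists>g\<in>abs_gal. \<forall>\<sigma>\<in>embeddings K. \<forall>x\<in>K. g (\<sigma> x) = \<pi> \<sigma> x"
proof -
  let ?N = "galois_closure K" and ?E = "embeddings K"
  note KQ = number_field_subfld[OF K(1)] number_field_Qbar[OF K(1)]
  obtain A where A: "determined_by K A" using number_field_determined[OF K(1)] by blast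
  note N = galois_closure_eq[OF K(1)]
  note cf = conj_field_determined[OF KQ A, folded N(1)]
  have base: "f y \<in> ?N" if "f \<in> abs_gal" "y \<in> K" for f y
    using generate_field_base[of "\<Union>g\<in>abs_gal. g ` K"] that unfolding N(1) conj_field_def by blast
  have fin: "finite ?E" and cE: "card ?E = k" using number_field_degree[OF K(1)] K(2) by auto
  define \<Phi> where "\<Phi> g \<sigma> = (if \<sigma> \<in> ?E then restrict (g \<circ> \<sigma>) K else \<sigma>)" for g \<sigma>
  have perm: "\<Phi> g permutes ?E" if g: "g \<in> abs_gal" for g
  proof (rule bij_imp_permutes)
    have inj: "inj_on (\<Phi> g) ?E"
    proof (rule inj_onI)
      fix \<sigma> \<tau> assume \<sigma>: "\<sigma> \<in> ?E" "\<tau> \<in> ?E" "\<Phi> g \<sigma> = \<Phi> g \<tau>"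
      then have "restrict (g \<circ> \<sigma>) K = restrict (g \<circ> \<tau>) K" by (simp add: \<Phi>_def)
      then have "\<forall>x\<in>K. g (\<sigma> x) = g (\<tau> x)" by (simp add: restrict_eq_iff)
      then have "\<forall>x\<in>K. \<sigma> x = \<tau> x" using abs_gal_inv_cancel(2)[OF g] by metis
      then show "\<sigma> = \<tau>" using \<sigma>(1,2) by (auto simp: embeddings_eq intro: extensionalityI)
    qed
    have "\<Phi> g ` ?E \<subseteq> ?E" using embeddings_compose[OF KQ g] by (auto simp: \<Phi>_def)
    then show "bij_betw (\<Phi> g) ?E ?E" using endo_inj_surj[OF fin _ inj] inj by (simp add: bij_betw_def)
  qed (simp add: \<Phi>_def)
  have eq: "\<Phi> g = \<Phi> h \<longleftrightarrow> restrict g ?N = restrict h ?N" if gh: "g \<in> abs_gal" "h \<in> abs_gal" for g h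
  proof
    assume eq: "\<Phi> g = \<Phi> h"
    have "g (f y) = h (f y)" if fy: "f \<in> abs_gal" "y \<in> K" for f y
    proof -
      have "restrict f K \<in> ?E" using fy by (auto simp: embeddings_eq_restrict[OF KQ])
      then have "restrict (g \<circ> restrict f K) K = restrict (h \<circ> restrict f K) K"
        using fun_cong[OF eq, of "restrict f K"] by (simp add: \<Phi>_def)
      then show ?thesis using fy(2) by (auto simp: restrict_eq_iff)
    qed
    then have "\<forall>x\<in>?N. g x = h x" using cf(5)[OF gh] by blast
    then show "restrict g ?N = restrict h ?N" by (simp add: restrict_eq_iff)
  next
    assume eq: "restrict g ?N = restrict h ?N"
    have "g (\<sigma> x) = h (\<sigma> x)" if \<sigma>: "\<sigma> \<in> ?E" "x \<in> K" for \<sigma> x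
    proof -
      obtain f where "f \<in> abs_gal" "\<sigma> = restrict f K" using \<sigma>(1) by (auto simp: embeddings_eq_restrict[OF KQ])
      then have "\<sigma> x \<in> ?N" using base \<sigma>(2) by simp
      then show ?thesis using eq by (simp add: restrict_eq_iff)
    qed
    then show "\<Phi> g = \<Phi> h" by (auto simp: \<Phi>_def restrict_def fun_eq_iff)
  qed
  obtain \<phi> where "\<phi> \<in> Group.iso (galois_group ?N) (sym_group k)" using iso by (auto simp: is_iso_def)
  then have "card (carrier (galois_group ?N)) = card (carrier (sym_group k))"
    by (auto simp: Group.iso_def intro: bij_betw_same_card)
  also have "\<dots> = fact k" by (simp add: sym_group_def card_permutations)
  finally have "card ((\<lambda>g. restrict g ?N) ` abs_gal) = fact k"
    using galois_group_carrier N by simp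
  then have "card (\<Phi> ` abs_gal) = fact k" using card_image_eq_card_image[of abs_gal \<Phi> "\<lambda>g. restrict g ?N"] eq by simp
  moreover have "card {p. p permutes ?E} = fact k" by (rule card_permutations[OF cE fin])
  moreover have "\<Phi> ` abs_gal \<subseteq> {p. p permutes ?E}" using perm by auto
  moreover have "finite {p. p permutes ?E}" by (rule finite_permutations[OF fin])
  ultimately have "\<Phi> ` abs_gal = {p. p permutes ?E}" by (intro card_subset_eq) auto
  then obtain g where g: "g \<in> abs_gal" "\<Phi> g = \<pi>" using \<pi> by (metis imageE mem_Collect_eq)
  have "g (\<sigma> x) = \<pi> \<sigma> x" if "\<sigma> \<in> ?E" "x \<in> K" for \<sigma> x
  proof -
    have "restrict (g \<circ> \<sigma>) K x = \<pi> \<sigma> x" using fun_cong[OF g(2), of \<sigma>] that by (simp add: \<Phi>_def)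
    with that show ?thesis by simp
  qed
  with g(1) show ?thesis by blast
qed

section \<open>Composita\<close>

lemma compositum_subfld: "subfld (compositum K L)"
  unfolding compositum_def by (rule generate_field_subfld)

lemma compositum_base: "K \<subseteq> compositum K L" "L \<subseteq> compositum K L"
  unfolding compositum_def using generate_field_base[of "K \<union> L"] by auto

lemma compositum_Qbar:
  assumes "K \<subseteq> Qbar" "L \<subseteq> Qbar" shows "compositum K L \<subseteq> Qbar"
  unfolding compositum_def using assms by (intro generate_field_least Qbar_subfld) auto

lemma compositum_agree:
  assumes "K \<subseteq> Qbar" "L \<subseteq> Qbar" and gh: "g \<in> abs_gal" "h \<in> abs_gal"
    and "\<And>x. x \<in> K \<Longrightarrow> g x = h x" "\<And>x. x \<in> L \<Longrightarrow> g x = h x" and x: "x \<in> compositum K L"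
  shows "g x = h x"
proof -
  have "compositum K L \<subseteq> {x \<in> Qbar. g x = h x}"
    unfolding compositum_def using assms(1,2,5,6) by (intro generate_field_least equalizer_subfld[OF gh]) auto
  with x show ?thesis by blast
qed

lemma compositum_determined:
  assumes K: "K \<subseteq> Qbar" "determined_by K A" and L: "L \<subseteq> Qbar" "determined_by L A'"
  shows "determined_by (compositum K L) (A \<union> A')"
  unfolding determined_by_def
proof (intro conjI ballI impI)
  show "finite (A \<union> A')" "A \<union> A' \<subseteq> compositum K L"
    using K(2) L(2) compositum_base[where K = K and L = L] by (auto simp: determined_by_def)
  fix g h x assume gh: "g \<in> abs_gal" "h \<in> abs_gal" "\<forall>a\<in>A \<union> A'. g a = h a" and x: "x \<in> compositum K L"
  show "g x = h x"
  proof (rule compositum_agree[OF K(1) L(1) gh(1,2) _ _ x])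
    show "g y = h y" if "y \<in> K" for y using determined_byD[OF K(2) gh(1,2) _ that] gh(3) by blast
    show "g y = h y" if "y \<in> L" for y using determined_byD[OF L(2) gh(1,2) _ that] gh(3) by blast
  qed
qed

section \<open>The joint action on the embeddings of K and on L\<close>

locale symmetric_and_abelian =
  fixes K L :: "complex set"
  assumes K: "subfld K" "K \<subseteq> Qbar" and L: "subfld L" "L \<subseteq> Qbar"
    and L_stable: "\<And>g x. g \<in> abs_gal \<Longrightarrow> x \<in> L \<Longrightarrow> g x \<in> L"
    and L_commute: "\<And>g h x. g \<in> abs_gal \<Longrightarrow> h \<in> abs_gal \<Longrightarrow> x \<in> L \<Longrightarrow> g (h x) = h (g x)"
    and perms: "\<And>\<pi>. \<pi> permutes embeddings K \<Longrightarrow> \<exists>g\<in>abs_gal. \<forall>\<sigma>\<in>embeddings K. \<forall>x\<in>K. g (\<sigma> x) = \<pi> \<sigma> x"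
    and three: "card (embeddings K) \<ge> 3"
begin

text \<open>Commutators act trivially on \<open>L\<close>, and the 3-cycle needed here is a commutator of two transpositions.\<close>

lemma three_cycle:
  assumes \<sigma>: "\<sigma>1 \<in> embeddings K" "\<sigma>2 \<in> embeddings K" "\<sigma>3 \<in> embeddings K" "\<sigma>1 \<noteq> \<sigma>2" "\<sigma>1 \<noteq> \<sigma>3" "\<sigma>2 \<noteq> \<sigma>3"
  shows "\<exists>h\<in>abs_gal. (\<forall>x\<in>L. h x = x) \<and> (\<forall>x\<in>K. h (\<sigma>1 x) = \<sigma>2 x \<and> h (\<sigma>2 x) = \<sigma>3 x)"
proof -
  let ?t1 = "Transposition.transpose \<sigma>1 \<sigma>3" and ?t2 = "Transposition.transpose \<sigma>3 \<sigma>2"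
  obtain g1 where g1: "g1 \<in> abs_gal" "\<And>\<sigma> x. \<sigma> \<in> embeddings K \<Longrightarrow> x \<in> K \<Longrightarrow> g1 (\<sigma> x) = ?t1 \<sigma> x"
    using perms[of ?t1] permutes_swap_id[of \<sigma>1 "embeddings K" \<sigma>3] \<sigma> by blast
  obtain g2 where g2: "g2 \<in> abs_gal" "\<And>\<sigma> x. \<sigma> \<in> embeddings K \<Longrightarrow> x \<in> K \<Longrightarrow> g2 (\<sigma> x) = ?t2 \<sigma> x"
    using perms[of ?t2] permutes_swap_id[of \<sigma>3 "embeddings K" \<sigma>2] \<sigma> by blast
  let ?i1 = "inv_into UNIV g1" and ?i2 = "inv_into UNIV g2"
  note i1 = abs_gal_inv_cancel[OF g1(1)] and i2 = abs_gal_inv_cancel[OF g2(1)]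
  \<comment> \<open>Read from right to left, the four factors move \<sigma>1 to \<sigma>1,
    \<sigma>3, \<sigma>2, \<sigma>2 and \<sigma>2 to \<sigma>3, \<sigma>1, \<sigma>1,
    \<sigma>3.\<close>
  define h where "h = g1 \<circ> g2 \<circ> ?i1 \<circ> ?i2"
  have "h \<in> abs_gal" unfolding h_def by (intro abs_gal_comp abs_gal_inv g1 g2)
  moreover have "h x = x" if x: "x \<in> L" for x
  proof -
    have "?i1 (?i2 x) \<in> L" by (rule L_stable[OF abs_gal_inv[OF g1(1)] L_stable[OF abs_gal_inv[OF g2(1)] x]])
    then have "g1 (g2 (?i1 (?i2 x))) = g2 (g1 (?i1 (?i2 x)))" by (rule L_commute[OF g1(1) g2(1)])
    then show ?thesis by (simp add: h_def i1 i2)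
  qed
  moreover have "h (\<sigma>1 x) = \<sigma>2 x" "h (\<sigma>2 x) = \<sigma>3 x" if x: "x \<in> K" for x
  proof -
    have t1: "g1 (\<sigma>1 x) = \<sigma>3 x" "g1 (\<sigma>3 x) = \<sigma>1 x" "g1 (\<sigma>2 x) = \<sigma>2 x"
      using g1(2)[OF _ x] \<sigma> by (simp_all add: Transposition.transpose_def)
    have t2: "g2 (\<sigma>1 x) = \<sigma>1 x" "g2 (\<sigma>3 x) = \<sigma>2 x" "g2 (\<sigma>2 x) = \<sigma>3 x"
      using g2(2)[OF _ x] \<sigma> by (simp_all add: Transposition.transpose_def)
    have "?i2 (\<sigma>1 x) = \<sigma>1 x" "?i1 (\<sigma>1 x) = \<sigma>3 x" "?i2 (\<sigma>2 x) = \<sigma>3 x" "?i1 (\<sigma>3 x) = \<sigma>1 x"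
      using i1(2) i2(2) t1 t2 by metis+
    then show "h (\<sigma>1 x) = \<sigma>2 x" "h (\<sigma>2 x) = \<sigma>3 x" using t1 t2 by (simp_all add: h_def)
  qed
  ultimately show ?thesis by blast
qed

text \<open>A 3-cycle from the inclusion of K to \<sigma> needs a third embedding, which
  \<open>three\<close> supplies. This transitivity is the linear disjointness behind the degree
  formula.\<close>

lemma transitive_over_L:
  assumes \<sigma>: "\<sigma> \<in> embeddings K"
  shows "\<exists>h\<in>abs_gal. (\<forall>x\<in>L. h x = x) \<and> (\<forall>x\<in>K. h x = \<sigma> x)"
proof (cases "\<forall>x\<in>K. \<sigma> x = x")
  case True
  then show ?thesis using abs_gal_id by (intro bexI[of _ id]) auto
next
  case False
  let ?\<iota> = "restrict id K"
  have \<iota>: "?\<iota> \<in> embeddings K" "?\<iota> \<noteq> \<sigma>" using abs_gal_id False by (auto simp: embeddings_eq_restrict[OF K])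
  have "card {?\<iota>, \<sigma>} < card (embeddings K)" using three \<iota>(2) by simp
  then obtain \<tau> where \<tau>: "\<tau> \<in> embeddings K" "\<tau> \<notin> {?\<iota>, \<sigma>}" using \<sigma> \<iota> 
    by (metis card_mono finite.emptyI finite.insertI not_le subsetI)
  from three_cycle[OF \<iota>(1) \<sigma> \<tau>(1) \<iota>(2)] \<tau>(2)
  obtain h where h: "h \<in> abs_gal" "\<forall>x\<in>L. h x = x" "\<forall>x\<in>K. h (?\<iota> x) = \<sigma> x" by blast
  have "\<forall>x\<in>K. h x = \<sigma> x" using h(3) by simp
  with h(1,2) show ?thesis by blast
qed

text \<open>Suppose g fixes L and \<alpha> but acts on K as \<sigma>, different from the inclusion
  \<iota>, and let h be any automorphism fixing L, acting on K as a third embedding \<tau>. The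
  3-cycle c through \<iota>, \<sigma>, \<tau> agrees with g on the compositum, so it fixes \<alpha>;
  and h agrees there with c after g, so h fixes \<alpha> too. Hence \<alpha> would lie in L.\<close>

lemma subset_adjoin_of_not_mem:
  assumes \<alpha>: "\<alpha> \<in> compositum K L" "\<alpha> \<notin> L"
  shows "K \<subseteq> adjoin L \<alpha>"
proof
  fix x assume x: "x \<in> K"
  have \<alpha>Q: "\<alpha> \<in> Qbar" using \<alpha> compositum_Qbar[OF K(2) L(2)] by blast
  show "x \<in> adjoin L \<alpha>"
  proof (rule abs_gal_fixed_field[OF adjoin_Qbar[OF L \<alpha>Q]])
    show "x \<in> Qbar" using x K by blast
    fix g assume g: "g \<in> abs_gal" "\<And>e. e \<in> adjoin L \<alpha> \<Longrightarrow> g e = e"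
    have gL: "g y = y" if "y \<in> L" for y using g(2) adjoin_base[OF L(1)] that by blast
    have g\<alpha>: "g \<alpha> = \<alpha>" using g(2) adjoin_mem[OF L(1)] by blast
    show "g x = x"
    proof (rule ccontr)
      assume gx: "g x \<noteq> x"
      let ?\<iota> = "restrict id K" and ?\<sigma> = "restrict g K"
      have emb: "restrict f K \<in> embeddings K" if "f \<in> abs_gal" for f
        using that by (auto simp: embeddings_eq_restrict[OF K])
      have ne: "?\<iota> \<noteq> ?\<sigma>" using x gx by (metis id_apply restrict_apply')
      have "\<alpha> \<in> L"
      proof (rule abs_gal_fixed_field[OF L \<alpha>Q])
        fix h assume h: "h \<in> abs_gal" "\<And>e. e \<in> L \<Longrightarrow> h e = e"
        let ?\<tau> = "restrict h K"
        consider "?\<tau> = ?\<iota>" | "?\<tau> = ?\<sigma>" | "?\<tau> \<noteq> ?\<iota>" "?\<tau> \<noteq> ?\<sigma>" by blast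
        then show "h \<alpha> = \<alpha>"
        proof cases
          case 1
          then have "h \<alpha> = id \<alpha>"
            using h by (intro compositum_agree[OF K(2) L(2) h(1) abs_gal_id _ _ \<alpha>(1)]) (auto simp: restrict_eq_iff)
          then show ?thesis by simp
        next
          case 2
          then have "h \<alpha> = g \<alpha>"
            using h gL by (intro compositum_agree[OF K(2) L(2) h(1) g(1) _ _ \<alpha>(1)]) (auto simp: restrict_eq_iff)
          then show ?thesis using g\<alpha> by simp
        next
          case 3
          obtain c where c: "c \<in> abs_gal" "\<forall>x\<in>L. c x = x" "\<forall>x\<in>K. c (?\<iota> x) = ?\<sigma> x \<and> c (?\<sigma> x) = ?\<tau> x"
            using three_cycle[OF emb[OF abs_gal_id] emb[OF g(1)] emb[OF h(1)] ne] 3 by metis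
          have "c \<alpha> = g \<alpha>"
            using c gL by (intro compositum_agree[OF K(2) L(2) c(1) g(1) _ _ \<alpha>(1)]) auto
          moreover have "h \<alpha> = (c \<circ> g) \<alpha>"
            using c gL h by (intro compositum_agree[OF K(2) L(2) h(1) abs_gal_comp[OF c(1) g(1)] _ _ \<alpha>(1)]) auto
          ultimately show ?thesis using g\<alpha> by simp
        qed
      qed
      with \<alpha>(2) show False ..
    qed
  qed
qed

text \<open>An embedding of the compositum is its pair of restrictions to K and L, and every pair
  occurs: a lift g of the embedding of L is corrected by an h that fixes L and equals the inverse of
  g after \<sigma> on K.\<close>

lemma card_embeddings_compositum:
  "card (embeddings (compositum K L)) = card (embeddings K) * card (embeddings L)"
proof -
  let ?F = "compositum K L"
  let ?f = "\<lambda>g. (restrict g K, restrict g L)"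
  have "card (embeddings ?F) = card (?f ` abs_gal)"
    unfolding embeddings_eq_restrict[OF compositum_subfld compositum_Qbar[OF K(2) L(2)]]
  proof (rule card_image_eq_card_image)
    fix g h assume gh: "g \<in> abs_gal" "h \<in> abs_gal"
    show "restrict g ?F = restrict h ?F \<longleftrightarrow> ?f g = ?f h"
    proof
      assume "restrict g ?F = restrict h ?F"
      then show "?f g = ?f h" using compositum_base[where K = K and L = L] by (simp add: restrict_eq_iff subset_iff)
    next
      assume "?f g = ?f h"
      then have "\<forall>x\<in>K. g x = h x" "\<forall>x\<in>L. g x = h x" by (simp_all add: restrict_eq_iff)
      then show "restrict g ?F = restrict h ?F"
        unfolding restrict_eq_iff using compositum_agree[OF K(2) L(2) gh] by (metis (full_types))
    qed
  qed
  also have "?f ` abs_gal = embeddings K \<times> embeddings L"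
  proof (intro equalityI subsetI)
    fix p assume "p \<in> ?f ` abs_gal"
    then show "p \<in> embeddings K \<times> embeddings L"
      by (auto simp: embeddings_eq_restrict[OF K] embeddings_eq_restrict[OF L])
  next
    fix p assume "p \<in> embeddings K \<times> embeddings L"
    then obtain \<sigma> g where p: "p = (\<sigma>, restrict g L)" "\<sigma> \<in> embeddings K" "g \<in> abs_gal"
      by (auto simp: embeddings_eq_restrict[OF L])
    let ?i = "inv_into UNIV g"
    have i: "?i \<in> abs_gal" by (rule abs_gal_inv[OF p(3)])
    obtain h where h: "h \<in> abs_gal" "\<forall>x\<in>L. h x = x" "\<forall>x\<in>K. h x = restrict (?i \<circ> \<sigma>) K x"
      using transitive_over_L[OF embeddings_compose[OF K i p(2)]] by blast
    have "restrict (g \<circ> h) K = \<sigma>"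
      using h(3) p(2) abs_gal_inv_cancel(1)[OF p(3)]
      by (auto simp: embeddings_eq fun_eq_iff restrict_def extensional_def)
    moreover have "restrict (g \<circ> h) L = restrict g L" using h(2) by (simp add: restrict_eq_iff)
    ultimately have "p = ?f (g \<circ> h)" using p by simp
    then show "p \<in> ?f ` abs_gal" using abs_gal_comp[OF p(3) h(1)] by blast
  qed
  finally show ?thesis by (simp add: card_cartesian_product)
qed

end

section \<open>Algebraic integers\<close>

definition zspan :: "complex set \<Rightarrow> complex set" where
  "zspan S = {\<Sum>s\<in>S. of_int (c s) * s | c. True}"

lemma zspan_base:
  assumes "finite S" "s \<in> S" shows "s \<in> zspan S"
  unfolding zspan_def
proof (intro CollectI exI conjI TrueI)
  have "(\<Sum>t\<in>S. of_int (if t = s then 1 else 0) * t) = (\<Sum>t\<in>S. if t = s then t else 0)"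
    by (rule sum.cong) auto
  also have "\<dots> = s" using assms by simp
  finally show "s = (\<Sum>t\<in>S. of_int ((\<lambda>t. if t = s then 1 else 0) t) * t)" by simp
qed

lemma zspan_0: "0 \<in> zspan S"
  unfolding zspan_def by (intro CollectI exI[of _ "\<lambda>_. 0"]) simp

lemma zspan_add:
  assumes "u \<in> zspan S" "v \<in> zspan S" shows "u + v \<in> zspan S"
proof -
  obtain c d where "u = (\<Sum>s\<in>S. of_int (c s) * s)" "v = (\<Sum>s\<in>S. of_int (d s) * s)"
    using assms by (auto simp: zspan_def)
  then have "u + v = (\<Sum>s\<in>S. of_int (c s + d s) * s)" by (simp add: sum.distrib algebra_simps)
  then show ?thesis unfolding zspan_def by (intro CollectI exI[of _ "\<lambda>s. c s + d s"]) simp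
qed

lemma zspan_scale:
  assumes "u \<in> zspan S" shows "of_int n * u \<in> zspan S"
proof -
  obtain c where "u = (\<Sum>s\<in>S. of_int (c s) * s)" using assms by (auto simp: zspan_def)
  then have "of_int n * u = (\<Sum>s\<in>S. of_int (n * c s) * s)" by (simp add: sum_distrib_left mult.assoc)
  then show ?thesis unfolding zspan_def by (intro CollectI exI[of _ "\<lambda>s. n * c s"]) simp
qed

lemma zspan_sum: "(\<And>i. i \<in> I \<Longrightarrow> f i \<in> zspan S) \<Longrightarrow> sum f I \<in> zspan S"
  by (induction I rule: infinite_finite_induct) (auto simp: zspan_0 zspan_add)

lemma zspan_mult_closed:
  assumes "\<And>s. s \<in> S \<Longrightarrow> z * s \<in> zspan S" "u \<in> zspan S" shows "z * u \<in> zspan S"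
proof -
  obtain c where "u = (\<Sum>s\<in>S. of_int (c s) * s)" using assms(2) by (auto simp: zspan_def)
  then have "z * u = (\<Sum>s\<in>S. of_int (c s) * (z * s))" by (simp add: sum_distrib_left mult_ac)
  then show ?thesis using assms(1) by (auto intro!: zspan_sum zspan_scale)
qed

text \<open>The determinant trick: the generators form an eigenvector, for the eigenvalue z, of an
  integer matrix, whose characteristic polynomial is monic and integral. The generator 1 makes the
  eigenvector nonzero.\<close>

lemma algebraic_int_if_zspan_stable:
  assumes S: "finite S" "1 \<in> S" and z: "\<And>s. s \<in> S \<Longrightarrow> z * s \<in> zspan S"
  shows "algebraic_int z"
proof -
  have "\<forall>s\<in>S. \<exists>c. z * s = (\<Sum>t\<in>S. of_int (c t) * t)" using z by (auto simp: zspan_def)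
  then obtain c where c: "\<And>s. s \<in> S \<Longrightarrow> z * s = (\<Sum>t\<in>S. of_int (c s t) * t)" by metis
  let ?n = "card S"
  obtain b where b: "bij_betw b {0..<?n} S" using ex_bij_betw_nat_finite[OF S(1)] by blast
  define A where "A = mat ?n ?n (\<lambda>(i, j). c (b i) (b j) :: int)"
  have A: "A \<in> carrier_mat ?n ?n" by (simp add: A_def)
  let ?A = "map_mat of_int A :: complex mat"
  have A': "?A \<in> carrier_mat ?n ?n" using A by simp
  define v where "v = vec ?n b"
  have "?A *\<^sub>v v = z \<cdot>\<^sub>v v"
  proof (rule eq_vecI)
    fix i assume "i < dim_vec (z \<cdot>\<^sub>v v)"
    then have i: "i < ?n" by (simp add: v_def)
    then have bi: "b i \<in> S" using b by (auto simp: bij_betw_def)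
    have "(?A *\<^sub>v v) $ i = (\<Sum>j\<in>{0..<?n}. of_int (c (b i) (b j)) * b j)"
      using i by (simp add: A_def v_def scalar_prod_def)
    also have "\<dots> = (\<Sum>t\<in>S. of_int (c (b i) t) * t)"
      by (rule sum.reindex_bij_betw[OF b])
    also have "\<dots> = z * b i" using c[OF bi] by simp
    finally show "(?A *\<^sub>v v) $ i = (z \<cdot>\<^sub>v v) $ i" using i by (simp add: v_def)
  qed (simp add: A_def v_def)
  moreover have "v \<noteq> 0\<^sub>v ?n"
  proof -
    have "1 \<in> b ` {0..<?n}" using b S(2) by (simp add: bij_betw_def)
    then obtain i where "i < ?n" "b i = 1" by force
    then have "v $ i \<noteq> 0\<^sub>v ?n $ i" by (simp add: v_def)
    then show ?thesis by auto
  qed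
  ultimately have "eigenvalue ?A z"
    unfolding eigenvalue_def eigenvector_def using A' by (intro exI[of _ v]) (auto simp: v_def)
  then have "poly (char_poly ?A) z = 0" using eigenvalue_root_char_poly[OF A'] by simp
  moreover have "char_poly ?A = map_poly of_int (char_poly A)" by (rule of_int_hom.char_poly_hom[OF A])
  moreover have "lead_coeff (char_poly A) = 1" using degree_monic_char_poly[OF A] by simp
  ultimately show ?thesis unfolding algebraic_int_altdef_ipoly by metis
qed

lemma algebraic_int_power_reduce:
  assumes "algebraic_int (x :: complex)"
  obtains d :: nat and a :: "nat \<Rightarrow> int" where "d > 0" "x ^ d = (\<Sum>i<d. of_int (a i) * x ^ i)"
proof -
  obtain p :: "int poly" where p: "poly (map_poly of_int p) x = 0" "lead_coeff p = 1"
    using assms unfolding algebraic_int_altdef_ipoly by blast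
  let ?d = "degree p"
  have d: "?d > 0"
  proof (rule gr0I)
    assume "?d = 0"
    then obtain c where "p = [:c:]" by (rule degree_eq_zeroE)
    with p show False by (simp add: map_poly_pCons)
  qed
  have "poly (map_poly of_int p) x = (\<Sum>i\<le>?d. of_int (coeff p i) * x ^ i)"
    by (simp add: poly_altdef degree_map_poly coeff_map_poly)
  also have "\<dots> = (\<Sum>i<?d. of_int (coeff p i) * x ^ i) + x ^ ?d"
    using p(2) by (simp add: lessThan_Suc_atMost[symmetric])
  finally have "x ^ ?d = (\<Sum>i<?d. of_int (- coeff p i) * x ^ i)"
    using p(1) by (simp add: sum_negf add_eq_0_iff)
  with d that[of ?d "\<lambda>i. - coeff p i"] show ?thesis by simp
qed

lemma
  assumes "algebraic_int (x :: complex)" "algebraic_int y"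
  shows algebraic_int_add: "algebraic_int (x + y)"
    and algebraic_int_mult: "algebraic_int (x * y)"
proof -
  obtain d a where d: "d > 0" "x ^ d = (\<Sum>i<d. of_int (a i :: int) * x ^ i)"
    using algebraic_int_power_reduce[OF assms(1)] by blast
  obtain e b where e: "e > 0" "y ^ e = (\<Sum>i<e. of_int (b i :: int) * y ^ i)"
    using algebraic_int_power_reduce[OF assms(2)] by blast
  \<comment> \<open>Monomials below the degrees of the two integral equations: multiplication by x
    or y stays in their span, since the equations rewrite the top powers. Positivity of d and e puts
    1 into S.\<close>
  define S where "S = (\<lambda>(i, j). x ^ i * y ^ j) ` ({..<d} \<times> {..<e})"
  have fin: "finite S" by (simp add: S_def)
  have mem: "x ^ i * y ^ j \<in> S" if "i < d" "j < e" for i j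
    using that by (force simp: S_def)
  have one: "1 \<in> S" using mem[of 0 0] d e by simp
  have base: "x ^ i * y ^ j \<in> zspan S" if "i < d" "j < e" for i j
    using zspan_base[OF fin mem[OF that]] .
  have X: "x * s \<in> zspan S" if s: "s \<in> S" for s
  proof -
    obtain i j where ij: "i < d" "j < e" "s = x ^ i * y ^ j" using s by (auto simp: S_def)
    show ?thesis
    proof (cases "Suc i < d")
      case True
      then show ?thesis using base[OF True ij(2)] ij(3) by (simp add: mult.assoc)
    next
      case False
      then have "d = Suc i" using ij(1) by simp
      then have "x * s = x ^ d * y ^ j" using ij(3) by simp
      also have "\<dots> = (\<Sum>k<d. of_int (a k) * (x ^ k * y ^ j))"
        unfolding d(2) sum_distrib_right by (simp add: mult.assoc)
      finally show ?thesis using base ij(2) by (auto intro!: zspan_sum zspan_scale)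
    qed
  qed
  have Y: "y * s \<in> zspan S" if s: "s \<in> S" for s
  proof -
    obtain i j where ij: "i < d" "j < e" "s = x ^ i * y ^ j" using s by (auto simp: S_def)
    show ?thesis
    proof (cases "Suc j < e")
      case True
      then show ?thesis using base[OF ij(1) True] ij(3) by (simp add: mult_ac)
    next
      case False
      then have "e = Suc j" using ij(2) by simp
      then have "y * s = x ^ i * y ^ e" using ij(3) by simp
      also have "\<dots> = (\<Sum>k<e. of_int (b k) * (x ^ i * y ^ k))"
        unfolding e(2) by (simp add: sum_distrib_left mult_ac)
      finally show ?thesis using base ij(1) by (auto intro!: zspan_sum zspan_scale)
    qed
  qed
  show "algebraic_int (x + y)"
    by (rule algebraic_int_if_zspan_stable[OF fin one]) (simp add: distrib_right X Y zspan_add)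
  show "algebraic_int (x * y)"
    by (rule algebraic_int_if_zspan_stable[OF fin one])
      (simp add: mult.assoc zspan_mult_closed[of S x, OF X] Y)
qed

lemma algebraic_int_prod:
  "(\<And>i. i \<in> I \<Longrightarrow> algebraic_int (f i :: complex)) \<Longrightarrow> algebraic_int (prod f I)"
  by (induction I rule: infinite_finite_induct) (auto simp: algebraic_int_mult)

lemma algebraic_int_diff:
  "algebraic_int (x :: complex) \<Longrightarrow> algebraic_int y \<Longrightarrow> algebraic_int (x - y)"
  using algebraic_int_add[of x "- y"] by simp

lemma algebraic_int_of_int_complex: "algebraic_int (of_int n :: complex)"
  by (rule int_imp_algebraic_int) simp

lemma algebraic_int_Qbar: "algebraic_int x \<Longrightarrow> x \<in> Qbar"
  by (auto simp: Qbar_def)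

lemma algebraic_int_abs_gal:
  assumes g: "g \<in> abs_gal" and x: "algebraic_int x" shows "algebraic_int (g x)"
proof -
  obtain p :: "int poly" where p: "poly (map_poly of_int p) x = 0" "lead_coeff p = 1"
    using x unfolding algebraic_int_altdef_ipoly by blast
  have "map_poly of_int p \<in> polys_over \<rat>" by (auto simp: polys_over_def coeff_map_poly)
  then have "poly (map_poly of_int p) (g x) = 0"
    using abs_gal_poly_Rats[OF g _ algebraic_int_Qbar[OF x]] p(1) abs_gal_0[OF g] by metis
  with p(2) show ?thesis unfolding algebraic_int_altdef_ipoly by blast
qed

lemma algebraic_imp_multiple_int:
  assumes "algebraic (x :: complex)" shows "\<exists>N :: int. N \<noteq> 0 \<and> algebraic_int (of_int N * x)"
proof -
  obtain p :: "int poly" where p: "p \<noteq> 0" "poly (map_poly of_int p) x = 0"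
    using assms by (rule algebraicE')
  define a where "a = lead_coeff p"
  define d where "d = degree p"
  have a: "a \<noteq> 0" using p(1) by (simp add: a_def)
  have sum0: "(\<Sum>i<d. of_int (coeff p i) * x ^ i) + of_int a * x ^ d = 0"
  proof -
    have "poly (map_poly of_int p) x = (\<Sum>i\<le>d. of_int (coeff p i) * x ^ i)"
      by (simp add: poly_altdef degree_map_poly coeff_map_poly d_def)
    then show ?thesis using p(2) by (simp add: lessThan_Suc_atMost[symmetric] a_def d_def)
  qed
  have d: "d > 0"
  proof (rule gr0I)
    assume "d = 0"
    with sum0 a show False by simp
  qed
  \<comment> \<open>The usual clearing of the leading coefficient: the monic polynomial q defined
    next satisfies q(a x) = a^(d-1) p(x).\<close>
  define r where "r = (\<Sum>i<d. Polynomial.monom (coeff p i * a ^ (d - 1 - i)) i)"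
  define q where "q = Polynomial.monom 1 d + r"
  have coeff_sum: "coeff r j = 0" if "j \<ge> d" for j
    using that by (simp add: r_def Polynomial.coeff_sum)
  have "degree q = d"
  proof (rule antisym)
    show "degree q \<le> d" by (rule degree_le) (simp add: q_def coeff_sum)
    show "d \<le> degree q" by (rule le_degree) (simp add: q_def coeff_sum)
  qed
  note deg = this
  have cq: "coeff q i = coeff p i * a ^ (d - 1 - i)" if "i < d" for i
    using that by (simp add: q_def r_def Polynomial.coeff_sum)
  have cd: "coeff q d = 1" by (simp add: q_def coeff_sum)
  then have lc: "lead_coeff q = 1" by (simp add: deg)
  have "poly (map_poly of_int q) (of_int a * x) = 
      (of_int a * x) ^ d + (\<Sum>i<d. of_int (coeff p i * a ^ (d - 1 - i)) * (of_int a * x) ^ i)"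
  proof -
    have "poly (map_poly of_int q) (of_int a * x) = (\<Sum>i\<le>d. of_int (coeff q i) * (of_int a * x) ^ i)"
      by (simp add: poly_altdef degree_map_poly coeff_map_poly deg)
    also have "\<dots> = (\<Sum>i<d. of_int (coeff q i) * (of_int a * x) ^ i) + (of_int a * x) ^ d"
      by (simp add: lessThan_Suc_atMost[symmetric] cd)
    also have "(\<Sum>i<d. of_int (coeff q i) * (of_int a * x) ^ i) =
        (\<Sum>i<d. of_int (coeff p i * a ^ (d - 1 - i)) * (of_int a * x) ^ i)"
      by (rule sum.cong) (simp_all add: cq)
    finally show ?thesis by (simp only: add.commute)
  qed
  also have "(\<Sum>i<d. of_int (coeff p i * a ^ (d - 1 - i)) * (of_int a * x) ^ i) =
      (\<Sum>i<d. of_int (a ^ (d - 1)) * (of_int (coeff p i) * x ^ i))"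
  proof (rule sum.cong[OF refl])
    fix i assume "i \<in> {..<d}"
    then have "a ^ (d - 1) = a ^ (d - 1 - i) * a ^ i" by (simp add: power_add[symmetric])
    then show "of_int (coeff p i * a ^ (d - 1 - i)) * (of_int a * x) ^ i =
        of_int (a ^ (d - 1)) * (of_int (coeff p i) * x ^ i)"
      by (simp add: power_mult_distrib mult_ac)
  qed
  also have "(of_int a * x) ^ d = of_int (a ^ (d - 1)) * (of_int a * x ^ d)"
    using d by (cases d) (simp_all add: power_mult_distrib mult_ac)
  also have "of_int (a ^ (d - 1)) * (of_int a * x ^ d) +
      (\<Sum>i<d. of_int (a ^ (d - 1)) * (of_int (coeff p i) * x ^ i)) =
      of_int (a ^ (d - 1)) * ((\<Sum>i<d. of_int (coeff p i) * x ^ i) + of_int a * x ^ d)"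
    by (simp only: sum_distrib_left[symmetric] distrib_left[symmetric] add.commute)
  also have "\<dots> = 0" using sum0 by simp
  finally have "algebraic_int (of_int a * x)" unfolding algebraic_int_altdef_ipoly using lc by blast
  with a show ?thesis by blast
qed

section \<open>Finitely many algebraic integers of bounded degree and size\<close>

lemma abs_gal_prod:
  assumes g: "g \<in> abs_gal" and "\<And>i. i \<in> I \<Longrightarrow> f i \<in> Qbar"
  shows "prod f I \<in> Qbar" "g (prod f I) = (\<Prod>i\<in>I. g (f i))"
proof -
  have "prod f I \<in> Qbar \<and> g (prod f I) = (\<Prod>i\<in>I. g (f i))" using assms(2)
    by (induction I rule: infinite_finite_induct)
      (auto simp: abs_gal_1[OF g] abs_gal_mult[OF g] subfld_1[OF Qbar_subfld] subfld_mult[OF Qbar_subfld])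
  then show "prod f I \<in> Qbar" "g (prod f I) = (\<Prod>i\<in>I. g (f i))" by auto
qed

lemma abs_gal_image_gal_orbit:
  assumes g: "g \<in> abs_gal" shows "g ` gal_orbit x = gal_orbit x"
proof (intro equalityI subsetI)
  fix y assume "y \<in> g ` gal_orbit x"
  then obtain h where h: "h \<in> abs_gal" "y = (g \<circ> h) x" by (auto simp: gal_orbit_def)
  then show "y \<in> gal_orbit x" using abs_gal_comp[OF g h(1)] unfolding gal_orbit_def by blast
next
  fix y assume "y \<in> gal_orbit x"
  then obtain h where h: "h \<in> abs_gal" "y = h x" by (auto simp: gal_orbit_def)
  let ?i = "inv_into UNIV g"
  have "(?i \<circ> h) x \<in> gal_orbit x" using abs_gal_comp[OF abs_gal_inv[OF g] h(1)] unfolding gal_orbit_def by blast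
  moreover have "y = g ((?i \<circ> h) x)" using h abs_gal_inv_cancel(1)[OF g] by simp
  ultimately show "y \<in> g ` gal_orbit x" by blast
qed

lemma gal_orbit_self: "x \<in> gal_orbit x"
  using imageI[OF abs_gal_id, of "\<lambda>g. g x"] by (simp add: gal_orbit_def)

text \<open>Automorphisms only permute the factors, so the product is rational; it is also an
  algebraic integer. It is the value at j of the polynomial whose roots are the conjugates of
  x.\<close>

lemma prod_gal_orbit_int:
  assumes x: "algebraic_int x"
  shows "(\<Prod>y\<in>gal_orbit x. of_nat j - y) \<in> \<int>"
proof -
  have int: "algebraic_int y" if "y \<in> gal_orbit x" for y
    using that algebraic_int_abs_gal[OF _ x] by (auto simp: gal_orbit_def)
  have int': "algebraic_int (of_nat j - y)" if "y \<in> gal_orbit x" for y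
    using algebraic_int_diff[OF algebraic_int_of_int_complex[of "int j"] int[OF that]] by simp
  have Q: "of_nat j - y \<in> Qbar" "y \<in> Qbar" if "y \<in> gal_orbit x" for y
    using algebraic_int_Qbar int int' that by blast+
  let ?P = "\<Prod>y\<in>gal_orbit x. of_nat j - y"
  have "?P \<in> \<rat>"
  proof (rule abs_gal_fixed_field[OF Rats_subfld])
    show "\<rat> \<subseteq> Qbar" using subfld_Rats[OF Qbar_subfld] by auto
    show "?P \<in> Qbar" using abs_gal_prod(1)[OF abs_gal_id] Q(1) by blast
    fix g assume g: "g \<in> abs_gal"
    have "g ?P = (\<Prod>y\<in>gal_orbit x. g (of_nat j - y))" using abs_gal_prod(2)[OF g] Q(1) by blast
    also have "\<dots> = (\<Prod>y\<in>gal_orbit x. of_nat j - g y)"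
      using Q(2) by (intro prod.cong refl)
        (simp add: abs_gal_diff[OF g] abs_gal_Rats[OF g] subfld_of_nat[OF Qbar_subfld])
    also have "\<dots> = (\<Prod>y\<in>g ` gal_orbit x. of_nat j - y)"
    proof (rule prod.reindex[symmetric, unfolded o_def])
      show "inj_on g (gal_orbit x)" using abs_gal_bij[OF g] by (meson bij_is_inj inj_on_subset subset_UNIV)
    qed
    also have "\<dots> = ?P" by (simp add: abs_gal_image_gal_orbit[OF g])
    finally show "g ?P = ?P" .
  qed
  moreover have "algebraic_int ?P" using int' by (rule algebraic_int_prod)
  ultimately show ?thesis by (rule rational_algebraic_int_is_int[rotated])
qed

text \<open>The polynomial with the conjugates of \<open>x\<close> as roots is determined by its values at \<open>0, \<dots>, N\<close>, which are integers
  of bounded size.\<close>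

theorem finite_bounded_algebraic_ints:
  fixes N :: nat and C :: real
  shows "finite {x. algebraic_int x \<and> card (gal_orbit x) \<le> N \<and> (\<forall>y\<in>gal_orbit x. cmod y \<le> C)}"
proof -
  define T where "T = {x. algebraic_int x \<and> card (gal_orbit x) \<le> N \<and> (\<forall>y\<in>gal_orbit x. cmod y \<le> C)}"
  define P where "P x = (\<Prod>y\<in>gal_orbit x. [:- y, 1:])" for x
  have fin: "finite (gal_orbit x)" if "x \<in> T" for x
    using that finite_gal_orbit algebraic_int_Qbar by (auto simp: T_def)
  have deg: "degree (P x) \<le> N" if "x \<in> T" for x
  proof -
    have "degree (P x) = (\<Sum>y\<in>gal_orbit x. degree [:- y, 1:])"
      unfolding P_def by (rule degree_prod_eq_sum_degree) auto
    also have "\<dots> = card (gal_orbit x)" by simp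
    finally show ?thesis using that by (simp add: T_def)
  qed
  \<comment> \<open>There are at most N factors, each at most N + C in modulus. The summand 1 makes
    the base at least 1, so that the power grows with the number of factors.\<close>
  define M where "M = (1 + real N + \<bar>C\<bar>) ^ N"
  define V where "V = (of_int :: int \<Rightarrow> complex) ` {- \<lceil>M\<rceil>..\<lceil>M\<rceil>}"
  have val: "poly (P x) (of_nat j) \<in> V" if x: "x \<in> T" and j: "j \<le> N" for x j
  proof -
    have ev: "poly (P x) (of_nat j) = (\<Prod>y\<in>gal_orbit x. of_nat j - y)"
      by (simp add: P_def poly_prod)
    have "(\<Prod>y\<in>gal_orbit x. of_nat j - y) \<in> \<int>" using prod_gal_orbit_int x by (simp add: T_def)
    then obtain i where i: "poly (P x) (of_nat j) = of_int i" unfolding ev by (auto elim: Ints_cases)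
    have "cmod (poly (P x) (of_nat j)) = (\<Prod>y\<in>gal_orbit x. cmod (of_nat j - y))"
      unfolding ev by (simp add: prod_norm)
    also have "\<dots> \<le> (\<Prod>y\<in>gal_orbit x. 1 + real N + \<bar>C\<bar>)"
    proof (rule prod_mono)
      fix y assume y: "y \<in> gal_orbit x"
      have "cmod (of_nat j - y) \<le> cmod (of_nat j) + cmod y" by (rule norm_triangle_ineq4)
      also have "\<dots> \<le> real N + C" using j y x by (intro add_mono) (auto simp: T_def)
      finally show "0 \<le> cmod (of_nat j - y) \<and> cmod (of_nat j - y) \<le> 1 + real N + \<bar>C\<bar>" by simp
    qed
    also have "\<dots> = (1 + real N + \<bar>C\<bar>) ^ card (gal_orbit x)" by simp
    also have "\<dots> \<le> M" unfolding M_def using x by (intro power_increasing) (auto simp: T_def)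
    finally have "\<bar>of_int i\<bar> \<le> M" unfolding i by simp
    then have "i \<in> {- \<lceil>M\<rceil>..\<lceil>M\<rceil>}" by (simp add: abs_le_iff) linarith
    then show ?thesis unfolding V_def i by blast
  qed
  define ev where "ev p = restrict (\<lambda>j. poly p (of_nat j)) {..N}" for p :: "complex poly"
  have "inj_on ev (P ` T)"
  proof (rule inj_onI)
    fix p q assume pq: "p \<in> P ` T" "q \<in> P ` T" "ev p = ev q"
    show "p = q"
    proof (rule poly_eqI_degree[of "(of_nat :: nat \<Rightarrow> complex) ` {..N}"])
      show "poly p z = poly q z" if "z \<in> of_nat ` {..N}" for z
        using that pq(3) by (auto simp: ev_def restrict_eq_iff)
      have "card ((of_nat :: nat \<Rightarrow> complex) ` {..N}) = Suc N" by (simp add: card_image inj_on_def)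
      then show "degree p < card ((of_nat :: nat \<Rightarrow> complex) ` {..N})"
        "degree q < card ((of_nat :: nat \<Rightarrow> complex) ` {..N})"
        using deg pq by (auto simp: less_Suc_eq_le)
    qed
  qed
  moreover have "ev ` P ` T \<subseteq> PiE {..N} (\<lambda>_. V)" using val by (auto simp: ev_def restrict_def PiE_def extensional_def)
  moreover have "finite (PiE {..N} (\<lambda>_. V))" by (intro finite_PiE) (auto simp: V_def)
  ultimately have finP: "finite (P ` T)" using finite_imageD finite_subset by blast
  have "T \<subseteq> (\<Union>p\<in>P ` T. {z. poly p z = 0})"
  proof
    fix x assume x: "x \<in> T"
    have "poly (P x) x = 0" using gal_orbit_self fin[OF x] by (auto simp: P_def poly_prod prod_zero_iff)
    with x show "x \<in> (\<Union>p\<in>P ` T. {z. poly p z = 0})" by blast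
  qed
  moreover have "finite {z. poly (P x) z = 0}" if "x \<in> T" for x
    by (rule poly_roots_finite) (use fin[OF that] in \<open>auto simp: P_def\<close>)
  then have "finite (\<Union>p\<in>P ` T. {z. poly p z = 0})" using finP by blast
  ultimately have "finite T" by (rule finite_subset)
  then show ?thesis by (simp add: T_def)
qed

lemma determined_adjoin:
  assumes L: "subfld L" "L \<subseteq> Qbar" "determined_by L A" and x: "x \<in> Qbar"
  shows "determined_by (adjoin L x) (insert x A)"
  unfolding determined_by_def
proof (intro conjI ballI impI)
  show "finite (insert x A)" "insert x A \<subseteq> adjoin L x"
    using L(3) adjoin_mem[OF L(1)] adjoin_base[OF L(1), of x] by (auto simp: determined_by_def)
  fix g h y assume gh: "g \<in> abs_gal" "h \<in> abs_gal" "\<forall>a\<in>insert x A. g a = h a" and y: "y \<in> adjoin L x"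
  have "L \<subseteq> {x \<in> Qbar. g x = h x}" using determined_byD[OF L(3) gh(1,2)] gh(3) L(2) by auto
  moreover have "x \<in> {x \<in> Qbar. g x = h x}" using gh(3) x by simp
  ultimately have "adjoin L x \<subseteq> {x \<in> Qbar. g x = h x}" by (rule adjoin_least[OF equalizer_subfld[OF gh(1,2)]])
  with y show "g y = h y" by blast
qed

theorem finite_exceptional_fields:
  fixes N :: nat and C :: real
  assumes L: "number_field L"
  shows "finite {K. subfld K \<and> (\<exists>x. algebraic_int x \<and> card (gal_orbit x) \<le> N \<and>
    (\<forall>y\<in>gal_orbit x. cmod y \<le> C) \<and> K \<subseteq> adjoin L x)}"
proof -
  note LQ = number_field_subfld[OF L] number_field_Qbar[OF L]
  obtain A where A: "determined_by L A" using number_field_determined[OF L] by blast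
  let ?T = "{x. algebraic_int x \<and> card (gal_orbit x) \<le> N \<and> (\<forall>y\<in>gal_orbit x. cmod y \<le> C)}"
  have "finite (\<Union>x\<in>?T. {K. subfld K \<and> K \<subseteq> adjoin L x})"
  proof (intro finite_UN_I finite_bounded_algebraic_ints)
    fix x assume "x \<in> ?T"
    then have x: "x \<in> Qbar" by (simp add: algebraic_int_Qbar)
    show "finite {K. subfld K \<and> K \<subseteq> adjoin L x}"
      by (rule finite_subfields[OF adjoin_Qbar[OF LQ x] determined_adjoin[OF LQ A x]])
  qed
  then show ?thesis by (rule rev_finite_subset) blast
qed



section \<open>Spans of vectors over subrings\<close>

text \<open>Trades the sum in the vector module for coordinatewise sums of complex numbers, which
  later proofs can manipulate directly.\<close>

lemma span_over_iff:
  assumes S: "S \<subseteq> carrier_vec r"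
  shows "v \<in> span_over R r S \<longleftrightarrow> v \<in> carrier_vec r \<and>
    (\<exists>c T. finite T \<and> T \<subseteq> S \<and> c ` T \<subseteq> R \<and> (\<forall>i<r. v $ i = (\<Sum>s\<in>T. c s * s $ i)))"
proof -
  have closed: "finsum_vec TYPE(complex) r (\<lambda>s. c s \<cdot>\<^sub>v s) T \<in> carrier_vec r"
    and index: "i < r \<Longrightarrow> finsum_vec TYPE(complex) r (\<lambda>s. c s \<cdot>\<^sub>v s) T $ i = (\<Sum>s\<in>T. c s * s $ i)"
    if T: "finite T" "T \<subseteq> S" for c T i
  proof -
    have Tc: "\<And>s. s \<in> T \<Longrightarrow> s \<in> carrier_vec r" using T(2) S by blast
    then show "finsum_vec TYPE(complex) r (\<lambda>s. c s \<cdot>\<^sub>v s) T \<in> carrier_vec r"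
      by (intro finsum_vec_closed) auto
    assume i: "i < r"
    have "finsum_vec TYPE(complex) r (\<lambda>s. c s \<cdot>\<^sub>v s) T $ i = (\<Sum>s\<in>T. (c s \<cdot>\<^sub>v s) $ i)"
      using Tc by (intro index_finsum_vec[OF T(1) i]) auto
    also have "\<dots> = (\<Sum>s\<in>T. c s * s $ i)" using Tc[THEN carrier_vecD] i by (intro sum.cong refl) simp
    finally show "finsum_vec TYPE(complex) r (\<lambda>s. c s \<cdot>\<^sub>v s) T $ i = (\<Sum>s\<in>T. c s * s $ i)" .
  qed
  show ?thesis
  proof
    assume "v \<in> span_over R r S"
    then obtain c T where T: "finite T" "T \<subseteq> S" "c ` T \<subseteq> R" and v: "v = finsum_vec TYPE(complex) r (\<lambda>s. c s \<cdot>\<^sub>v s) T"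
      by (auto simp: span_over_def)
    show "v \<in> carrier_vec r \<and>
      (\<exists>c T. finite T \<and> T \<subseteq> S \<and> c ` T \<subseteq> R \<and> (\<forall>i<r. v $ i = (\<Sum>s\<in>T. c s * s $ i)))"
      unfolding v using T closed[OF T(1,2)] index[OF T(1,2)]
      by (intro conjI exI[of _ c] exI[of _ T]) simp_all
  next
    assume "v \<in> carrier_vec r \<and>
      (\<exists>c T. finite T \<and> T \<subseteq> S \<and> c ` T \<subseteq> R \<and> (\<forall>i<r. v $ i = (\<Sum>s\<in>T. c s * s $ i)))"
    then obtain c T where v: "v \<in> carrier_vec r" "finite T" "T \<subseteq> S" "c ` T \<subseteq> R"
      "\<forall>i<r. v $ i = (\<Sum>s\<in>T. c s * s $ i)" by blast
    have "v = finsum_vec TYPE(complex) r (\<lambda>s. c s \<cdot>\<^sub>v s) T"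
      using v(5) index[OF v(2,3)] carrier_vecD[OF closed[OF v(2,3)]] carrier_vecD[OF v(1)]
      by (intro eq_vecI) simp_all
    with v show "v \<in> span_over R r S" by (auto simp: span_over_def)
  qed
qed

lemma span_over_carrier: "S \<subseteq> carrier_vec r \<Longrightarrow> span_over R r S \<subseteq> carrier_vec r"
  by (rule subsetI) (simp add: span_over_iff)

lemma span_over_zero: "S \<subseteq> carrier_vec r \<Longrightarrow> 0\<^sub>v r \<in> span_over R r S"
  by (auto simp: span_over_iff intro!: exI[of _ "{}"])

text \<open>The closure properties shared by fields and rings of integers, so that one set of span
  lemmas serves for both kinds of coefficients.\<close>

definition additive_ring :: "complex set \<Rightarrow> bool" where
  "additive_ring R \<longleftrightarrow> 0 \<in> R \<and> 1 \<in> R \<and> (\<forall>x\<in>R. \<forall>y\<in>R. x + y \<in> R \<and> x * y \<in> R)"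

lemma span_over_add_smult:
  assumes S: "S \<subseteq> carrier_vec r" and R: "additive_ring R"
    and v: "v \<in> span_over R r S" and s: "s \<in> S" "x \<in> R"
  shows "v + x \<cdot>\<^sub>v s \<in> span_over R r S"
proof -
  obtain c and T :: "complex vec set" where T: "v \<in> carrier_vec r" "finite T" "T \<subseteq> S" "c ` T \<subseteq> R"
    "\<And>i. i < r \<Longrightarrow> v $ i = (\<Sum>s\<in>T. c s * s $ i)" using v span_over_iff[OF S, of v R] by auto
  have sc: "s \<in> carrier_vec r" using s S by blast
  \<comment> \<open>One formula for both cases: a vector s already in T gets x added to its
    coefficient, a new one starts from 0.\<close>
  define c' where "c' t = (if t \<in> T then c t else 0) + (if t = s then x else 0)" for t
  have "(v + x \<cdot>\<^sub>v s) $ i = (\<Sum>t\<in>insert s T. c' t * t $ i)" if i: "i < r" for i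
  proof -
    have "(\<Sum>t\<in>insert s T. c' t * t $ i) =
      (\<Sum>t\<in>insert s T. (if t \<in> T then c t * t $ i else 0)) + (\<Sum>t\<in>insert s T. if t = s then x * t $ i else 0)"
      unfolding sum.distrib[symmetric] by (intro sum.cong refl) (auto simp: c'_def algebra_simps)
    also have "(\<Sum>t\<in>insert s T. (if t \<in> T then c t * t $ i else 0)) = (\<Sum>t\<in>T. c t * t $ i)"
      using T(2) by (intro sum.mono_neutral_cong_right) auto
    also have "(\<Sum>t\<in>insert s T. if t = s then x * t $ i else 0) = x * s $ i"
      using T(2) by simp
    finally show ?thesis using T(1,5) sc i by (simp add: carrier_vecD)
  qed
  moreover have "c' ` insert s T \<subseteq> R" using T(4) s R by (auto simp: c'_def additive_ring_def)
  moreover have "v + x \<cdot>\<^sub>v s \<in> carrier_vec r" using T(1) sc by simp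
  ultimately show ?thesis unfolding span_over_iff[OF S]
    using T(2,3) s(1) by (intro conjI exI[of _ c'] exI[of _ "insert s T"]) auto
qed

lemma span_over_induct [consumes 2, case_names zero step]:
  assumes S: "S \<subseteq> carrier_vec r" and v: "v \<in> span_over R r S"
    and zero: "P (0\<^sub>v r)"
    and step: "\<And>w s x. w \<in> carrier_vec r \<Longrightarrow> P w \<Longrightarrow> s \<in> S \<Longrightarrow> x \<in> R \<Longrightarrow> P (w + x \<cdot>\<^sub>v s)"
  shows "P v"
proof -
  obtain c and T :: "complex vec set" where T: "v \<in> carrier_vec r" "finite T" "T \<subseteq> S" "c ` T \<subseteq> R"
    "\<And>i. i < r \<Longrightarrow> v $ i = (\<Sum>s\<in>T. c s * s $ i)" using v span_over_iff[OF S, of v R] by auto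
  have "P (vec r (\<lambda>i. \<Sum>s\<in>T. c s * s $ i))" using T(2,3,4)
  proof (induction T rule: finite_induct)
    case empty
    show ?case using zero by (simp add: zero_vec_def)
  next
    case (insert s T)
    have "s \<in> carrier_vec r" using insert S by blast
    then have "vec r (\<lambda>i. \<Sum>s\<in>insert s T. c s * s $ i) = vec r (\<lambda>i. \<Sum>s\<in>T. c s * s $ i) + c s \<cdot>\<^sub>v s"
      using insert by (intro eq_vecI) auto
    then show ?case using step[of "vec r (\<lambda>i. \<Sum>s\<in>T. c s * s $ i)" s "c s"] insert by auto
  qed
  moreover have "vec r (\<lambda>i. \<Sum>s\<in>T. c s * s $ i) = v" using T by (intro eq_vecI) auto
  ultimately show ?thesis by simp
qed

context
  fixes S :: "complex vec set" and r R assumes S: "S \<subseteq> carrier_vec r" and R: "additive_ring R"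
begin

lemma span_over_smult:
  assumes v: "v \<in> span_over R r S" and y: "y \<in> R"
  shows "y \<cdot>\<^sub>v v \<in> span_over R r S"
  using S v
proof (induction rule: span_over_induct)
  case zero
  have "y \<cdot>\<^sub>v 0\<^sub>v r = 0\<^sub>v r" by (rule eq_vecI) auto
  then show ?case using span_over_zero[OF S] by simp
next
  case (step w s x)
  have "s \<in> carrier_vec r" using step S by blast
  then have "y \<cdot>\<^sub>v (w + x \<cdot>\<^sub>v s) = y \<cdot>\<^sub>v w + (y * x) \<cdot>\<^sub>v s"
    using step(1) by (intro eq_vecI) (auto simp: algebra_simps)
  moreover have "y * x \<in> R" using R y step by (auto simp: additive_ring_def)
  ultimately show ?case using span_over_add_smult[OF S R step.IH step.hyps(2)] by simp
qed

lemma span_over_add: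
  assumes v: "v \<in> span_over R r S" and w: "w \<in> span_over R r S"
  shows "v + w \<in> span_over R r S"
  using S w
proof (induction rule: span_over_induct)
  case zero
  have "v \<in> carrier_vec r" using v span_over_carrier[OF S] by blast
  then show ?case using v by simp
next
  case (step w s x)
  have "s \<in> carrier_vec r" "v \<in> carrier_vec r" using step S v span_over_carrier[OF S] by blast+
  then have "v + (w + x \<cdot>\<^sub>v s) = (v + w) + x \<cdot>\<^sub>v s"
    using step(1) by (intro eq_vecI) (auto simp: algebra_simps)
  then show ?case using span_over_add_smult[OF S R step.IH step.hyps(2,3)] by simp
qed

lemma span_over_base:
  assumes "s \<in> S" shows "s \<in> span_over R r S"
proof -
  have "s \<in> carrier_vec r" using assms S by blast
  then have "0\<^sub>v r + 1 \<cdot>\<^sub>v s = s" by (intro eq_vecI) auto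
  then show ?thesis using span_over_add_smult[OF S R span_over_zero[OF S] assms, of 1] R
    by (simp add: additive_ring_def)
qed

end

lemma coord_space_iff: "v \<in> coord_space F r \<longleftrightarrow> v \<in> carrier_vec r \<and> (\<forall>i<r. v $ i \<in> F)"
  by (auto simp: coord_space_def vec_set_def)

lemma coord_space_carrier: "coord_space F r \<subseteq> carrier_vec r"
  by (auto simp: coord_space_iff)

context
  fixes F assumes F: "subfld F"
begin

lemma coord_space_add: "v \<in> coord_space F r \<Longrightarrow> w \<in> coord_space F r \<Longrightarrow> v + w \<in> coord_space F r"
  by (auto simp: coord_space_iff subfld_add[OF F])

lemma coord_space_smult: "x \<in> F \<Longrightarrow> w \<in> coord_space F r \<Longrightarrow> x \<cdot>\<^sub>v w \<in> coord_space F r"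
  by (auto simp: coord_space_iff subfld_mult[OF F])

lemma coord_space_zero: "0\<^sub>v r \<in> coord_space F r"
  by (auto simp: coord_space_iff subfld_0[OF F])

lemma span_over_coord_space:
  assumes S: "S \<subseteq> coord_space F r" and "R \<subseteq> F"
  shows "span_over R r S \<subseteq> coord_space F r"
proof
  fix v assume v: "v \<in> span_over R r S"
  have S': "S \<subseteq> carrier_vec r" using S coord_space_carrier[of F r] by blast
  show "v \<in> coord_space F r" using S' v
    by (induction rule: span_over_induct) (use assms in \<open>auto intro!: coord_space_add coord_space_smult coord_space_zero\<close>)
qed

lemma additive_ring_subfld: "additive_ring F"
  by (simp add: additive_ring_def subfld_0[OF F] subfld_1[OF F] subfld_add[OF F] subfld_mult[OF F])

lemma additive_ring_integers: "additive_ring (ring_of_integers F)"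
  by (auto simp: additive_ring_def ring_of_integers_def subfld_0[OF F] subfld_1[OF F] subfld_add[OF F]
    subfld_mult[OF F] algebraic_int_add algebraic_int_mult)

end

section \<open>Quadratic forms\<close>

definition qform :: "nat \<Rightarrow> (nat \<Rightarrow> nat \<Rightarrow> complex) \<Rightarrow> complex vec \<Rightarrow> complex" where
  "qform r c v = (\<Sum>j<r. \<Sum>i\<le>j. c i j * v $ i * v $ j)"

text \<open>The bilinear form Q(v + w) - Q(v) - Q(w), deliberately not halved: the form need not be
  classical, and the diagonal values are 2 Q(v).\<close>

definition polar :: "nat \<Rightarrow> (nat \<Rightarrow> nat \<Rightarrow> complex) \<Rightarrow> complex vec \<Rightarrow> complex vec \<Rightarrow> complex" where
  "polar r c v w = (\<Sum>j<r. \<Sum>i\<le>j. c i j * (v $ i * w $ j + w $ i * v $ j))"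

lemma polar_commute: "polar r c v w = polar r c w v"
  by (simp add: polar_def add.commute)

lemma polar_self: "polar r c v v = 2 * qform r c v"
  by (simp add: polar_def qform_def sum_distrib_left algebra_simps)

lemma
  assumes "v \<in> carrier_vec r" "w \<in> carrier_vec r"
  shows qform_add: "qform r c (v + w) = qform r c v + qform r c w + polar r c v w"
    and polar_add: "polar r c (v + w) u = polar r c v u + polar r c w u"
    and polar_smult: "polar r c (x \<cdot>\<^sub>v v) u = x * polar r c v u"
    and qform_smult: "qform r c (x \<cdot>\<^sub>v v) = x\<^sup>2 * qform r c v"
  using assms unfolding qform_def polar_def sum.distrib[symmetric] sum_distrib_left
  by (auto intro!: sum.cong simp: algebra_simps power2_eq_square)

lemma polar_smult_right: "v \<in> carrier_vec r \<Longrightarrow> polar r c u (x \<cdot>\<^sub>v v) = x * polar r c u v"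
  using polar_smult[of v r v c x u] by (simp add: polar_commute)

lemma polar_zero: "polar r c (0\<^sub>v r) u = 0"
  by (auto simp: polar_def intro!: sum.neutral)

lemma qform_zero: "qform r c (0\<^sub>v r) = 0"
  by (auto simp: qform_def intro!: sum.neutral)

section \<open>Linear combinations and orthogonal families\<close>

definition lincomb_vec :: "nat \<Rightarrow> nat \<Rightarrow> (nat \<Rightarrow> complex) \<Rightarrow> (nat \<Rightarrow> complex vec) \<Rightarrow> complex vec" where
  "lincomb_vec r s d e = vec r (\<lambda>i. \<Sum>j<s. d j * e j $ i)"

lemma lincomb_vec_carrier [simp]: "lincomb_vec r s d e \<in> carrier_vec r"
  by (simp add: lincomb_vec_def)

lemma lincomb_vec_0: "lincomb_vec r 0 d e = 0\<^sub>v r"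
  by (auto simp: lincomb_vec_def)

lemma lincomb_vec_Suc:
  "e s \<in> carrier_vec r \<Longrightarrow> lincomb_vec r (Suc s) d e = lincomb_vec r s d e + d s \<cdot>\<^sub>v e s"
  by (intro eq_vecI) (auto simp: lincomb_vec_def)

lemma lincomb_vec_cong:
  "(\<And>j. j < s \<Longrightarrow> d j = d' j) \<Longrightarrow> (\<And>j. j < s \<Longrightarrow> e j = e' j) \<Longrightarrow> lincomb_vec r s d e = lincomb_vec r s d' e'"
  by (auto simp: lincomb_vec_def intro!: eq_vecI sum.cong)

lemma polar_lincomb:
  "(\<And>j. j < s \<Longrightarrow> e j \<in> carrier_vec r) \<Longrightarrow> polar r c (lincomb_vec r s d e) u = (\<Sum>j<s. d j * polar r c (e j) u)"
  by (induction s) (simp_all add: lincomb_vec_0 polar_zero lincomb_vec_Suc polar_add polar_smult[where w = "0\<^sub>v r"])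

lemma polar_lincomb_orthogonal:
  assumes e: "\<And>j. j < s \<Longrightarrow> e j \<in> carrier_vec r"
    and orth: "\<And>i j. i < s \<Longrightarrow> j < s \<Longrightarrow> i \<noteq> j \<Longrightarrow> polar r c (e i) (e j) = 0" and k: "k < s"
  shows "polar r c (lincomb_vec r s d e) (e k) = d k * polar r c (e k) (e k)"
proof -
  have "polar r c (lincomb_vec r s d e) (e k) = (\<Sum>j<s. d j * polar r c (e j) (e k))"
    by (rule polar_lincomb[OF e])
  also have "\<dots> = (\<Sum>j<s. if j = k then d k * polar r c (e k) (e k) else 0)"
    using orth k by (intro sum.cong refl) auto
  finally show ?thesis using k by simp
qed

lemma qform_lincomb_orthogonal:
  assumes "\<And>j. j < s \<Longrightarrow> e j \<in> carrier_vec r"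
    and "\<And>i j. i < s \<Longrightarrow> j < s \<Longrightarrow> i \<noteq> j \<Longrightarrow> polar r c (e i) (e j) = 0"
  shows "qform r c (lincomb_vec r s d e) = (\<Sum>j<s. qform r c (e j) * (d j)\<^sup>2)"
  using assms
proof (induction s)
  case 0
  show ?case by (simp add: lincomb_vec_0 qform_zero)
next
  case (Suc s)
  have "polar r c (lincomb_vec r s d e) (e s) = (\<Sum>j<s. d j * polar r c (e j) (e s))"
    using Suc.prems by (intro polar_lincomb) simp
  also have "\<dots> = 0" using Suc.prems by (intro sum.neutral) auto
  finally have "polar r c (lincomb_vec r s d e) (d s \<cdot>\<^sub>v e s) = 0"
    using Suc.prems by (simp add: polar_smult_right)
  moreover have "e s \<in> carrier_vec r" using Suc.prems by simp
  ultimately show ?case using Suc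
    by (simp add: lincomb_vec_Suc qform_add qform_smult[where w = "0\<^sub>v r"])
qed

text \<open>More than r vectors in r coordinates satisfy a complex linear relation; pairing it with
  each \<open>e k\<close> annihilates its coefficients one by one. The relation may have arbitrary
  complex coefficients, so the bound is by r for whatever subfield the vectors came from.\<close>

lemma orthogonal_le_dim:
  assumes e: "\<And>j. j < s \<Longrightarrow> e j \<in> carrier_vec r"
    and orth: "\<And>i j. i < s \<Longrightarrow> j < s \<Longrightarrow> i \<noteq> j \<Longrightarrow> polar r c (e i) (e j) = 0"
    and nz: "\<And>j. j < s \<Longrightarrow> polar r c (e j) (e j) \<noteq> 0"
  shows "s \<le> r"
proof (rule ccontr)
  assume "\<not> s \<le> r"
  then have rs: "r < s" by simp
  \<comment> \<open>The coordinate matrix padded with zero rows to a square one. Row r is zero, so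
    the transpose kills the unit vector r, and the vanishing determinant yields the relation
    d.\<close>
  define M where "M = mat s s (\<lambda>(i, j). if i < r then e j $ i else 0)"
  have M: "M \<in> carrier_mat s s" by (simp add: M_def)
  have "transpose_mat M *\<^sub>v unit_vec s r = 0\<^sub>v s"
    using rs by (intro eq_vecI) (auto simp: M_def scalar_prod_def intro!: sum.neutral)
  moreover have "unit_vec s r \<noteq> (0\<^sub>v s :: complex vec)" using rs by simp
  ultimately have "det (transpose_mat M) = 0"
    using det_0_iff_vec_prod_zero_field[of "transpose_mat M" s] M by (metis transpose_carrier_mat unit_vec_carrier)
  then have "det M = 0" using det_transpose[OF M] by simp
  then obtain d where d: "d \<in> carrier_vec s" "d \<noteq> 0\<^sub>v s" "M *\<^sub>v d = 0\<^sub>v s"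
    using det_0_iff_vec_prod_zero_field[OF M] by blast
  have zero: "lincomb_vec r s (\<lambda>j. d $ j) e = 0\<^sub>v r"
  proof (rule eq_vecI)
    fix i assume "i < dim_vec (0\<^sub>v r :: complex vec)"
    then have i: "i < r" by simp
    have "(\<Sum>j<s. d $ j * e j $ i) = (M *\<^sub>v d) $ i"
      using i rs d(1) by (simp add: M_def scalar_prod_def carrier_vecD atLeast0LessThan mult.commute)
    also have "\<dots> = 0" using d(3) i rs by simp
    finally show "lincomb_vec r s (\<lambda>j. d $ j) e $ i = 0\<^sub>v r $ i" using i by (simp add: lincomb_vec_def)
  qed (simp add: lincomb_vec_def)
  have "d = 0\<^sub>v s"
  proof (rule eq_vecI)
    fix k assume "k < dim_vec (0\<^sub>v s :: complex vec)"
    then have k: "k < s" by simp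
    have "polar r c (lincomb_vec r s (\<lambda>j. d $ j) e) (e k) = d $ k * polar r c (e k) (e k)"
      by (rule polar_lincomb_orthogonal) (use e orth k in auto)
    then have "d $ k * polar r c (e k) (e k) = 0" using zero by (simp add: polar_zero)
    then show "d $ k = 0\<^sub>v s $ k" using nz[OF k] k by simp
  qed (use d in simp)
  with d(2) show False ..
qed


section \<open>Descent of lattices\<close>

text \<open>Every embedding of L comes from an automorphism and so extends to F, where positivity is
  known.\<close>

lemma positive_integers_subfield:
  assumes F: "subfld F" "F \<subseteq> Qbar" and L: "subfld L" "L \<subseteq> F" and x: "x \<in> positive_integers F" "x \<in> L"
  shows "x \<in> positive_integers L"
proof -
  have LQ: "L \<subseteq> Qbar" using L F by blast
  have "\<tau> x \<in> \<real> \<and> Re (\<tau> x) > 0" if \<tau>: "\<tau> \<in> embeddings L" for \<tau>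
  proof -
    obtain g where g: "g \<in> abs_gal" "\<tau> = restrict g L" using \<tau> by (auto simp: embeddings_eq_restrict[OF L(1) LQ])
    have "restrict g F \<in> embeddings F" using g(1) by (auto simp: embeddings_eq_restrict[OF F])
    then have "restrict g F x \<in> \<real> \<and> Re (restrict g F x) > 0"
      using x(1) by (auto simp: positive_integers_def totally_positive_def)
    moreover have "x \<in> F" using x(2) L(2) by blast
    ultimately show ?thesis using g(2) x(2) by simp
  qed
  then show ?thesis using x by (auto simp: positive_integers_def totally_positive_def ring_of_integers_def)
qed

text \<open>The projection coefficients are quotients of polar values and hence stay in L;
  anisotropy keeps the denominators nonzero. A vector with zero remainder w adds no member to the
  family, so no independence of V is required beforehand.\<close>

lemma gram_schmidt:
  assumes L: "subfld L" and W: "W \<subseteq> carrier_vec r"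
    and add: "\<And>v w. v \<in> W \<Longrightarrow> w \<in> W \<Longrightarrow> v + w \<in> W"
    and smult: "\<And>x w. x \<in> L \<Longrightarrow> w \<in> W \<Longrightarrow> x \<cdot>\<^sub>v w \<in> W"
    and zero: "0\<^sub>v r \<in> W"
    and pol: "\<And>v w. v \<in> W \<Longrightarrow> w \<in> W \<Longrightarrow> polar r c v w \<in> L"
    and aniso: "\<And>w. w \<in> W \<Longrightarrow> w \<noteq> 0\<^sub>v r \<Longrightarrow> qform r c w \<noteq> 0"
    and V: "finite V" "V \<subseteq> W"
  shows "\<exists>s e. (\<forall>j<s. e j \<in> W \<and> qform r c (e j) \<noteq> 0) \<and>
    (\<forall>i<s. \<forall>j<s. i \<noteq> j \<longrightarrow> polar r c (e i) (e j) = 0) \<and>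
    (\<forall>v\<in>V. \<exists>d. (\<forall>j<s. d j \<in> L) \<and> v = lincomb_vec r s d e)"
  using V
proof (induction V rule: finite_induct)
  case empty
  show ?case by (rule exI[of _ 0]) auto
next
  case (insert v V)
  then obtain s e where e: "\<And>j. j < s \<Longrightarrow> e j \<in> W" "\<And>j. j < s \<Longrightarrow> qform r c (e j) \<noteq> 0"
    and orth: "\<And>i j. i < s \<Longrightarrow> j < s \<Longrightarrow> i \<noteq> j \<Longrightarrow> polar r c (e i) (e j) = 0"
    and rep: "\<And>v. v \<in> V \<Longrightarrow> \<exists>d. (\<forall>j<s. d j \<in> L) \<and> v = lincomb_vec r s d e"
    by (simp add: subset_iff) metis
  have v: "v \<in> W" "v \<in> carrier_vec r" using insert W by auto
  have ec: "e j \<in> carrier_vec r" if "j < s" for j using e(1)[OF that] W by blast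
  have self: "polar r c (e j) (e j) \<noteq> 0" if "j < s" for j using e(2)[OF that] by (simp add: polar_self)
  define d where "d j = polar r c v (e j) / polar r c (e j) (e j)" for j
  have dL: "d j \<in> L" if "j < s" for j
    unfolding d_def using e(1)[OF that] v(1) by (intro subfld_divide[OF L] pol)
  define u where "u = lincomb_vec r s d e"
  have lin: "lincomb_vec r t d e \<in> W" if "t \<le> s" for t
    using that by (induction t) (auto simp: lincomb_vec_0 lincomb_vec_Suc zero ec intro!: add smult dL e)
  have uW: "u \<in> W" "u \<in> carrier_vec r" using lin[of s] by (auto simp: u_def)
  define w where "w = v + (- 1) \<cdot>\<^sub>v u"
  have "- 1 \<in> L" using subfld_minus[OF L subfld_1[OF L]] .
  then have wW: "w \<in> W" "w \<in> carrier_vec r" using v uW by (auto simp: w_def intro!: add smult)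
  have w_orth: "polar r c w (e k) = 0" if k: "k < s" for k
  proof -
    have "polar r c u (e k) = d k * polar r c (e k) (e k)"
      unfolding u_def by (rule polar_lincomb_orthogonal) (use ec orth k in auto)
    also have "\<dots> = polar r c v (e k)" using self[OF k] by (simp add: d_def)
    finally show ?thesis
      using v uW unfolding w_def by (simp add: polar_add polar_smult[where w = u])
  qed
  have v_eq: "v = u + w" using v uW by (intro eq_vecI) (auto simp: w_def)
  show ?case
  proof (cases "w = 0\<^sub>v r")
    case True
    then have "v = lincomb_vec r s d e" using v_eq uW by (simp add: u_def)
    then have "\<forall>x\<in>insert v V. \<exists>d. (\<forall>j<s. d j \<in> L) \<and> x = lincomb_vec r s d e" using rep dL by blast
    then show ?thesis using e orth by (intro exI[of _ s] exI[of _ e]) auto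
  next
    case False
    define e' where "e' = e(s := w)"
    have e'W: "e' j \<in> W" "qform r c (e' j) \<noteq> 0" if "j < Suc s" for j
      using that e wW(1) aniso[OF wW(1) False] by (auto simp: e'_def less_Suc_eq)
    have orth': "polar r c (e' i) (e' j) = 0" if "i < Suc s" "j < Suc s" "i \<noteq> j" for i j
      using that orth w_orth polar_commute[of r c w] by (auto simp: e'_def less_Suc_eq)
    have ext: "lincomb_vec r (Suc s) (d'(s := y)) e' = lincomb_vec r s d' e + y \<cdot>\<^sub>v w" for d' y
    proof -
      have "lincomb_vec r s (d'(s := y)) e' = lincomb_vec r s d' e"
        by (rule lincomb_vec_cong) (auto simp: e'_def)
      then show ?thesis using wW(2) by (subst lincomb_vec_Suc) (auto simp: e'_def)
    qed
    have "\<exists>d. (\<forall>j<Suc s. d j \<in> L) \<and> x = lincomb_vec r (Suc s) d e'" if x: "x \<in> insert v V" for x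
    proof (cases "x = v")
      case True
      have "1 \<cdot>\<^sub>v w = w" by (intro eq_vecI) auto
      then have "x = lincomb_vec r (Suc s) (d(s := 1)) e'" unfolding ext using True v_eq by (simp add: u_def)
      moreover have "\<forall>j<Suc s. (d(s := 1)) j \<in> L" using dL subfld_1[OF L] by (auto simp: less_Suc_eq)
      ultimately show ?thesis by blast
    next
      case False
      then obtain d' where d': "\<forall>j<s. d' j \<in> L" "x = lincomb_vec r s d' e" using rep[of x] x by auto
      have "lincomb_vec r s d' e + 0 \<cdot>\<^sub>v w = lincomb_vec r s d' e"
        using wW(2) by (intro eq_vecI) (auto simp: carrier_vecD[OF lincomb_vec_carrier])
      then have "x = lincomb_vec r (Suc s) (d'(s := 0)) e'" unfolding ext using d' by simp
      moreover have "\<forall>j<Suc s. (d'(s := 0)) j \<in> L" using d' subfld_0[OF L] by (auto simp: less_Suc_eq)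
      ultimately show ?thesis by blast
    qed
    then show ?thesis using e'W orth' by (intro exI[of _ "Suc s"] exI[of _ e']) auto
  qed
qed

lemma tp_quadratic_latticeE:
  assumes F: "subfld F" and lat: "tp_quadratic_lattice F r \<Lambda> Q"
  obtains c where "\<Lambda> \<subseteq> coord_space F r" "0\<^sub>v r \<in> \<Lambda>"
    "\<And>v w. v \<in> \<Lambda> \<Longrightarrow> w \<in> \<Lambda> \<Longrightarrow> v + w \<in> \<Lambda>"
    "\<And>v x. v \<in> \<Lambda> \<Longrightarrow> x \<in> ring_of_integers F \<Longrightarrow> x \<cdot>\<^sub>v v \<in> \<Lambda>"
    "\<And>v. v \<in> coord_space F r \<Longrightarrow> Q v = qform r c v"
    "\<And>v. v \<in> \<Lambda> \<Longrightarrow> v \<noteq> 0\<^sub>v r \<Longrightarrow> Q v \<in> positive_integers F"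
proof -
  obtain S where S: "finite S" "S \<subseteq> coord_space F r" "\<Lambda> = span_over (ring_of_integers F) r S"
    using lat by (auto simp: tp_quadratic_lattice_def)
  obtain c where c: "\<And>v. v \<in> coord_space F r \<Longrightarrow> Q v = qform r c v"
    using lat by (auto simp: tp_quadratic_lattice_def quadratic_form_on_def qform_def)
  have pos: "Q v \<in> positive_integers F" if "v \<in> \<Lambda>" "v \<noteq> 0\<^sub>v r" for v
    using lat that by (auto simp: tp_quadratic_lattice_def)
  have Sc: "S \<subseteq> carrier_vec r" using S coord_space_carrier[of F r] by blast
  have O: "ring_of_integers F \<subseteq> F" by (auto simp: ring_of_integers_def)
  have \<Lambda>F: "\<Lambda> \<subseteq> coord_space F r" unfolding S(3) by (rule span_over_coord_space[OF F S(2) O])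
  show ?thesis
    by (rule that[OF \<Lambda>F _ _ _ c pos])
      (auto simp: S(3) span_over_zero[OF Sc] span_over_add[OF Sc additive_ring_integers[OF F]]
        span_over_smult[OF Sc additive_ring_integers[OF F]])
qed

lemma lattice_conjugate_bound:
  assumes F: "subfld F" "F \<subseteq> Qbar" and lat: "tp_quadratic_lattice F r \<Lambda> Q"
    and g: "g \<in> abs_gal" and v: "v \<in> \<Lambda>" and w: "w \<in> \<Lambda>"
  shows "cmod (g (Q (v + w))) \<le> 2 * cmod (g (Q v)) + 2 * cmod (g (Q w))"
proof -
  obtain c where \<Lambda>F: "\<Lambda> \<subseteq> coord_space F r" and \<Lambda>zero: "0\<^sub>v r \<in> \<Lambda>"
    and \<Lambda>add: "\<And>v w. v \<in> \<Lambda> \<Longrightarrow> w \<in> \<Lambda> \<Longrightarrow> v + w \<in> \<Lambda>"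
    and \<Lambda>smult: "\<And>v x. v \<in> \<Lambda> \<Longrightarrow> x \<in> ring_of_integers F \<Longrightarrow> x \<cdot>\<^sub>v v \<in> \<Lambda>"
    and c: "\<And>v. v \<in> coord_space F r \<Longrightarrow> Q v = qform r c v"
    and pos: "\<And>v. v \<in> \<Lambda> \<Longrightarrow> v \<noteq> 0\<^sub>v r \<Longrightarrow> Q v \<in> positive_integers F"
    by (fact tp_quadratic_latticeE[OF F(1) lat])
  \<comment> \<open>The zero vector needs its own case, because total positivity speaks of nonzero
    vectors; there the value is 0.\<close>
  have val: "Q x \<in> Qbar" "g (Q x) \<in> \<real>" "Re (g (Q x)) \<ge> 0" if x: "x \<in> \<Lambda>" for x
  proof -
    consider "x = 0\<^sub>v r" | "x \<noteq> 0\<^sub>v r" by blast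
    then have "Q x \<in> Qbar \<and> g (Q x) \<in> \<real> \<and> Re (g (Q x)) \<ge> 0"
    proof cases
      case 1
      then have "Q x = 0" using c[of x] \<Lambda>F x by (auto simp: qform_zero)
      then show ?thesis by (simp add: abs_gal_0[OF g] subfld_0[OF Qbar_subfld])
    next
      case 2
      have Qx: "Q x \<in> positive_integers F" by (rule pos[OF x 2])
      then have QF: "Q x \<in> F" by (auto simp: positive_integers_def ring_of_integers_def)
      have "restrict g F \<in> embeddings F" using g by (auto simp: embeddings_eq_restrict[OF F])
      then have "restrict g F (Q x) \<in> \<real> \<and> Re (restrict g F (Q x)) > 0"
        using Qx by (auto simp: positive_integers_def totally_positive_def)
      then show ?thesis using QF F(2) by auto
    qed
    then show "Q x \<in> Qbar" "g (Q x) \<in> \<real>" "Re (g (Q x)) \<ge> 0" by auto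
  qed
  have cm: "cmod (g (Q x)) = Re (g (Q x))" if "x \<in> \<Lambda>" for x
    using val(2,3)[OF that] by (auto elim!: Reals_cases)
  let ?u = "v + (- 1) \<cdot>\<^sub>v w"
  have "- 1 \<in> ring_of_integers F"
    using subfld_of_int[OF F(1), of "- 1"] by (simp add: ring_of_integers_def)
  then have u: "?u \<in> \<Lambda>" by (intro \<Lambda>add \<Lambda>smult v w)
  have vw: "v + w \<in> \<Lambda>" by (intro \<Lambda>add v w)
  have vc: "v \<in> carrier_vec r" "w \<in> carrier_vec r" using v w \<Lambda>F coord_space_carrier[of F r] by auto
  have "Q (v + w) + Q ?u = 2 * Q v + 2 * Q w"
    using c \<Lambda>F v w u vw vc
    by (simp add: subset_iff qform_add qform_smult[where w = w] polar_smult_right)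
  then have eq: "Q (v + w) + Q ?u = (Q v + Q v) + (Q w + Q w)" by simp
  have "g (Q (v + w) + Q ?u) = g (Q (v + w)) + g (Q ?u)" by (rule abs_gal_add[OF g val(1)[OF vw] val(1)[OF u]])
  moreover have "g ((Q v + Q v) + (Q w + Q w)) = (g (Q v) + g (Q v)) + (g (Q w) + g (Q w))"
    by (simp only: abs_gal_add[OF g] subfld_add[OF Qbar_subfld] val(1)[OF v] val(1)[OF w])
  ultimately have "g (Q (v + w)) + g (Q ?u) = (g (Q v) + g (Q v)) + (g (Q w) + g (Q w))" unfolding eq by simp
  then have "Re (g (Q (v + w))) + Re (g (Q ?u)) = 2 * Re (g (Q v)) + 2 * Re (g (Q w))"
    by (metis (no_types, lifting) mult_2 plus_complex.sel(1))
  then show ?thesis using cm[OF v] cm[OF w] cm[OF vw] val(3)[OF u] by simp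
qed

text \<open>An orthogonal basis of the L-span W of V identifies W with a coordinate space over L of
  dimension s, at most r. The new form is Q read in these coordinates, and the new lattice is
  generated by the coordinates of V.\<close>

theorem lattice_descent:
  assumes F: "subfld F" "F \<subseteq> Qbar" and L: "subfld L" "L \<subseteq> F"
    and lat: "tp_quadratic_lattice F r \<Lambda> Q"
    and V: "finite V" "V \<subseteq> \<Lambda>" "\<And>v. v \<in> V \<Longrightarrow> Q v \<in> L"
      "\<And>v w. v \<in> V \<Longrightarrow> w \<in> V \<Longrightarrow> Q (v + w) \<in> L"
  shows "\<exists>s \<Lambda>' Q'. s \<le> r \<and> tp_quadratic_lattice L s \<Lambda>' Q' \<and> (\<forall>v\<in>V. represents \<Lambda>' Q' (Q v))"
proof -
  obtain c where \<Lambda>F: "\<Lambda> \<subseteq> coord_space F r" and \<Lambda>zero: "0\<^sub>v r \<in> \<Lambda>"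
    and \<Lambda>add: "\<And>v w. v \<in> \<Lambda> \<Longrightarrow> w \<in> \<Lambda> \<Longrightarrow> v + w \<in> \<Lambda>"
    and \<Lambda>smult: "\<And>v x. v \<in> \<Lambda> \<Longrightarrow> x \<in> ring_of_integers F \<Longrightarrow> x \<cdot>\<^sub>v v \<in> \<Lambda>"
    and c: "\<And>v. v \<in> coord_space F r \<Longrightarrow> Q v = qform r c v"
    and pos: "\<And>v. v \<in> \<Lambda> \<Longrightarrow> v \<noteq> 0\<^sub>v r \<Longrightarrow> Q v \<in> positive_integers F"
    by (fact tp_quadratic_latticeE[OF F(1) lat])
  have VF: "V \<subseteq> coord_space F r" using V(2) \<Lambda>F by blast
  then have Vc: "V \<subseteq> carrier_vec r" using coord_space_carrier[of F r] by blast
  define W where "W = span_over L r V"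
  have WF: "W \<subseteq> coord_space F r" unfolding W_def by (rule span_over_coord_space[OF F(1) VF L(2)])
  then have Wc: "W \<subseteq> carrier_vec r" using coord_space_carrier[of F r] by blast
  note Wadd = span_over_add[OF Vc additive_ring_subfld[OF L(1)], folded W_def]
  note Wsmult = span_over_smult[OF Vc additive_ring_subfld[OF L(1)], folded W_def]
  note Wzero = span_over_zero[OF Vc, of L, folded W_def]
  have VW: "V \<subseteq> W" using span_over_base[OF Vc additive_ring_subfld[OF L(1)]] by (auto simp: W_def)
  \<comment> \<open>Polarisation is the reason for asking that the values on sums of two vectors of
    V lie in L; bilinearity then spreads this to W.\<close>
  have polV: "polar r c v w \<in> L" if "v \<in> V" "w \<in> V" for v w
  proof -
    have vw: "v \<in> coord_space F r" "w \<in> coord_space F r" using that VF by auto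
    then have "Q (v + w) = Q v + Q w + polar r c v w"
      using c[OF coord_space_add[OF F(1) vw]] c[OF vw(1)] c[OF vw(2)] qform_add[of v r w c]
      by (auto simp: coord_space_iff)
    then have "polar r c v w = Q (v + w) - Q v - Q w" by simp
    then show ?thesis using V(3,4) that by (simp add: subfld_diff[OF L(1)])
  qed
  have polWV: "polar r c w v \<in> L" if w: "w \<in> W" and v: "v \<in> V" for w v
    using Vc w[unfolded W_def]
  proof (induction rule: span_over_induct)
    case zero
    show ?case by (simp add: polar_zero subfld_0[OF L(1)])
  next
    case (step w s x)
    have "s \<in> carrier_vec r" using step.hyps Vc by blast
    then show ?case using step polV[OF _ v, of s]
      by (simp add: polar_add polar_smult[where w = s] subfld_add[OF L(1)] subfld_mult[OF L(1)])
  qed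
  have polW: "polar r c u w \<in> L" if u: "u \<in> W" and w: "w \<in> W" for w u
    using Vc u[unfolded W_def]
  proof (induction rule: span_over_induct)
    case zero
    show ?case by (simp add: polar_zero subfld_0[OF L(1)])
  next
    case (step u s x)
    have "s \<in> carrier_vec r" using step.hyps Vc by blast
    moreover have "polar r c s w \<in> L" using polWV[OF w, of s] step.hyps polar_commute[of r c w s] by simp
    ultimately show ?case using step
      by (simp add: polar_add polar_smult[where w = s] subfld_add[OF L(1)] subfld_mult[OF L(1)])
  qed
  have intF: "of_int N \<in> ring_of_integers F" for N
    by (simp add: ring_of_integers_def subfld_of_int[OF F(1)] algebraic_int_of_int_complex)
  \<comment> \<open>Vectors of W need not lie in the lattice, but an integer multiple does: each
    coefficient from L becomes an algebraic integer after multiplication by a nonzero integer.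
    Positivity on the lattice thus gives anisotropy on W.\<close>
  have clear: "\<exists>N :: int. N \<noteq> 0 \<and> of_int N \<cdot>\<^sub>v w \<in> \<Lambda>" if w: "w \<in> W" for w
    using Vc w[unfolded W_def]
  proof (induction rule: span_over_induct)
    case zero
    have "1 \<cdot>\<^sub>v 0\<^sub>v r = (0\<^sub>v r :: complex vec)" by (intro eq_vecI) auto
    then show ?case using \<Lambda>zero by (intro exI[of _ 1]) simp
  next
    case (step w s x)
    then obtain N :: int where N: "N \<noteq> 0" "of_int N \<cdot>\<^sub>v w \<in> \<Lambda>" by blast
    have xF: "x \<in> F" using step.hyps L(2) by blast
    then have "algebraic x" using F(2) by (auto simp: Qbar_def)
    then obtain M :: int where M: "M \<noteq> 0" "algebraic_int (of_int M * x)" using algebraic_imp_multiple_int by blast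
    have Mx: "of_int M * x \<in> ring_of_integers F"
      using M(2) xF by (simp add: ring_of_integers_def subfld_mult[OF F(1)] subfld_of_int[OF F(1)])
    have sc: "s \<in> carrier_vec r" using step.hyps Vc by blast
    have s\<Lambda>: "s \<in> \<Lambda>" using step.hyps V(2) by blast
    have "of_int (M * N) \<cdot>\<^sub>v (w + x \<cdot>\<^sub>v s) =
        of_int M \<cdot>\<^sub>v (of_int N \<cdot>\<^sub>v w) + of_int N \<cdot>\<^sub>v ((of_int M * x) \<cdot>\<^sub>v s)"
      using sc step.hyps(1) by (intro eq_vecI) (auto simp: algebra_simps)
    also have "\<dots> \<in> \<Lambda>" by (intro \<Lambda>add \<Lambda>smult intF N(2) Mx s\<Lambda>)
    finally show ?case using M(1) N(1) by (intro exI[of _ "M * N"]) simp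
  qed
  have aniso: "qform r c w \<noteq> 0" if w: "w \<in> W" "w \<noteq> 0\<^sub>v r" for w
  proof -
    obtain N :: int where N: "N \<noteq> 0" "of_int N \<cdot>\<^sub>v w \<in> \<Lambda>" using clear[OF w(1)] by blast
    have wc: "w \<in> carrier_vec r" using w Wc by blast
    have "of_int N \<cdot>\<^sub>v w \<noteq> 0\<^sub>v r"
    proof
      assume z: "of_int N \<cdot>\<^sub>v w = 0\<^sub>v r"
      have "w = 0\<^sub>v r"
      proof (rule eq_vecI)
        fix i assume i: "i < dim_vec (0\<^sub>v r :: complex vec)"
        have "(of_int N \<cdot>\<^sub>v w) $ i = 0" using z i by simp
        then show "w $ i = 0\<^sub>v r $ i" using i wc N(1) by simp
      qed (use wc in simp)
      with w(2) show False ..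
    qed
    then have "Q (of_int N \<cdot>\<^sub>v w) \<in> positive_integers F" by (rule pos[OF N(2)])
    moreover have "restrict id F \<in> embeddings F" using abs_gal_id by (auto simp: embeddings_eq_restrict[OF F])
    ultimately have "Q (of_int N \<cdot>\<^sub>v w) \<noteq> 0"
      using subfld_0[OF F(1)] by (force simp: positive_integers_def totally_positive_def)
    moreover have "Q (of_int N \<cdot>\<^sub>v w) = (of_int N)\<^sup>2 * qform r c w"
      using c[of "of_int N \<cdot>\<^sub>v w"] N(2) \<Lambda>F qform_smult[OF wc wc] by auto
    ultimately show ?thesis by auto
  qed
  have "\<exists>s e. (\<forall>j<s. e j \<in> W \<and> qform r c (e j) \<noteq> 0) \<and>
    (\<forall>i<s. \<forall>j<s. i \<noteq> j \<longrightarrow> polar r c (e i) (e j) = 0) \<and>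
    (\<forall>v\<in>V. \<exists>d. (\<forall>j<s. d j \<in> L) \<and> v = lincomb_vec r s d e)"
    by (rule gram_schmidt[OF L(1) Wc _ _ Wzero _ _ V(1) VW]) (auto intro: Wadd Wsmult polW dest: aniso)
  then obtain s e where GS: "\<forall>j<s. e j \<in> W \<and> qform r c (e j) \<noteq> 0"
    and orth': "\<forall>i<s. \<forall>j<s. i \<noteq> j \<longrightarrow> polar r c (e i) (e j) = 0"
    and rep: "\<forall>v\<in>V. \<exists>d. (\<forall>j<s. d j \<in> L) \<and> v = lincomb_vec r s d e"
    by (elim exE conjE)
  have e: "e j \<in> W" "qform r c (e j) \<noteq> 0" if "j < s" for j using GS that by auto
  have orth: "polar r c (e i) (e j) = 0" if "i < s" "j < s" "i \<noteq> j" for i j using orth' that by simp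
  have ec: "e j \<in> carrier_vec r" if "j < s" for j using e(1)[OF that] Wc by blast
  have self: "polar r c (e j) (e j) \<noteq> 0" if "j < s" for j using e(2)[OF that] by (simp add: polar_self)
  \<comment> \<open>Here s is the dimension of W over L, which independence over L alone would not
    bound by r.\<close>
  have sr: "s \<le> r" by (rule orthogonal_le_dim[of s e r c]) (use ec orth self in auto)
  define \<phi> where "\<phi> u = lincomb_vec r s (\<lambda>j. u $ j) e" for u
  have \<phi>c: "\<phi> u \<in> carrier_vec r" for u by (simp add: \<phi>_def)
  have \<phi>add: "\<phi> (u + x \<cdot>\<^sub>v u') = \<phi> u + x \<cdot>\<^sub>v \<phi> u'" if "u \<in> carrier_vec s" "u' \<in> carrier_vec s" for u u' x
    using that by (intro eq_vecI) (auto simp: \<phi>_def lincomb_vec_def sum_distrib_left sum.distrib[symmetric]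
        algebra_simps intro!: sum.cong)
  have \<phi>zero: "\<phi> (0\<^sub>v s) = 0\<^sub>v r" by (intro eq_vecI) (auto simp: \<phi>_def lincomb_vec_def)
  \<comment> \<open>Orthogonality recovers the coordinates from the image, which makes \<phi>
    injective.\<close>
  have coord: "u $ k = polar r c (\<phi> u) (e k) / polar r c (e k) (e k)" if k: "k < s" for u k
  proof -
    have "polar r c (\<phi> u) (e k) = u $ k * polar r c (e k) (e k)"
      unfolding \<phi>_def by (rule polar_lincomb_orthogonal) (use ec orth k in auto)
    then show ?thesis using self[OF k] by simp
  qed
  have \<phi>inj: "u = u'" if "u \<in> carrier_vec s" "u' \<in> carrier_vec s" "\<phi> u = \<phi> u'" for u u'
    using that coord by (intro eq_vecI) (auto dest!: carrier_vecD)
  have \<phi>W: "\<phi> u \<in> W" if u: "u \<in> coord_space L s" for u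
  proof -
    have "lincomb_vec r t (\<lambda>j. u $ j) e \<in> W" if "t \<le> s" for t
      using that u by (induction t) (auto simp: lincomb_vec_0 lincomb_vec_Suc Wzero ec coord_space_iff intro!: Wadd Wsmult e)
    then show ?thesis by (simp add: \<phi>_def)
  qed
  have "\<forall>v\<in>V. \<exists>u\<in>coord_space L s. \<phi> u = v"
  proof
    fix v assume "v \<in> V"
    then obtain d where d: "\<forall>j<s. d j \<in> L" "v = lincomb_vec r s d e" using rep by blast
    have "vec s d \<in> coord_space L s" using d by (simp add: coord_space_iff)
    moreover have "\<phi> (vec s d) = v" unfolding \<phi>_def d(2) by (rule lincomb_vec_cong) auto
    ultimately show "\<exists>u\<in>coord_space L s. \<phi> u = v" by blast
  qed
  then obtain \<psi> where \<psi>: "\<And>v. v \<in> V \<Longrightarrow> \<psi> v \<in> coord_space L s" "\<And>v. v \<in> V \<Longrightarrow> \<phi> (\<psi> v) = v" by metis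
  define U where "U = \<psi> ` V"
  have UL: "U \<subseteq> coord_space L s" using \<psi>(1) by (auto simp: U_def)
  then have Uc: "U \<subseteq> carrier_vec s" using coord_space_carrier[of L s] by blast
  \<comment> \<open>The coordinates of V generate the lattice, rather than the unit vectors: the
    \<open>e j\<close> come from W and may lie outside \<Lambda>, whereas now \<phi> maps \<Lambda>'
    into \<Lambda> and positivity is inherited.\<close>
  define \<Lambda>' where "\<Lambda>' = span_over (ring_of_integers L) s U"
  have OL: "ring_of_integers L \<subseteq> L" "ring_of_integers L \<subseteq> ring_of_integers F"
    using L(2) by (auto simp: ring_of_integers_def)
  have \<Lambda>'L: "\<Lambda>' \<subseteq> coord_space L s" unfolding \<Lambda>'_def by (rule span_over_coord_space[OF L(1) UL OL(1)])
  have U\<Lambda>': "U \<subseteq> \<Lambda>'" using span_over_base[OF Uc additive_ring_integers[OF L(1)]] by (auto simp: \<Lambda>'_def)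
  have \<phi>\<Lambda>: "\<phi> u \<in> \<Lambda>" if u: "u \<in> \<Lambda>'" for u
    using Uc u[unfolded \<Lambda>'_def]
  proof (induction rule: span_over_induct)
    case zero
    show ?case using \<Lambda>zero by (simp add: \<phi>zero)
  next
    case (step w t x)
    have "t \<in> carrier_vec s" using step.hyps Uc by blast
    moreover have "\<phi> t \<in> \<Lambda>" using step.hyps \<psi>(2) V(2) by (auto simp: U_def)
    moreover have "x \<in> ring_of_integers F" using step.hyps OL by blast
    ultimately show ?case using \<phi>add[OF step.hyps(1), of t x] \<Lambda>add[OF step.IH] \<Lambda>smult by simp
  qed
  define Q' where "Q' u = Q (\<phi> u)" for u
  have QL: "Q (\<phi> u) = (\<Sum>j<s. qform r c (e j) * (u $ j)\<^sup>2)" if "u \<in> coord_space L s" for u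
  proof -
    have "Q (\<phi> u) = qform r c (\<phi> u)" using c \<phi>W[OF that] WF by blast
    then show ?thesis unfolding \<phi>_def by (subst (asm) qform_lincomb_orthogonal) (use ec orth in auto)
  qed
  have qeL: "qform r c (e j) \<in> L" if "j < s" for j
  proof -
    have "2 \<in> L" using subfld_of_nat[OF L(1), of 2] by simp
    then have "polar r c (e j) (e j) / 2 \<in> L" by (intro subfld_divide[OF L(1)] polW e(1) that)
    then show ?thesis by (simp add: polar_self)
  qed
  \<comment> \<open>In an orthogonal basis the form is diagonal.\<close>
  let ?c = "\<lambda>i j. if i = j then qform r c (e j) else 0"
  have "quadratic_form_on L s Q'"
    unfolding quadratic_form_on_def
  proof (rule exI[of _ ?c], intro conjI allI impI ballI)
    show "?c i j \<in> L" if "i < s" "j < s" for i j using qeL that by (simp add: subfld_0[OF L(1)])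
    fix u assume u: "u \<in> coord_space L s"
    have "(\<Sum>j<s. \<Sum>i\<le>j. ?c i j * u $ i * u $ j) = (\<Sum>j<s. qform r c (e j) * (u $ j)\<^sup>2)"
    proof (rule sum.cong[OF refl])
      fix j
      have "(\<Sum>i\<le>j. ?c i j * u $ i * u $ j) = (\<Sum>i\<le>j. if i = j then qform r c (e j) * (u $ j)\<^sup>2 else 0)"
        by (rule sum.cong) (auto simp: power2_eq_square)
      then show "(\<Sum>i\<le>j. ?c i j * u $ i * u $ j) = qform r c (e j) * (u $ j)\<^sup>2" by simp
    qed
    then show "Q' u = (\<Sum>j<s. \<Sum>i\<le>j. ?c i j * u $ i * u $ j)" using QL[OF u] by (simp add: Q'_def)
  qed
  moreover have "span_over L s \<Lambda>' = coord_space L s"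
  proof
    show "span_over L s \<Lambda>' \<subseteq> coord_space L s" by (rule span_over_coord_space[OF L(1) \<Lambda>'L order.refl])
    have \<Lambda>'c: "\<Lambda>' \<subseteq> carrier_vec s" using \<Lambda>'L coord_space_carrier[of L s] by blast
    show "coord_space L s \<subseteq> span_over L s \<Lambda>'"
    proof
      fix u assume u: "u \<in> coord_space L s"
      \<comment> \<open>V spans W by construction, so \<phi> maps the span of \<Lambda>' onto W;
        injectivity of \<phi> then gives the full coordinate space.\<close>
      have "\<exists>t\<in>span_over L s \<Lambda>'. \<phi> t = w" if w: "w \<in> W" for w
        using Vc w[unfolded W_def]
      proof (induction rule: span_over_induct)
        case zero
        show ?case using span_over_zero[OF \<Lambda>'c] \<phi>zero by blast
      next
        case (step w v x)
        then obtain t where t: "t \<in> span_over L s \<Lambda>'" "\<phi> t = w" by blast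
        have \<psi>v: "\<psi> v \<in> \<Lambda>'" using step.hyps U\<Lambda>' by (auto simp: U_def)
        have "t + x \<cdot>\<^sub>v \<psi> v \<in> span_over L s \<Lambda>'"
          using span_over_add_smult[OF \<Lambda>'c additive_ring_subfld[OF L(1)] t(1) \<psi>v] step.hyps by blast
        moreover have "\<phi> (t + x \<cdot>\<^sub>v \<psi> v) = w + x \<cdot>\<^sub>v v"
          using \<phi>add[of t "\<psi> v" x] t span_over_carrier[OF \<Lambda>'c, of L] \<psi>v \<Lambda>'c \<psi>(2) step.hyps by auto
        ultimately show ?case by blast
      qed
      then obtain t where t: "t \<in> span_over L s \<Lambda>'" "\<phi> t = \<phi> u" using \<phi>W[OF u] by blast
      then have "t = u" using \<phi>inj span_over_carrier[OF \<Lambda>'c, of L] u by (auto simp: coord_space_iff)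
      with t show "u \<in> span_over L s \<Lambda>'" by simp
    qed
  qed
  moreover have "Q' u \<in> positive_integers L" if u: "u \<in> \<Lambda>'" "u \<noteq> 0\<^sub>v s" for u
  proof -
    have uL: "u \<in> coord_space L s" using u \<Lambda>'L by blast
    have "\<phi> u \<noteq> 0\<^sub>v r" using \<phi>inj[of u "0\<^sub>v s"] \<phi>zero u(2) uL by (auto simp: coord_space_iff)
    then have "Q (\<phi> u) \<in> positive_integers F" by (rule pos[OF \<phi>\<Lambda>[OF u(1)]])
    moreover have "Q (\<phi> u) \<in> L" unfolding QL[OF uL]
      using uL qeL by (auto simp: power2_eq_square coord_space_iff intro!: subfld_sum[OF L(1)] subfld_mult[OF L(1)])
    ultimately show ?thesis using positive_integers_subfield[OF F L] by (simp add: Q'_def)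
  qed
  ultimately have "tp_quadratic_lattice L s \<Lambda>' Q'"
    unfolding tp_quadratic_lattice_def \<Lambda>'_def using UL V(1) by (auto simp: U_def)
  moreover have "represents \<Lambda>' Q' (Q v)" if v: "v \<in> V" for v
    unfolding represents_def using \<psi>(2)[OF v] U\<Lambda>' v by (intro bexI[of _ "\<psi> v"]) (auto simp: Q'_def U_def)
  ultimately show ?thesis using sr by blast
qed

section \<open>The bound B and the rank estimate\<close>

lemma card_gal_orbit_le_embeddings:
  assumes F: "subfld F" "F \<subseteq> Qbar" "finite (embeddings F)" and x: "x \<in> F"
  shows "card (gal_orbit x) \<le> card (embeddings F)"
proof -
  have "gal_orbit x = (\<lambda>\<sigma>. \<sigma> x) ` embeddings F"
    using x by (auto simp: gal_orbit_def embeddings_eq_restrict[OF F(1,2)] image_image)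
  then show ?thesis using card_image_le[OF F(3)] by simp
qed

theorem theorem3p1:
  fixes k l m n :: nat and L :: "complex set" and a :: "nat \<Rightarrow> complex"
  assumes "k > 0" "l > 0" "m > 0" "n > 0"
    and "k = 3 \<or> k \<ge> 5"
    and "galois_number_field L" "totally_real L"
    and "field_degree L = l"
    and "galois_group L \<cong> integer_mod_group l"
    and "\<forall>i\<in>{1..n}. a i \<in> positive_integers L"
    and "\<forall>r \<Lambda> Q. tp_quadratic_lattice L r \<Lambda> Q \<and> (\<forall>i\<in>{1..n}. represents \<Lambda> Q (a i)) \<longrightarrow> r \<ge> m"
  shows "\<exists>B::real. B > 0 \<and>
    (\<forall>K. number_field K \<and> totally_real K \<and> field_degree K = k \<and>
       real_of_int (field_disc K) > B \<and> coprime (field_disc K) (field_disc L) \<and>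
       galois_group (galois_closure K) \<cong> sym_group k \<longrightarrow>
       field_degree (compositum K L) = k * l \<and>
       min_universal_rank (compositum K L) \<ge> enat m)"
proof -
  have Lnf: "number_field L" using assms(6) by (simp add: galois_number_field_def)
  note L = number_field_subfld[OF Lnf] number_field_Qbar[OF Lnf]
  have aL: "a i \<in> L" if "i \<in> {1..n}" for i
    using assms(10) that by (auto simp: positive_integers_def ring_of_integers_def)
  \<comment> \<open>The bound 2 |g(a i)| + 2 |g(a j)| for the conjugates of Q(v i + v j) has to be
    at most C for all i, j and g. Summing over all conjugates of all a i and taking the factor 4
    makes each half at most C / 2.\<close>
  define C where "C = 4 * (\<Sum>i\<in>{1..n}. \<Sum>y\<in>gal_orbit (a i). cmod y)"
  have C: "4 * cmod (g (a i)) \<le> C" if g: "g \<in> abs_gal" and i: "i \<in> {1..n}" for g i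
  proof -
    have "finite (gal_orbit (a i))" using finite_gal_orbit aL[OF i] L(2) by blast
    moreover have "g (a i) \<in> gal_orbit (a i)" using g by (auto simp: gal_orbit_def)
    ultimately have "cmod (g (a i)) \<le> (\<Sum>y\<in>gal_orbit (a i). cmod y)" by (intro member_le_sum) auto
    also have "\<dots> \<le> (\<Sum>i\<in>{1..n}. \<Sum>y\<in>gal_orbit (a i). cmod y)"
      using i by (intro member_le_sum[of i "{1..n}" "\<lambda>i. \<Sum>y\<in>gal_orbit (a i). cmod y"]) (auto intro: sum_nonneg)
    finally show ?thesis by (simp add: C_def)
  qed
  \<comment> \<open>The number k * l is the degree of the compositum, which bounds the number of
    conjugates of each of its elements.\<close>
  define Bad where "Bad = {K. subfld K \<and> (\<exists>x. algebraic_int x \<and> card (gal_orbit x) \<le> k * l \<and>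
    (\<forall>y\<in>gal_orbit x. cmod y \<le> C) \<and> K \<subseteq> adjoin L x)}"
  have fin: "finite Bad" unfolding Bad_def by (rule finite_exceptional_fields[OF Lnf])
  \<comment> \<open>The sum dominates the discriminant of each exceptional field; the summand 1
    makes B positive even if there is none.\<close>
  define B where "B = 1 + (\<Sum>K\<in>Bad. \<bar>real_of_int (field_disc K)\<bar>)"
  have "(\<Sum>K\<in>Bad. \<bar>real_of_int (field_disc K)\<bar>) \<ge> 0" by (rule sum_nonneg) simp
  then have B0: "B > 0" unfolding B_def by linarith
  have good: "K \<notin> Bad" if K: "real_of_int (field_disc K) > B" for K
  proof
    assume "K \<in> Bad"
    then have "\<bar>real_of_int (field_disc K)\<bar> \<le> (\<Sum>K\<in>Bad. \<bar>real_of_int (field_disc K)\<bar>)"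
      using fin by (intro member_le_sum) auto
    with K show False by (simp add: B_def)
  qed
  have "field_degree (compositum K L) = k * l \<and> min_universal_rank (compositum K L) \<ge> enat m"
    if K: "number_field K" "field_degree K = k" "real_of_int (field_disc K) > B"
      "galois_group (galois_closure K) \<cong> sym_group k" for K
  proof -
    note KQ = number_field_subfld[OF K(1)] number_field_Qbar[OF K(1)]
    let ?F = "compositum K L"
    note F = compositum_subfld[of K L] compositum_Qbar[OF KQ(2) L(2)]
    have three: "card (embeddings K) \<ge> 3" using number_field_degree(1)[OF K(1)] K(2) assms(5) by auto
    interpret SA: symmetric_and_abelian K L
    proof (rule symmetric_and_abelian.intro)
      show "subfld K" "K \<subseteq> Qbar" "subfld L" "L \<subseteq> Qbar" by (fact KQ L)+
      show "g x \<in> L" if "g \<in> abs_gal" "x \<in> L" for g x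
        by (rule galois_number_field_stable[OF assms(6) that])
      show "g (h x) = h (g x)" if "g \<in> abs_gal" "h \<in> abs_gal" "x \<in> L" for g h x
        by (rule galois_group_cyclic_commute[OF assms(6,9) that])
      show "\<exists>g\<in>abs_gal. \<forall>\<sigma>\<in>embeddings K. \<forall>x\<in>K. g (\<sigma> x) = \<pi> \<sigma> x" if "\<pi> permutes embeddings K" for \<pi>
        by (rule symmetric_galois_group_realizes[OF K(1,2,4) that])
      show "card (embeddings K) \<ge> 3" by (fact three)
    qed
    have cardF: "card (embeddings ?F) = k * l"
      using SA.card_embeddings_compositum number_field_degree(1)[OF K(1)] number_field_degree(1)[OF Lnf]
        K(2) assms(8) by simp
    obtain A A' where A: "determined_by K A" "determined_by L A'"
      using number_field_determined[OF K(1)] number_field_determined[OF Lnf] by blast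
    note det = compositum_determined[OF KQ(2) A(1) L(2) A(2)]
    have deg: "field_degree ?F = k * l" using number_field_of_determined(2)[OF F det] cardF by simp
    have "m \<le> r" if univ: "universal_lattice ?F r \<Lambda> Q" for r \<Lambda> Q
    proof -
      have lat: "tp_quadratic_lattice ?F r \<Lambda> Q" using univ by (simp add: universal_lattice_def)
      \<comment> \<open>Embeddings of the compositum restrict to embeddings of L, so the a i remain
        totally positive and a universal lattice represents them.\<close>
      have pos: "a i \<in> positive_integers ?F" if i: "i \<in> {1..n}" for i
      proof -
        have ai: "a i \<in> positive_integers L" using assms(10) i by blast
        have "\<sigma> (a i) \<in> \<real> \<and> Re (\<sigma> (a i)) > 0" if \<sigma>: "\<sigma> \<in> embeddings ?F" for \<sigma>
        proof -
          obtain g where g: "g \<in> abs_gal" "\<sigma> = restrict g ?F" using \<sigma> by (auto simp: embeddings_eq_restrict[OF F])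
          have "restrict g L \<in> embeddings L" using g(1) by (auto simp: embeddings_eq_restrict[OF L])
          then have "restrict g L (a i) \<in> \<real> \<and> Re (restrict g L (a i)) > 0"
            using ai by (auto simp: positive_integers_def totally_positive_def)
          moreover have "a i \<in> ?F" using aL[OF i] compositum_base(2)[of L K] by blast
          ultimately show ?thesis using g(2) aL[OF i] by simp
        qed
        moreover have "a i \<in> ?F" using aL[OF i] compositum_base(2)[of L K] by blast
        ultimately show ?thesis using ai
          by (auto simp: positive_integers_def totally_positive_def ring_of_integers_def)
      qed
      have "\<forall>i\<in>{1..n}. \<exists>v\<in>\<Lambda>. Q v = a i"
        using univ pos by (auto simp: universal_lattice_def represents_def)
      then obtain v where v: "\<And>i. i \<in> {1..n} \<Longrightarrow> v i \<in> \<Lambda>" "\<And>i. i \<in> {1..n} \<Longrightarrow> Q (v i) = a i" by metis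
      obtain c where \<Lambda>F: "\<Lambda> \<subseteq> coord_space ?F r" and "0\<^sub>v r \<in> \<Lambda>"
        and \<Lambda>add: "\<And>v w. v \<in> \<Lambda> \<Longrightarrow> w \<in> \<Lambda> \<Longrightarrow> v + w \<in> \<Lambda>"
        and "\<And>v x. v \<in> \<Lambda> \<Longrightarrow> x \<in> ring_of_integers ?F \<Longrightarrow> x \<cdot>\<^sub>v v \<in> \<Lambda>"
        and c: "\<And>v. v \<in> coord_space ?F r \<Longrightarrow> Q v = qform r c v"
        and Qpos: "\<And>v. v \<in> \<Lambda> \<Longrightarrow> v \<noteq> 0\<^sub>v r \<Longrightarrow> Q v \<in> positive_integers ?F"
        by (fact tp_quadratic_latticeE[OF F(1) lat])
      have sums: "Q (v i + v j) \<in> L" if ij: "i \<in> {1..n}" "j \<in> {1..n}" for i j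
      proof (rule ccontr)
        let ?\<alpha> = "Q (v i + v j)"
        assume notL: "?\<alpha> \<notin> L"
        have mem: "v i + v j \<in> \<Lambda>" by (intro \<Lambda>add v ij)
        \<comment> \<open>The zero vector has value 0, which lies in L.\<close>
        have "v i + v j \<noteq> 0\<^sub>v r"
        proof
          assume z: "v i + v j = 0\<^sub>v r"
          have "?\<alpha> = 0" using c[of "v i + v j"] mem \<Lambda>F unfolding z by (auto simp: qform_zero)
          with notL show False by (simp add: subfld_0[OF L(1)])
        qed
        then have "?\<alpha> \<in> positive_integers ?F" by (rule Qpos[OF mem])
        then have \<alpha>: "?\<alpha> \<in> ?F" "algebraic_int ?\<alpha>" by (auto simp: positive_integers_def ring_of_integers_def)
        \<comment> \<open>A value outside L would make K a subfield of L(\<alpha>) for one of the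
          finitely many bounded integers, so K would be exceptional despite its large
          discriminant.\<close>
        have "K \<subseteq> adjoin L ?\<alpha>" by (rule SA.subset_adjoin_of_not_mem[OF \<alpha>(1) notL])
        moreover have "card (gal_orbit ?\<alpha>) \<le> k * l"
          using card_gal_orbit_le_embeddings[OF F finite_embeddings[OF F det] \<alpha>(1)] cardF by simp
        moreover have "cmod y \<le> C" if y: "y \<in> gal_orbit ?\<alpha>" for y
        proof -
          obtain g where g: "g \<in> abs_gal" "y = g ?\<alpha>" using y by (auto simp: gal_orbit_def)
          have "cmod y \<le> 2 * cmod (g (Q (v i))) + 2 * cmod (g (Q (v j)))"
            unfolding g(2) by (rule lattice_conjugate_bound[OF F lat g(1) v(1)[OF ij(1)] v(1)[OF ij(2)]])
          then show ?thesis using C[OF g(1) ij(1)] C[OF g(1) ij(2)] v(2) ij by simp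
        qed
        ultimately have "K \<in> Bad" unfolding Bad_def using KQ(1) \<alpha>(2) by blast
        with good[OF K(3)] show False ..
      qed
      have "\<exists>s \<Lambda>' Q'. s \<le> r \<and> tp_quadratic_lattice L s \<Lambda>' Q' \<and> (\<forall>x\<in>v ` {1..n}. represents \<Lambda>' Q' (Q x))"
        by (rule lattice_descent[OF F L(1) compositum_base(2)[of L K] lat]) (use v aL sums in auto)
      then obtain s \<Lambda>' Q' where s: "s \<le> r" "tp_quadratic_lattice L s \<Lambda>' Q'"
        "\<forall>i\<in>{1..n}. represents \<Lambda>' Q' (a i)" using v(2) by auto
      then have "m \<le> s" using assms(11) by blast
      with s(1) show ?thesis by simp
    qed
    \<comment> \<open>As an infimum in the extended naturals this also covers the case of no
      universal lattice, where the value is infinite.\<close>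
    then have "min_universal_rank ?F \<ge> enat m"
      unfolding min_universal_rank_def by (intro Inf_greatest) auto
    with deg show ?thesis by blast
  qed
  with B0 show ?thesis by (intro exI[of _ B]) auto
qed

end
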